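(* Let $V$ be a finite-dimensional vector space over $\Bbbk$ (of even dimension) equipped with a non-degenerate skew-symmetric bilinear form. Then the representation $(Sp(V):\wedge^2V)$ of $Sp(V)$ on the exterior square of $V$ has GNIB.
   Context: The ground field $\Bbbk$ is algebraically closed of characteristic zero. For a Lie algebra $\mathfrak q$ and a finite-dimensional $\mathfrak q$-module $U$, the index is $\mathrm{ind}(\mathfrak q,U)=\dim U-\max_{\xi\in U^*}\dim(\mathfrak q\cdot\xi)$. For a rational representation $(G:U)$ of a reductive group $G$ with Lie algebra $\mathfrak g$, a vector $v\in U$ is nilpotent if $0\in\overline{G\cdot v}$; $\mathfrak g_v$ is the stabiliser of $v$ in $\mathfrak g$, and $U/\mathfrak g\cdot v$ is a $\mathfrak g_v$-module. $(G:U)$ has good nilpotent index behaviour (GNIB) if $\mathrm{ind}(\mathfrak g,U^* )=\mathrm{ind}(\mathfrak g_v,(U/\mathfrak g\cdot v)^* )$ for every nilpotent $v\in U$. (The representation in question is the isotropy representation of the symmetric pair $(GL(V),Sp(V))$.) *)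

theory Defs
  imports "HOL-Algebra.AbelCoset" "Jordan_Normal_Form.VS_Connect" "HOL-Library.Poly_Mapping"
begin

text \<open>
  The ground field is a type \<open>'k\<close>, seen as the record \<open>class_ring\<close>; vector spaces over it are
  records \<open>U\<close> with \<open>vectorspace class_ring U\<close>. The ring multiplication and unit which such records
  also contain play no role and are filled with dummies.
\<close>

section \<open>Linear maps, duals, quotients\<close>

definition scalars :: "('k::field, 'k) module" where
  "scalars = \<lparr>carrier = UNIV, mult = (*), one = 1, zero = 0, add = (+), smult = (*)\<rparr>"

definition endos :: "('k::field, 'u) module \<Rightarrow> ('u \<Rightarrow> 'u) set" where
  "endos U = LinearCombinations.module_hom class_ring U U \<inter> extensional (carrier U)"

definition dual :: "('k::field, 'u) module \<Rightarrow> ('k, 'u \<Rightarrow> 'k) module" where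
  "dual U = (ring.func_space class_ring (carrier U))
     \<lparr>carrier := LinearCombinations.module_hom class_ring U scalars \<inter> extensional (carrier U)\<rparr>"

text \<open>
  \<open>U / S\<close>, realised by cosets. In \<open>quot\<close> and \<open>quot_act\<close>, the union over all representatives \<open>u\<close>
  of the coset \<open>C\<close> is a union of equal cosets if \<open>S\<close> is a subspace that is stable under
  the operation; so \<open>c\<close> maps \<open>S + u\<close> to \<open>S + c u\<close>, also for \<open>c = 0\<close>.
\<close>

definition quot :: "('k::field, 'u) module \<Rightarrow> 'u set \<Rightarrow> ('k, 'u set) module" where
  "quot U S = \<lparr>carrier = a_rcosets\<^bsub>U\<^esub> S, mult = (\<lambda>_ _. S), one = S, zero = S,
     add = set_add U, smult = (\<lambda>c C. \<Union>u\<in>C. S +>\<^bsub>U\<^esub> (c \<odot>\<^bsub>U\<^esub> u))\<rparr>"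

definition quot_act ::
  "('k::field, 'u) module \<Rightarrow> 'u set \<Rightarrow> ('x \<Rightarrow> 'u \<Rightarrow> 'u) \<Rightarrow> 'x \<Rightarrow> 'u set \<Rightarrow> 'u set" where
  "quot_act U S act x C = (\<Union>u\<in>C. S +>\<^bsub>U\<^esub> act x u)"

section \<open>Index of a module over a Lie algebra\<close>

text \<open>
  A Lie algebra is given by its set \<open>q\<close> of elements, and a \<open>q\<close>-module by a vector space \<open>U\<close> with
  an action \<open>act\<close>; the bracket does not occur in the definition of the index.
\<close>

definition orbit :: "'x set \<Rightarrow> ('x \<Rightarrow> 'u \<Rightarrow> 'u) \<Rightarrow> 'u \<Rightarrow> 'u set" where
  "orbit X act u = (\<lambda>x. act x u) ` X"

definition lie_stabiliser ::
  "'x set \<Rightarrow> ('x \<Rightarrow> 'u \<Rightarrow> 'u) \<Rightarrow> ('k::field, 'u) module \<Rightarrow> 'u \<Rightarrow> 'x set" where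
  "lie_stabiliser q act U v = {x \<in> q. act x v = \<zero>\<^bsub>U\<^esub>}"

definition dual_act ::
  "('k::field, 'u) module \<Rightarrow> ('x \<Rightarrow> 'u \<Rightarrow> 'u) \<Rightarrow> 'x \<Rightarrow> ('u \<Rightarrow> 'k) \<Rightarrow> ('u \<Rightarrow> 'k)" where
  "dual_act U act x f = (\<lambda>u\<in>carrier U. - f (act x u))"

definition ind :: "'x set \<Rightarrow> ('x \<Rightarrow> 'u \<Rightarrow> 'u) \<Rightarrow> ('k::field, 'u) module \<Rightarrow> int" where
  "ind q act U = int (vectorspace.dim class_ring U) -
     int (MAX \<xi>\<in>carrier (dual U).
       vectorspace.dim class_ring ((dual U)\<lparr>carrier := orbit q (dual_act U act) \<xi>\<rparr>))"

section \<open>Nilpotent vectors\<close>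

inductive_set poly_fun :: "('k::field, 'u) module \<Rightarrow> ('u \<Rightarrow> 'k) set"
  for U :: "('k, 'u) module" where
  "(\<lambda>_. c) \<in> poly_fun U"
| "f \<in> carrier (dual U) \<Longrightarrow> f \<in> poly_fun U"
| "p \<in> poly_fun U \<Longrightarrow> q \<in> poly_fun U \<Longrightarrow> (\<lambda>u. p u + q u) \<in> poly_fun U"
| "p \<in> poly_fun U \<Longrightarrow> q \<in> poly_fun U \<Longrightarrow> (\<lambda>u. p u * q u) \<in> poly_fun U"

definition zariski_closed :: "('k::field, 'u) module \<Rightarrow> 'u set \<Rightarrow> bool" where
  "zariski_closed U Z \<longleftrightarrow> (\<exists>P \<subseteq> poly_fun U. Z = {u \<in> carrier U. \<forall>p\<in>P. p u = 0})"

definition zariski_closure :: "('k::field, 'u) module \<Rightarrow> 'u set \<Rightarrow> 'u set" where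
  "zariski_closure U S = \<Inter>{Z. zariski_closed U Z \<and> S \<subseteq> Z}"

definition nilpotent_vector ::
  "'g set \<Rightarrow> ('g \<Rightarrow> 'u \<Rightarrow> 'u) \<Rightarrow> ('k::field, 'u) module \<Rightarrow> 'u \<Rightarrow> bool" where
  "nilpotent_vector G act U v \<longleftrightarrow>
     v \<in> carrier U \<and> \<zero>\<^bsub>U\<^esub> \<in> zariski_closure U (orbit G act v)"

section \<open>Good nilpotent index behaviour\<close>

text \<open>
  The group \<open>G\<close> acts on \<open>U\<close> by \<open>Act\<close>; \<open>g\<close> is the Lie algebra of \<open>G\<close> and \<open>act\<close> is the
  differential of \<open>Act\<close>.
\<close>

definition gnib ::
  "'g set \<Rightarrow> ('g \<Rightarrow> 'u \<Rightarrow> 'u) \<Rightarrow> 'x set \<Rightarrow> ('x \<Rightarrow> 'u \<Rightarrow> 'u) \<Rightarrow> ('k::field, 'u) module \<Rightarrow> bool" where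
  "gnib G Act g act U \<longleftrightarrow>
     (\<forall>v. nilpotent_vector G Act U v \<longrightarrow>
        (let gv = orbit g act v; Q = quot U gv in
          ind g (dual_act U act) (dual U) =
          ind (lie_stabiliser g act U v) (dual_act Q (quot_act U gv act)) (dual Q)))"

section \<open>The symplectic group and its Lie algebra\<close>

definition symplectic_form :: "('k::field, 'v) module \<Rightarrow> ('v \<Rightarrow> 'v \<Rightarrow> 'k) \<Rightarrow> bool" where
  "symplectic_form V \<omega> \<longleftrightarrow>
     (\<forall>v\<in>carrier V. \<omega> v \<in> LinearCombinations.module_hom class_ring V scalars \<and>
        (\<lambda>u. \<omega> u v) \<in> LinearCombinations.module_hom class_ring V scalars) \<and>
     (\<forall>v\<in>carrier V. \<forall>w\<in>carrier V. \<omega> v w = - \<omega> w v) \<and>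
     (\<forall>v\<in>carrier V. (\<forall>w\<in>carrier V. \<omega> v w = 0) \<longrightarrow> v = \<zero>\<^bsub>V\<^esub>)"

definition Sp_group :: "('k::field, 'v) module \<Rightarrow> ('v \<Rightarrow> 'v \<Rightarrow> 'k) \<Rightarrow> ('v \<Rightarrow> 'v) set" where
  "Sp_group V \<omega> = {g \<in> endos V. bij_betw g (carrier V) (carrier V) \<and>
     (\<forall>v\<in>carrier V. \<forall>w\<in>carrier V. \<omega> (g v) (g w) = \<omega> v w)}"

definition sp_algebra :: "('k::field, 'v) module \<Rightarrow> ('v \<Rightarrow> 'v \<Rightarrow> 'k) \<Rightarrow> ('v \<Rightarrow> 'v) set" where
  "sp_algebra V \<omega> = {x \<in> endos V.
     \<forall>v\<in>carrier V. \<forall>w\<in>carrier V. \<omega> (x v) w + \<omega> v (x w) = 0}"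

section \<open>The exterior square\<close>

text \<open>
  The exterior square of \<open>V\<close> is the quotient of the free vector space on \<open>V \<times> V\<close> (finitely
  supported functions, \<open>single (v, w) 1\<close> being the generator that becomes the wedge product of
  \<open>v\<close> and \<open>w\<close>) by the relations of bilinearity and alternation.
\<close>

definition free_vs :: "'b set \<Rightarrow> ('k::field, 'b \<Rightarrow>\<^sub>0 'k) module" where
  "free_vs B = \<lparr>carrier = {f. Poly_Mapping.keys f \<subseteq> B}, mult = (\<lambda>_ _. 0), one = 0, zero = 0,
     add = (+), smult = (\<lambda>c. Poly_Mapping.map ((*) c))\<rparr>"

abbreviation gen :: "'v \<Rightarrow> 'v \<Rightarrow> ('v \<times> 'v) \<Rightarrow>\<^sub>0 'k::field" where
  "gen v w \<equiv> Poly_Mapping.single (v, w) 1"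

definition ext_relations :: "('k::field, 'v) module \<Rightarrow> (('v \<times> 'v) \<Rightarrow>\<^sub>0 'k) set" where
  "ext_relations V =
     {gen (u \<oplus>\<^bsub>V\<^esub> v) w - gen u w - gen v w | u v w.
        u \<in> carrier V \<and> v \<in> carrier V \<and> w \<in> carrier V} \<union>
     {gen w (u \<oplus>\<^bsub>V\<^esub> v) - gen w u - gen w v | u v w.
        u \<in> carrier V \<and> v \<in> carrier V \<and> w \<in> carrier V} \<union>
     {gen (c \<odot>\<^bsub>V\<^esub> v) w - Poly_Mapping.single (v, w) c | c v w.
        v \<in> carrier V \<and> w \<in> carrier V} \<union>
     {gen v (c \<odot>\<^bsub>V\<^esub> w) - Poly_Mapping.single (v, w) c | c v w.
        v \<in> carrier V \<and> w \<in> carrier V} \<union>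
     {gen v v | v. v \<in> carrier V}"

definition ext_rel_space :: "('k::field, 'v) module \<Rightarrow> (('v \<times> 'v) \<Rightarrow>\<^sub>0 'k) set" where
  "ext_rel_space V = LinearCombinations.module.span class_ring
     (free_vs (carrier V \<times> carrier V)) (ext_relations V)"

definition ext2 :: "('k::field, 'v) module \<Rightarrow> ('k, (('v \<times> 'v) \<Rightarrow>\<^sub>0 'k) set) module" where
  "ext2 V = quot (free_vs (carrier V \<times> carrier V)) (ext_rel_space V)"

text \<open>
  The actions on the exterior square are induced by the linear maps of the free space with
  \<open>gen v w \<mapsto> gen (g v) (g w)\<close> and \<open>gen v w \<mapsto> gen (x v) w + gen v (x w)\<close>, respectively.
\<close>

definition free_group_act ::
  "('v \<Rightarrow> 'v) \<Rightarrow> (('v \<times> 'v) \<Rightarrow>\<^sub>0 'k::field) \<Rightarrow> (('v \<times> 'v) \<Rightarrow>\<^sub>0 'k)" where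
  "free_group_act g f = (\<Sum>(v, w)\<in>Poly_Mapping.keys f.
     Poly_Mapping.single (g v, g w) (Poly_Mapping.lookup f (v, w)))"

definition free_lie_act ::
  "('v \<Rightarrow> 'v) \<Rightarrow> (('v \<times> 'v) \<Rightarrow>\<^sub>0 'k::field) \<Rightarrow> (('v \<times> 'v) \<Rightarrow>\<^sub>0 'k)" where
  "free_lie_act x f = (\<Sum>(v, w)\<in>Poly_Mapping.keys f.
     Poly_Mapping.single (x v, w) (Poly_Mapping.lookup f (v, w)) +
     Poly_Mapping.single (v, x w) (Poly_Mapping.lookup f (v, w)))"

definition ext2_group_act :: "('k::field, 'v) module \<Rightarrow> ('v \<Rightarrow> 'v) \<Rightarrow>
    (('v \<times> 'v) \<Rightarrow>\<^sub>0 'k) set \<Rightarrow> (('v \<times> 'v) \<Rightarrow>\<^sub>0 'k) set" where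
  "ext2_group_act V = quot_act (free_vs (carrier V \<times> carrier V)) (ext_rel_space V) free_group_act"

definition ext2_lie_act :: "('k::field, 'v) module \<Rightarrow> ('v \<Rightarrow> 'v) \<Rightarrow>
    (('v \<times> 'v) \<Rightarrow>\<^sub>0 'k) set \<Rightarrow> (('v \<times> 'v) \<Rightarrow>\<^sub>0 'k) set" where
  "ext2_lie_act V = quot_act (free_vs (carrier V \<times> carrier V)) (ext_rel_space V) free_lie_act"

end

theory Submission
  imports Defs "HOL-Library.Function_Algebras"
begin

text \<open>
  Put \<open>U = \<Lambda>^2 V\<close>, \<open>g = sp(V)\<close> and
  \<open>n = dim V / 2\<close>. After the identification of \<open>U\<close> with its double dual, the left-hand side is the
  minimal codimension of \<open>g z\<close> in \<open>U\<close> and the right-hand side is the minimal codimension of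
  \<open>g v + g_v u\<close>. Both are \<open>n\<close>: no \<open>g z\<close> has codimension below \<open>n\<close>; some \<open>g v + g_v u\<close> has
  codimension at most \<open>n\<close>; and \<open>g v + g_v u\<close> is never bigger than \<open>g (v + t u)\<close> for generic \<open>t\<close>.

  For the first two claims, \<open>\<Sum> c a \<and> b\<close> corresponds to the self-adjoint operator
  \<open>e w = \<Sum> c (\<omega>(w, a) b - \<omega>(w, b) a)\<close>, functionals on \<open>U\<close> are alternating forms \<open>\<beta>\<close>, and \<open>\<beta>\<close> vanishes on
  \<open>g v\<close> iff \<open>\<beta>(e a, b) = \<beta>(a, e b)\<close>. The space \<open>V\<close> is an orthogonal sum of pieces
  \<open>k[e] v \<oplus> k[e] v'\<close> of dimension \<open>2 d\<close>; each of them contributes the \<open>d\<close> independent forms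
  \<open>\<omega>(e^i a, b)\<close>, which gives the first claim. For the second one \<open>u\<close> is a generic
  combination of the bivectors \<open>v \<and> v'\<close>: the condition that \<open>\<beta>\<close> vanishes on \<open>g_v u\<close> then kills the
  values of \<open>\<beta>\<close> between different pieces.
\<close>

section \<open>Linear algebra over an algebraically closed field of characteristic zero\<close>

text \<open>No Jordan form is used. A piece is given by a vector \<open>v\<close> whose annihilator
  is the minimal polynomial \<open>m\<close> of \<open>e\<close>, of degree \<open>d\<close>, and by
  a \<open>v'\<close> that pairs to 1 with \<open>e^(d-1) v\<close> and to 0 with the lower powers.
  The pairing of \<open>e^i v\<close> with \<open>e^j v'\<close> depends on \<open>i + j\<close>
  only; it is 0 for \<open>i + j < d - 1\<close> and 1 for \<open>i + j = d - 1\<close>. So the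
  piece is nondegenerate, and induction applies to its orthogonal complement.

  The obstacle is to write down elements of the stabiliser that mix a piece with the rest. The
  Bezoutian of \<open>m\<close> supplies an operator commuting with \<open>e\<close> for any two
  vectors \<open>p\<close> and \<open>q\<close> annihilated by \<open>m\<close>; hence a piece with
  the full minimal polynomial has to be split off first. For \<open>p\<close> in the complement and
  \<open>q\<close> one of \<open>v\<close> and \<open>v'\<close>, the resulting element moves
  \<open>v \<and> v'\<close> to \<open>p \<and> q\<close>, but it also moves the remaining part
  \<open>t us\<close> of the bivector. Together the condition reads
  \<open>\<beta>(q, p + t R p) = 0\<close> for an operator \<open>R\<close> of the complement, and
  the generic coefficients are there to make \<open>1 + t R\<close> invertible.\<close>

locale char0_space = vector_space scale
  for scale :: "'a::{alg_closed_field,field_char_0} \<Rightarrow> 'b::ab_group_add \<Rightarrow> 'b" (infixr \<open>*s\<close> 75)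
begin

abbreviation lin :: "('b \<Rightarrow> 'b) \<Rightarrow> bool" where "lin \<equiv> Vector_Spaces.linear scale scale"
abbreviation linf :: "('b \<Rightarrow> 'a) \<Rightarrow> bool" where "linf \<equiv> Vector_Spaces.linear scale (*)"

lemma vs_field: "vector_space ((*) :: 'a \<Rightarrow> 'a \<Rightarrow> 'a)"
  by unfold_locales (auto simp: algebra_simps)

lemma linI:
  assumes "\<And>x y. f (x + y) = f x + f y" "\<And>c x. f (c *s x) = c *s f x"
  shows "lin f"
  using assms by (simp add: Vector_Spaces.linear_iff vector_space_axioms)

lemma linfI:
  assumes "\<And>x y. f (x + y) = f x + f y" "\<And>c x. f (c *s x) = c * f x"
  shows "linf f"
  using assms by (simp add: Vector_Spaces.linear_iff vector_space_axioms vs_field)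

lemma
  assumes "lin f"
  shows lin_add: "f (x + y) = f x + f y"
    and lin_scale: "f (c *s x) = c *s f x"
    and lin_zero: "f 0 = 0"
    and lin_diff: "f (x - y) = f x - f y"
    and lin_sum: "f (sum g A) = (\<Sum>i\<in>A. f (g i))"
proof -
  interpret Vector_Spaces.linear scale scale f by fact
  show "f (x + y) = f x + f y" "f (c *s x) = c *s f x" "f 0 = 0" "f (x - y) = f x - f y"
    "f (sum g A) = (\<Sum>i\<in>A. f (g i))"
    by (simp_all add: add scale diff sum)
qed

lemma
  assumes "linf f"
  shows linf_add: "f (x + y) = f x + f y"
    and linf_scale: "f (c *s x) = c * f x"
    and linf_zero: "f 0 = 0"
    and linf_diff: "f (x - y) = f x - f y"
    and linf_neg: "f (- x) = - f x"
    and linf_sum: "f (sum g A) = (\<Sum>i\<in>A. f (g i))"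
proof -
  interpret Vector_Spaces.linear scale "(*)" f by fact
  show "f (x + y) = f x + f y" "f (c *s x) = c * f x" "f 0 = 0" "f (x - y) = f x - f y"
    "f (- x) = - f x" "f (sum g A) = (\<Sum>i\<in>A. f (g i))"
    by (simp_all add: add scale diff neg sum)
qed

lemma lin_funpow: "lin e \<Longrightarrow> lin (e ^^ i)"
proof (induction i)
  case (Suc i)
  then show ?case by (intro linI) (simp_all add: lin_add lin_scale)
qed (simp add: linI)

lemma funpow_mem: "e ` S \<subseteq> S \<Longrightarrow> w \<in> S \<Longrightarrow> (e ^^ i) w \<in> S"
  by (induction i) auto

section \<open>Functionals and bounds for dimensions\<close>

lemma linf_vanish_span:
  assumes "linf f" "\<And>b. b \<in> B \<Longrightarrow> f b = 0" "x \<in> span B" shows "f x = 0"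
  using assms(3)
  by (induction rule: span_induct_alt) (simp_all add: assms linf_add linf_scale linf_zero)

lemma linf_separates:
  assumes "x \<notin> span B"
  obtains f where "linf f" "\<And>b. b \<in> B \<Longrightarrow> f b = 0" "f x = 1"
proof -
  interpret p: vector_space_pair scale "(*) :: 'a \<Rightarrow> 'a \<Rightarrow> 'a"
    by (rule vector_space_pair.intro[OF vector_space_axioms vs_field])
  obtain C where C: "C \<subseteq> B" "independent C" "B \<subseteq> span C"
    using maximal_independent_subset by blast
  have "x \<notin> span C"
    using assms C(1) span_mono by blast
  then have ind: "independent (insert x C)"
    using C(2) independent_insertI by blast
  obtain f where f: "linf f" "\<forall>y\<in>insert x C. f y = (if y = x then 1 else 0)"
    using p.linear_independent_extend[OF ind, of "\<lambda>y. if y = x then 1 else 0"] by metis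
  have "x \<notin> C" using \<open>x \<notin> span C\<close> span_base[of x C] by metis
  then have "\<And>b. b \<in> C \<Longrightarrow> f b = 0" using f(2) by auto
  then have "\<And>b. b \<in> B \<Longrightarrow> f b = 0" using linf_vanish_span[OF f(1)] C(3) by blast
  then show thesis using that f by auto
qed

text \<open>Finiteness is asked of subspaces and not of the type, because the ambient spaces will be
  spaces of all functions on a possibly infinite type.\<close>

definition fin_span :: "'b set \<Rightarrow> bool" where
  "fin_span S \<longleftrightarrow> (\<exists>B. finite B \<and> S \<subseteq> span B)"

lemma fin_spanE:
  assumes "fin_span S"
  obtains B where "finite B" "B \<subseteq> S" "independent B" "S \<subseteq> span B" "card B = dim S"
proof -
  obtain B where B: "B \<subseteq> S" "independent B" "S \<subseteq> span B" "card B = dim S"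
    using basis_exists by blast
  obtain A where "finite A" "S \<subseteq> span A" using assms fin_span_def by auto
  then have "finite B" using independent_span_bound[of A B] B by auto
  then show thesis using that B by auto
qed

lemma fin_span_subset: "fin_span S \<Longrightarrow> T \<subseteq> S \<Longrightarrow> fin_span T"
  unfolding fin_span_def by blast

lemma independent_card_le:
  assumes "fin_span S" "independent B" "B \<subseteq> S" shows "finite B" "card B \<le> dim S"
proof -
  obtain A where A: "finite A" "A \<subseteq> S" "independent A" "S \<subseteq> span A" "card A = dim S"
    using fin_spanE[OF assms(1)] by auto
  show "finite B" "card B \<le> dim S"
    using independent_span_bound[of A B] A assms by auto
qed

text \<open>\<open>f n\<close> kills the span of everything placed before \<open>w n\<close> but not
  \<open>w n\<close> itself, so \<open>w n\<close> lies outside that span.\<close>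

lemma triangular_independent:
  fixes f :: "nat \<Rightarrow> 'b \<Rightarrow> 'a" and w :: "nat \<Rightarrow> 'b"
  assumes B: "independent B" "finite B"
    and f: "\<And>k. k < n \<Longrightarrow> linf (f k)"
    and z: "\<And>k b. k < n \<Longrightarrow> b \<in> B \<Longrightarrow> f k b = 0"
    and tr: "\<And>k i. k < n \<Longrightarrow> i < k \<Longrightarrow> f k (w i) = 0"
    and nz: "\<And>k. k < n \<Longrightarrow> f k (w k) \<noteq> 0"
  shows "independent (B \<union> w ` {..<n}) \<and> card (B \<union> w ` {..<n}) = card B + n"
  using f z tr nz
proof (induction n)
  case 0
  then show ?case using B by simp
next
  case (Suc n)
  let ?A = "B \<union> w ` {..<n}"
  have IH: "independent ?A" "card ?A = card B + n" using Suc by auto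
  have "f n x = 0" if "x \<in> span ?A" for x
  proof (rule linf_vanish_span[OF _ _ that])
    show "linf (f n)" using Suc.prems(1) by auto
    show "f n b = 0" if "b \<in> ?A" for b using that Suc.prems by auto
  qed
  then have n: "w n \<notin> span ?A" using Suc.prems(4) by blast
  have e: "B \<union> w ` {..<Suc n} = insert (w n) ?A" by (auto simp: lessThan_Suc)
  have "w n \<notin> ?A" using n span_base[of "w n" ?A] by metis
  then show ?case
    unfolding e using independent_insertI[OF n IH(1)] IH(2) B(2) by simp
qed

text \<open>Bounds the codimension of \<open>W\<close> from above: a vector of \<open>S\<close>
  outside the span of \<open>W\<close> and \<open>P\<close> would be detected by a functional
  vanishing on both.\<close>

lemma dim_ge_of_functionals:
  assumes S: "fin_span S" and P: "finite P" "W \<subseteq> S"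
    and h: "\<And>f. linf f \<Longrightarrow> (\<And>x. x \<in> W \<union> P \<Longrightarrow> f x = 0) \<Longrightarrow> (\<And>x. x \<in> S \<Longrightarrow> f x = 0)"
  shows "dim S \<le> dim W + card P"
proof -
  obtain B where B: "finite B" "B \<subseteq> W" "independent B" "W \<subseteq> span B" "card B = dim W"
    using fin_spanE[OF fin_span_subset[OF S P(2)]] by blast
  have "S \<subseteq> span (W \<union> P)"
  proof
    fix x assume x: "x \<in> S"
    show "x \<in> span (W \<union> P)"
    proof (rule ccontr)
      assume "x \<notin> span (W \<union> P)"
      then obtain f where "linf f" "\<And>b. b \<in> W \<union> P \<Longrightarrow> f b = 0" "f x = 1"
        using linf_separates by metis
      then show False using h[of f x] x by simp
    qed
  qed
  also have "\<dots> \<subseteq> span (B \<union> P)"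
    by (rule span_minimal) (use B(4) span_mono[of B "B \<union> P"] span_superset[of "B \<union> P"] in auto)
  finally have "dim S \<le> card (B \<union> P)" using dim_le_card B P by blast
  then show ?thesis using card_Un_le[of B P] B by linarith
qed

text \<open>Bounds the codimension of \<open>W\<close> from below, by adjoining the
  \<open>w k\<close> to a basis of \<open>W\<close>. A triangular shape is demanded rather than dual
  vectors because it is what the pairing of two cyclic subspaces provides.\<close>

lemma dim_le_of_functionals:
  fixes f :: "nat \<Rightarrow> 'b \<Rightarrow> 'a" and w :: "nat \<Rightarrow> 'b"
  assumes S: "fin_span S" and W: "W \<subseteq> S"
    and f: "\<And>k. k < n \<Longrightarrow> linf (f k)"
    and z: "\<And>k b. k < n \<Longrightarrow> b \<in> W \<Longrightarrow> f k b = 0"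
    and w: "\<And>k. k < n \<Longrightarrow> w k \<in> S"
    and tr: "\<And>k i. k < n \<Longrightarrow> i < k \<Longrightarrow> f k (w i) = 0"
    and nz: "\<And>k. k < n \<Longrightarrow> f k (w k) \<noteq> 0"
  shows "dim W + n \<le> dim S"
proof -
  obtain B where B: "finite B" "B \<subseteq> W" "independent B" "W \<subseteq> span B" "card B = dim W"
    using fin_spanE[OF fin_span_subset[OF S W]] by blast
  have i: "independent (B \<union> w ` {..<n}) \<and> card (B \<union> w ` {..<n}) = card B + n"
    by (rule triangular_independent[of B n f w]) (use B f z tr nz in auto)
  have "B \<union> w ` {..<n} \<subseteq> S" using B(2) W w by auto
  then have "card (B \<union> w ` {..<n}) \<le> dim S" using independent_card_le(2)[OF S conjunct1[OF i]] by blast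
  then show ?thesis using i B(5) by linarith
qed

section \<open>Polynomials in an operator\<close>

definition papp :: "('b \<Rightarrow> 'b) \<Rightarrow> 'a poly \<Rightarrow> 'b \<Rightarrow> 'b" where
  "papp e p w = (\<Sum>i\<le>degree p. coeff p i *s (e ^^ i) w)"

lemma papp_bound: "degree p \<le> n \<Longrightarrow> papp e p w = (\<Sum>i\<le>n. coeff p i *s (e ^^ i) w)"
  unfolding papp_def by (rule sum.mono_neutral_left) (auto simp: coeff_eq_0)

lemma papp_0: "papp e 0 w = 0"
  by (simp add: papp_def)

lemma papp_add: "papp e (p + q) w = papp e p w + papp e q w"
proof -
  let ?n = "max (degree p) (degree q)"
  show ?thesis
    using degree_add_le_max[of p q]
    by (simp add: papp_bound[of _ ?n] scale_left_distrib sum.distrib)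
qed

lemma papp_smult: "papp e (Polynomial.smult c p) w = c *s papp e p w"
  using degree_smult_le[of c p]
  by (simp add: papp_bound[of _ "degree p"] scale_sum_right)

lemma papp_diff: "papp e (p - q) w = papp e p w - papp e q w"
  using papp_add[of e "p - q" q w] by simp

lemma papp_monom: "papp e (monom c n) w = c *s (e ^^ n) w"
proof -
  have "papp e (monom c n) w = (\<Sum>i\<le>n. (if i = n then c *s (e ^^ i) w else 0))"
    unfolding papp_bound[OF degree_monom_le]
    by (intro sum.cong refl) (auto)
  then show ?thesis by simp
qed

lemma papp_pCons:
  assumes e: "lin e" shows "papp e (pCons a p) w = a *s w + e (papp e p w)"
proof -
  have "papp e (pCons a p) w = (\<Sum>i\<le>Suc (degree p). coeff (pCons a p) i *s (e ^^ i) w)"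
    by (rule papp_bound) (auto simp: degree_pCons_le)
  then show ?thesis
    by (simp add: sum.atMost_Suc_shift papp_def lin_sum[OF e] lin_scale[OF e] del: sum.atMost_Suc)
qed

lemma papp_linear: "lin e \<Longrightarrow> lin (papp e p)"
  by (intro linI) (simp_all add: papp_def lin_add[OF lin_funpow] lin_scale[OF lin_funpow]
      scale_right_distrib sum.distrib scale_sum_right mult.commute)

lemma papp_mult: "lin e \<Longrightarrow> papp e (p * q) w = papp e p (papp e q w)"
proof (induction p)
  case 0
  then show ?case by (simp add: papp_0)
next
  case (pCons a p)
  then show ?case
    by (simp add: papp_pCons papp_add papp_smult lin_zero)
qed

lemma papp_mem: "subspace S \<Longrightarrow> e ` S \<subseteq> S \<Longrightarrow> w \<in> S \<Longrightarrow> papp e p w \<in> S"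
  unfolding papp_def by (intro subspace_sum subspace_scale) (auto intro: funpow_mem)

lemma funpow_dependent:
  assumes e: "lin e" and S: "subspace S" "fin_span S" "e ` S \<subseteq> S" and w: "w \<in> S"
  shows "\<exists>p. p \<noteq> 0 \<and> papp e p w = 0"
proof (cases "inj_on (\<lambda>i. (e ^^ i) w) {..dim S}")
  \<comment> \<open>Dependence is a property of the set of iterates, so a repetition among them is a
    case of its own; it yields the annihilator \<open>x^i - x^j\<close>.\<close>
  case False
  then obtain i j where ij: "i \<noteq> j" "(e ^^ i) w = (e ^^ j) w"
    unfolding inj_on_def by blast
  have "monom 1 i - monom (1::'a) j \<noteq> 0"
  proof
    assume "monom 1 i - monom (1::'a) j = 0"
    then have "coeff (monom 1 i) i = coeff (monom (1::'a) j) i" by simp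
    then show False using ij(1) by simp
  qed
  moreover have "papp e (monom 1 i - monom 1 j) w = 0"
    by (simp add: papp_diff papp_monom ij(2))
  ultimately show ?thesis by blast
next
  case True
  let ?A = "(\<lambda>i. (e ^^ i) w) ` {..dim S}"
  have "card ?A = Suc (dim S)" using card_image[OF True] by simp
  moreover have "?A \<subseteq> S" using funpow_mem[OF S(3) w] by auto
  ultimately have "dependent ?A" using independent_card_le(2)[OF S(2), of ?A] by auto
  then obtain u v where u: "v \<in> ?A" "u v \<noteq> 0" "(\<Sum>v\<in>?A. u v *s v) = 0"
    unfolding dependent_finite[of ?A, simplified] by blast
  then obtain k where k: "k \<le> dim S" "v = (e ^^ k) w" by auto
  define p where "p = (\<Sum>i\<le>dim S. monom (u ((e ^^ i) w)) i)"
  have c: "coeff p i = (if i \<le> dim S then u ((e ^^ i) w) else 0)" for i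
    by (simp add: p_def coeff_sum)
  have "p \<noteq> 0" using c[of k] u(2) k by auto
  moreover have "papp e p w = (\<Sum>i\<le>dim S. coeff p i *s (e ^^ i) w)"
    by (rule papp_bound) (simp add: degree_le c)
  then have "papp e p w = 0" using u(3) by (simp add: c sum.reindex[OF True])
  ultimately show ?thesis by blast
qed

text \<open>Polynomials in \<open>e\<close> commute, so the product of annihilators of the basis
  vectors annihilates each of them and hence their span.\<close>

lemma annihilator_exists:
  assumes e: "lin e" and S: "subspace S" "fin_span S" "e ` S \<subseteq> S"
  shows "\<exists>p. p \<noteq> 0 \<and> (\<forall>w\<in>S. papp e p w = 0)"
proof -
  obtain B where B: "finite B" "B \<subseteq> S" "S \<subseteq> span B" using fin_spanE[OF S(2)] by metis
  have "\<exists>p. p \<noteq> 0 \<and> (\<forall>w\<in>B. papp e p w = 0)" using B(1,2)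
  proof (induction B)
    case empty
    then show ?case by (auto intro: exI[of _ 1])
  next
    case (insert b B)
    then obtain p where p: "p \<noteq> 0" "\<forall>w\<in>B. papp e p w = 0" by auto
    obtain q where q: "q \<noteq> 0" "papp e q b = 0"
      using funpow_dependent[OF e S, of b] insert.prems by blast
    have "papp e (p * q) b = 0" by (simp add: papp_mult e q lin_zero[OF papp_linear])
    moreover have "papp e (p * q) w = 0" if "w \<in> B" for w
      using p that by (simp add: papp_mult mult.commute[of p] e lin_zero[OF papp_linear])
    ultimately show ?case using p q by (intro exI[of _ "p * q"]) auto
  qed
  then obtain p where p: "p \<noteq> 0" "\<forall>w\<in>B. papp e p w = 0" by blast
  have "papp e p w = 0" if "w \<in> span B" for w
    using that
    by (induction rule: span_induct_alt)
      (use p(2) in \<open>auto simp: lin_add[OF papp_linear[OF e]] lin_scale[OF papp_linear[OF e]] lin_zero[OF papp_linear[OF e]]\<close>)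
  then show ?thesis using p B(3) by blast
qed

text \<open>For a non-root \<open>s\<close> of an annihilating polynomial \<open>m\<close> of \<open>R\<close>, the quotient of
  \<open>m - m(s)\<close> by \<open>x - s\<close> yields an inverse of \<open>R - s\<close>.\<close>

lemma generic_invertible:
  assumes R: "lin R" and S: "subspace S" "fin_span S" "R ` S \<subseteq> S"
  obtains t where "t \<noteq> 0" "\<And>w. w \<in> S \<Longrightarrow> \<exists>w'\<in>S. w' + t *s R w' = w"
    "\<And>w. w \<in> S \<Longrightarrow> w + t *s R w = 0 \<Longrightarrow> w = 0"
proof -
  obtain m where m: "m \<noteq> 0" "\<forall>w\<in>S. papp R m w = 0" using annihilator_exists[OF R S] by blast
  \<comment> \<open>Avoiding 0 besides the roots of \<open>m\<close> allows
    \<open>t = - 1 / s\<close>, for which \<open>1 + t R\<close> is the multiple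
    \<open>- (R - s) / s\<close> of \<open>R - s\<close>.\<close>
  have "finite (insert 0 {x. poly m x = 0})" using poly_roots_finite[OF m(1)] by blast
  then obtain s where "s \<notin> insert 0 {x. poly m x = 0}"
    using ex_new_if_finite[OF infinite_UNIV_char_0] by blast
  then have s: "s \<noteq> 0" "poly m s \<noteq> 0" by blast+
  obtain h where h: "m - [:poly m s:] = [:-s, 1:] * h"
    using poly_eq_0_iff_dvd[of "m - [:poly m s:]" s] by (auto simp: dvd_def)
  have c: "papp R [:c:] w = c *s w" for c w by (simp add: papp_def)
  have l: "papp R [:-s, 1:] w = R w - s *s w" for w
    by (simp add: papp_pCons[OF R] papp_0 lin_zero[OF R])
  have 1: "papp R [:-s, 1:] (papp R h w) = - poly m s *s w" if "w \<in> S" for w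
  proof -
    have "papp R (m - [:poly m s:]) w = papp R [:-s, 1:] (papp R h w)"
      unfolding h papp_mult[OF R] ..
    then show ?thesis using m(2) that by (simp add: papp_diff c)
  qed
  have 2: "papp R h (papp R [:-s, 1:] w) = - poly m s *s w" if "w \<in> S" for w
    using 1[OF that] by (metis papp_mult[OF R] mult.commute)
  have e: "w + (- inverse s) *s R w = (- inverse s) *s papp R [:-s, 1:] w" for w
    using s by (simp add: l scale_right_diff_distrib)
  show thesis
  proof (rule that[of "- inverse s"])
    show "- inverse s \<noteq> 0" using s by simp
  next
    fix w assume w: "w \<in> S"
    \<comment> \<open>On \<open>S\<close> the product of \<open>R - s\<close> and
      \<open>h(R)\<close> is \<open>- m(s)\<close>; with the factor \<open>- 1 / s\<close> this
      fixes the scalar.\<close>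
    let ?w = "(s / poly m s) *s papp R h w"
    have "?w \<in> S" using papp_mem[OF S(1,3) w] S(1) by (simp add: subspace_scale)
    moreover have "?w + (- inverse s) *s R ?w = w"
      unfolding e lin_scale[OF papp_linear[OF R]] 1[OF w] using s by simp
    ultimately show "\<exists>w'\<in>S. w' + (- inverse s) *s R w' = w" by blast
  next
    fix w assume w: "w \<in> S" "w + (- inverse s) *s R w = 0"
    then have "papp R [:-s, 1:] w = 0" using s unfolding e by simp
    then show "w = 0" using 2[OF w(1)] s by (simp add: lin_zero[OF papp_linear[OF R]])
  qed
qed

end

text \<open>A list of triples \<open>(c, a, b)\<close> stands for the bivector
  \<open>\<Sum> c a \<and> b\<close>. Lists are far from unique representatives; statements on
  bivectors are therefore tested by evaluating alternating forms, which do not distinguish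
  representatives. The derivation induced by an operator is \<open>wedge_act\<close>.\<close>

definition wedge_eval :: "('x \<Rightarrow> 'y \<Rightarrow> 'k::comm_ring_1) \<Rightarrow> ('k \<times> 'x \<times> 'y) list \<Rightarrow> 'k" where
  "wedge_eval \<beta> us = (\<Sum>(c, a, b)\<leftarrow>us. c * \<beta> a b)"

definition wedge_act :: "('x \<Rightarrow> 'x) \<Rightarrow> ('k \<times> 'x \<times> 'x) list \<Rightarrow> ('k \<times> 'x \<times> 'x) list" where
  "wedge_act x us = concat (map (\<lambda>(c, a, b). [(c, x a, b), (c, a, x b)]) us)"

lemma wedge_eval_simps [simp]:
  "wedge_eval \<beta> [] = 0" "wedge_eval \<beta> ((c, a, b) # us) = c * \<beta> a b + wedge_eval \<beta> us"
  by (simp_all add: wedge_eval_def)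

lemma wedge_act_simps [simp]:
  "wedge_act x [] = []" "wedge_act x ((c, a, b) # us) = (c, x a, b) # (c, a, x b) # wedge_act x us"
  by (simp_all add: wedge_act_def)

section \<open>The minimal polynomial and cyclic vectors\<close>

context char0_space
begin

text \<open>An annihilator of least degree, made monic. Its degree is positive because a nonzero
  constant kills no nonzero vector.\<close>

lemma minimal_annihilator:
  assumes e: "lin e" and S: "subspace S" "fin_span S" "e ` S \<subseteq> S" and ne: "S \<noteq> {0}"
  obtains m where "lead_coeff m = 1" "0 < degree m" "\<And>w. w \<in> S \<Longrightarrow> papp e m w = 0"
    "\<And>p. p \<noteq> 0 \<Longrightarrow> degree p < degree m \<Longrightarrow> \<exists>w\<in>S. papp e p w \<noteq> 0"
proof -
  let ?P = "\<lambda>p. p \<noteq> 0 \<and> (\<forall>w\<in>S. papp e p w = 0)"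
  obtain p0 where "?P p0" using annihilator_exists[OF e S] by blast
  then obtain p where p: "?P p" "\<forall>q. ?P q \<longrightarrow> degree p \<le> degree q"
    using ex_has_least_nat[of ?P p0 degree] by blast
  let ?m = "Polynomial.smult (inverse (lead_coeff p)) p"
  have lc: "lead_coeff p \<noteq> 0" using p by simp
  have "degree p \<noteq> 0"
  proof
    assume "degree p = 0"
    then obtain c where c: "p = [:c:]" using degree_eq_zeroE by blast
    obtain w where "w \<in> S" "w \<noteq> 0" using ne subspace_0[OF S(1)] by blast
    then show False using p(1) by (auto simp: c papp_def)
  qed
  then show thesis
    using p lc by (intro that[of ?m]) (auto simp: papp_smult not_less[symmetric])
qed

lemma finite_line_kernel:
  assumes "x \<noteq> 0 \<or> y \<noteq> (0::'b)" shows "finite {t. x + t *s y = 0}"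
proof (cases "y = 0")
  case True
  then show ?thesis using assms by simp
next
  case False
  have "{t. x + t *s y = 0} \<subseteq> {t}" if "x + t *s y = 0" for t
  proof
    fix s assume "s \<in> {t. x + t *s y = 0}"
    then have "s *s y = t *s y" using that by (metis add_left_cancel mem_Collect_eq)
    then show "s \<in> {t}" using False by simp
  qed
  then show ?thesis by (metis (mono_tags, lifting) empty_Collect_eq finite.emptyI finite.insertI finite_subset)
qed

text \<open>On a line \<open>v + t w\<close> each \<open>L i\<close> that is nonzero at
  \<open>v\<close> or at \<open>w\<close> vanishes for at most one \<open>t\<close>, and the field
  is infinite.\<close>

lemma common_nonvanishing:
  assumes "finite I" "subspace S" "\<And>i. i \<in> I \<Longrightarrow> lin (L i)" "\<And>i. i \<in> I \<Longrightarrow> \<exists>w\<in>S. L i w \<noteq> 0"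
  shows "\<exists>v\<in>S. \<forall>i\<in>I. L i v \<noteq> 0"
  using assms
proof (induction I)
  case empty
  then show ?case using subspace_0 by blast
next
  case (insert k I)
  then obtain v where v: "v \<in> S" "\<forall>i\<in>I. L i v \<noteq> 0" by auto
  obtain w where w: "w \<in> S" "L k w \<noteq> 0" using insert.prems by blast
  have "finite (\<Union>i\<in>insert k I. {t. L i v + t *s L i w = 0})"
    using insert.hyps(1) v w by (intro finite_UN_I finite_line_kernel) auto
  then obtain t where t: "t \<notin> (\<Union>i\<in>insert k I. {t. L i v + t *s L i w = 0})"
    using ex_new_if_finite[OF infinite_UNIV_char_0] by blast
  have "L i (v + t *s w) \<noteq> 0" if "i \<in> insert k I" for i
    using t that insert.prems(2)[OF that] by (auto simp: lin_add lin_scale)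
  moreover have "v + t *s w \<in> S" using v w insert.prems(1) by (simp add: subspace_add subspace_scale)
  ultimately show ?case by blast
qed

text \<open>\<open>v\<close> is chosen outside the kernels of \<open>m / (x - r)\<close> at
  \<open>e\<close>, for all roots \<open>r\<close> of \<open>m\<close>. Its annihilator
  \<open>f\<close> of least degree divides \<open>m\<close>. If the quotient were not constant, it
  would have a root \<open>r\<close>, so \<open>f\<close> would divide \<open>m / (x - r)\<close>
  and that polynomial would kill \<open>v\<close>. Multiple roots need no special care.\<close>

lemma cyclic_vector:
  assumes e: "lin e" and S: "subspace S" "fin_span S" "e ` S \<subseteq> S" and ne: "S \<noteq> {0}"
  obtains m v where "lead_coeff m = 1" "0 < degree m" "\<And>w. w \<in> S \<Longrightarrow> papp e m w = 0"
    "v \<in> S" "\<And>p. degree p < degree m \<Longrightarrow> papp e p v = 0 \<Longrightarrow> p = 0"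
proof -
  obtain m where m: "lead_coeff m = 1" "0 < degree m" "\<And>w. w \<in> S \<Longrightarrow> papp e m w = 0"
    "\<And>p. p \<noteq> 0 \<Longrightarrow> degree p < degree m \<Longrightarrow> \<exists>w\<in>S. papp e p w \<noteq> 0"
    using minimal_annihilator[OF e S ne] by blast
  have m0: "m \<noteq> 0" using m(1) by auto
  let ?q = "\<lambda>r. m div [:-r, 1:]"
  have q: "m = [:-r, 1:] * ?q r" if "poly m r = 0" for r
    using that dvd_mult_div_cancel[of "[:-r, 1:]" m] poly_eq_0_iff_dvd[of m r] by metis
  have "\<exists>v\<in>S. \<forall>r\<in>{r. poly m r = 0}. papp e (?q r) v \<noteq> 0"
  proof (rule common_nonvanishing)
    show "finite {r. poly m r = 0}" using poly_roots_finite[OF m0] .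
    show "lin (papp e (?q r))" for r by (rule papp_linear[OF e])
    fix r assume "r \<in> {r. poly m r = 0}"
    then have r: "m = [:-r, 1:] * ?q r" using q by blast
    then have "?q r \<noteq> 0" using m0 by auto
    moreover from this have "degree m = 1 + degree (?q r)"
      by (subst r, subst degree_mult_eq) auto
    ultimately show "\<exists>w\<in>S. papp e (?q r) w \<noteq> 0" by (intro m(4)) auto
  qed (rule S)
  then obtain v where v: "v \<in> S" "\<And>r. poly m r = 0 \<Longrightarrow> papp e (?q r) v \<noteq> 0" by blast
  have "p = 0" if p: "degree p < degree m" "papp e p v = 0" for p
  proof (rule ccontr)
    assume "p \<noteq> 0"
    let ?P = "\<lambda>p. p \<noteq> 0 \<and> papp e p v = 0"
    obtain f where f: "?P f" "\<forall>q. ?P q \<longrightarrow> degree f \<le> degree q"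
      using ex_has_least_nat[of ?P p degree] \<open>p \<noteq> 0\<close> p by blast
    have "papp e (m mod f) v = papp e m v - papp e (m div f) (papp e f v)"
      by (simp add: papp_diff papp_mult[OF e, symmetric] minus_div_mult_eq_mod[symmetric])
    then have "papp e (m mod f) v = 0"
      using f m(3)[OF v(1)] by (simp add: lin_zero[OF papp_linear[OF e]])
    then have "m mod f = 0" using f degree_mod_less[of f m] by fastforce
    then obtain h where h: "m = f * h" by (metis mod_0_imp_dvd dvd_def)
    have "degree f < degree m" using f p \<open>p \<noteq> 0\<close> by fastforce
    then have "degree h > 0" using h m0 degree_mult_eq[of f h] by fastforce
    then obtain r where r: "poly h r = 0" using alg_closed_imp_poly_has_root by blast
    then obtain h' where h': "h = [:-r, 1:] * h'" by (auto simp: poly_eq_0_iff_dvd dvd_def)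
    have pr: "poly m r = 0" using r h by simp
    have "[:-r, 1:] * ?q r = f * ([:-r, 1:] * h')" using q[OF pr] h h' by metis
    also have "\<dots> = [:-r, 1:] * (h' * f)" by (simp only: ac_simps)
    finally have "?q r = h' * f" by (simp only: mult_cancel_left) auto
    then show False
      using v(2)[OF pr] f by (simp add: papp_mult[OF e] lin_zero[OF papp_linear[OF e]])
  qed
  then show thesis using that m(1-3) v(1) by blast
qed

text \<open>Induction through the kernel of \<open>f m\<close>: there one functional fewer suffices,
  and the last coefficient is dictated by the value of \<open>g\<close> at a single vector outside
  the kernel.\<close>

lemma functional_in_span:
  fixes f :: "nat \<Rightarrow> 'b \<Rightarrow> 'a"
  assumes "subspace S" "\<And>i. i < m \<Longrightarrow> linf (f i)" "linf g"
    "\<And>w. w \<in> S \<Longrightarrow> (\<And>i. i < m \<Longrightarrow> f i w = 0) \<Longrightarrow> g w = 0"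
  shows "\<exists>c. \<forall>w\<in>S. g w = (\<Sum>i<m. c i * f i w)"
  using assms
proof (induction m arbitrary: S)
  case 0
  then show ?case by simp
next
  case (Suc m)
  let ?T = "{w \<in> S. f m w = 0}"
  have fm: "linf (f m)" using Suc.prems by simp
  have "subspace ?T"
    using Suc.prems(1) by (auto simp: subspace_def linf_add[OF fm] linf_scale[OF fm] linf_zero[OF fm])
  moreover have "g w = 0" if "w \<in> ?T" "\<And>i. i < m \<Longrightarrow> f i w = 0" for w
    using that Suc.prems(4)[of w] by (auto simp: less_Suc_eq)
  ultimately obtain c where c: "\<And>w. w \<in> ?T \<Longrightarrow> g w = (\<Sum>i<m. c i * f i w)"
    using Suc.IH[of ?T] Suc.prems(2,3) by auto
  show ?case
  proof (cases "\<exists>w\<in>S. f m w \<noteq> 0")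
    case False
    then show ?thesis using c by (intro exI[of _ c]) auto
  next
    case True
    then obtain w0 where w0: "w0 \<in> S" "f m w0 \<noteq> 0" by blast
    let ?k = "(g w0 - (\<Sum>i<m. c i * f i w0)) / f m w0"
    have "g w = (\<Sum>i<Suc m. (c(m := ?k)) i * f i w)" if w: "w \<in> S" for w
    proof -
      let ?r = "f m w / f m w0"
      have "w - ?r *s w0 \<in> ?T"
        using w w0 Suc.prems(1) by (simp add: subspace_diff subspace_scale linf_diff[OF fm] linf_scale[OF fm])
      from c[OF this] have "g w - ?r * g w0 = (\<Sum>i<m. c i * (f i w - ?r * f i w0))"
        using Suc.prems(2,3) by (simp add: linf_diff linf_scale)
      also have "\<dots> = (\<Sum>i<m. c i * f i w) - ?r * (\<Sum>i<m. c i * f i w0)"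
        by (simp add: sum_subtractf right_diff_distrib sum_distrib_left ac_simps)
      finally have "g w = (\<Sum>i<m. c i * f i w) + ?k * f m w"
        using w0 by (simp add: field_simps)
      moreover have "(\<Sum>i<m. (c(m := ?k)) i * f i w) = (\<Sum>i<m. c i * f i w)"
        by (intro sum.cong) auto
      ultimately show ?thesis by simp
    qed
    then show ?thesis by blast
  qed
qed

end

section \<open>Decomposition for a self-adjoint operator on a symplectic space\<close>

locale skew_space = char0_space scale
  for scale :: "'a::{alg_closed_field,field_char_0} \<Rightarrow> 'b::ab_group_add \<Rightarrow> 'b" (infixr \<open>*s\<close> 75) +
  fixes \<omega> :: "'b \<Rightarrow> 'b \<Rightarrow> 'a"
  assumes om_add: "\<omega> (x + y) z = \<omega> x z + \<omega> y z"
    and om_scale: "\<omega> (c *s x) z = c * \<omega> x z"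
    and om_skew: "\<omega> x y = - \<omega> y x"
begin

lemma om_add_right: "\<omega> z (x + y) = \<omega> z x + \<omega> z y"
  by (subst (1 2 3) om_skew) (simp add: om_add)

lemma om_scale_right: "\<omega> z (c *s x) = c * \<omega> z x"
  by (subst (1 2) om_skew) (simp add: om_scale)

lemma om_linear: "linf (\<lambda>w. \<omega> w z)" "linf (\<omega> z)"
  by (auto intro!: linfI simp: om_add om_scale om_add_right om_scale_right)

lemmas om_simps = om_add om_scale om_add_right om_scale_right
  linf_zero[OF om_linear(1)] linf_zero[OF om_linear(2)]
  linf_diff[OF om_linear(1)] linf_diff[OF om_linear(2)]
  linf_neg[OF om_linear(1)] linf_neg[OF om_linear(2)]
lemmas om_sum = linf_sum[OF om_linear(1)] linf_sum[OF om_linear(2)]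

lemma om_0: "\<omega> 0 x = 0" "\<omega> x 0 = 0"
  by (simp_all add: om_simps)

text \<open>Asked of a subspace, since the form transported to the type of all coordinate functions
  has a radical in general.\<close>

definition nondeg :: "'b set \<Rightarrow> bool" where
  "nondeg S \<longleftrightarrow> (\<forall>x\<in>S. (\<forall>y\<in>S. \<omega> x y = 0) \<longrightarrow> x = 0)"

definition self_adjoint :: "('b \<Rightarrow> 'b) \<Rightarrow> bool" where
  "self_adjoint y \<longleftrightarrow> lin y \<and> (\<forall>a b. \<omega> (y a) b = \<omega> a (y b))"

definition skew_adjoint :: "('b \<Rightarrow> 'b) \<Rightarrow> bool" where
  "skew_adjoint x \<longleftrightarrow> lin x \<and> (\<forall>a b. \<omega> (x a) b = - \<omega> a (x b))"

definition alternating :: "('b \<Rightarrow> 'b \<Rightarrow> 'a) \<Rightarrow> bool" where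
  "alternating \<beta> \<longleftrightarrow> (\<forall>b. linf (\<lambda>a. \<beta> a b)) \<and> (\<forall>a b. \<beta> a b = - \<beta> b a)"

lemma
  assumes "alternating \<beta>"
  shows alternating_linear: "linf (\<lambda>a. \<beta> a b)" "linf (\<beta> a)"
    and alternating_skew: "\<beta> a b = - \<beta> b a"
    and alternating_self: "\<beta> a a = 0"
proof -
  show s: "\<beta> a b = - \<beta> b a" for a b using assms unfolding alternating_def by blast
  show l: "linf (\<lambda>a. \<beta> a b)" for b using assms unfolding alternating_def by blast
  have "linf (\<lambda>a. - \<beta> a b)" for b
    by (intro linfI) (simp_all add: linf_add[OF l] linf_scale[OF l])
  moreover have "\<beta> a = (\<lambda>b. - \<beta> b a)" by (rule ext) (rule s)
  ultimately show "linf (\<beta> a)" by simp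
  show "\<beta> a a = 0" using s[of a a] by simp
qed

lemmas alternating_simps = linf_add[OF alternating_linear(1)] linf_add[OF alternating_linear(2)]
  linf_scale[OF alternating_linear(1)] linf_scale[OF alternating_linear(2)]
  linf_zero[OF alternating_linear(1)] linf_zero[OF alternating_linear(2)]
  linf_diff[OF alternating_linear(1)] linf_diff[OF alternating_linear(2)]
  linf_neg[OF alternating_linear(1)] linf_neg[OF alternating_linear(2)]
lemmas alternating_sum = linf_sum[OF alternating_linear(1)] linf_sum[OF alternating_linear(2)]

end

locale self_adjoint_op = skew_space +
  fixes e S
  assumes e: "self_adjoint e" and S: "subspace S" "fin_span S" "e ` S \<subseteq> S" and nd: "nondeg S"
begin

lemma e_lin: "lin e" and e_adj: "\<omega> (e a) b = \<omega> a (e b)"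
  using e by (auto simp: self_adjoint_def)

lemma pow_adj: "\<omega> ((e ^^ i) a) b = \<omega> a ((e ^^ i) b)"
  by (induction i arbitrary: a b) (simp_all add: e_adj funpow_swap1)

lemma nondeg_left: "x \<in> S \<Longrightarrow> (\<And>y. y \<in> S \<Longrightarrow> \<omega> x y = 0) \<Longrightarrow> x = 0"
  using nd unfolding nondeg_def by blast

lemma papp_eq_sum:
  assumes "\<And>i. n \<le> i \<Longrightarrow> coeff p i = 0"
  shows "papp e p w = (\<Sum>i<n. coeff p i *s (e ^^ i) w)"
  unfolding papp_def
proof (rule sum.mono_neutral_cong)
  show "coeff p i *s (e ^^ i) w = 0" if "i \<in> {..<n} - {..degree p}" for i
    using that by (simp add: coeff_eq_0)
qed (use assms not_less in auto)

text \<open>The second generator represents the functional that reads off the top coefficient of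
  the elements of the cyclic subspace of the first one.\<close>

lemma cyclic_pair:
  assumes "S \<noteq> {0}"
  obtains m v v' where "lead_coeff m = 1" "0 < degree m" "\<And>w. w \<in> S \<Longrightarrow> papp e m w = 0"
    "v \<in> S" "v' \<in> S" "\<And>i. i < degree m \<Longrightarrow> \<omega> ((e ^^ i) v) v' = (if Suc i = degree m then 1 else 0)"
proof -
  obtain m v where m: "lead_coeff m = 1" "0 < degree m" "\<And>w. w \<in> S \<Longrightarrow> papp e m w = 0"
    "v \<in> S" "\<And>p. degree p < degree m \<Longrightarrow> papp e p v = 0 \<Longrightarrow> p = 0"
    using cyclic_vector[OF e_lin S assms] by blast
  obtain n where n: "degree m = Suc n" using m(2) gr0_implies_Suc by blast
  let ?f = "\<lambda>i. \<omega> ((e ^^ i) v)"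
  have "\<exists>w\<in>S. (\<forall>i<n. ?f i w = 0) \<and> ?f n w \<noteq> 0"
  proof (rule ccontr)
    assume "\<not> ?thesis"
    then have "\<And>w. w \<in> S \<Longrightarrow> (\<And>i. i < n \<Longrightarrow> ?f i w = 0) \<Longrightarrow> ?f n w = 0" by blast
    from functional_in_span[of S n ?f, OF S(1) om_linear(2) om_linear(2) this]
    obtain c where c: "\<And>w. w \<in> S \<Longrightarrow> ?f n w = (\<Sum>i<n. c i * ?f i w)" by blast
    \<comment> \<open>A relation among the functionals \<open>?f i\<close> on \<open>S\<close>
      becomes, by nondegeneracy, a monic polynomial of degree \<open>n\<close> that annihilates
      \<open>v\<close>, against the choice of \<open>v\<close>.\<close>
    define p where "p = monom 1 n - (\<Sum>i<n. monom (c i) i)"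
    have co: "coeff p i = (if i = n then 1 else if i < n then - c i else 0)" for i
      by (simp add: p_def coeff_sum)
    have "papp e p v = (\<Sum>i<Suc n. coeff p i *s (e ^^ i) v)"
      by (rule papp_eq_sum) (simp add: co)
    also have "\<dots> = (e ^^ n) v - (\<Sum>i<n. c i *s (e ^^ i) v)"
      by (simp add: co sum_negf)
    finally have pe: "papp e p v = (e ^^ n) v - (\<Sum>i<n. c i *s (e ^^ i) v)" .
    have "papp e p v = 0"
    proof (rule nondeg_left)
      show "papp e p v \<in> S" by (rule papp_mem[OF S(1,3) m(4)])
      show "\<omega> (papp e p v) y = 0" if "y \<in> S" for y
        using c[OF that] by (simp add: pe om_simps om_sum)
    qed
    moreover have "degree p < degree m"
      using degree_le[of n p] co n by auto
    ultimately have "p = 0" using m(5) by blast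
    then show False using co[of n] by simp
  qed
  then obtain w where w: "w \<in> S" "\<And>i. i < n \<Longrightarrow> ?f i w = 0" "?f n w \<noteq> 0" by blast
  show thesis
  proof (rule that[of m v "inverse (?f n w) *s w"])
    show "inverse (?f n w) *s w \<in> S" using S(1) w(1) by (rule subspace_scale)
    show "\<omega> ((e ^^ i) v) (inverse (?f n w) *s w) = (if Suc i = degree m then 1 else 0)"
      if "i < degree m" for i using that w(2)[of i] w(3) n by (auto simp: om_simps less_Suc_eq)
  qed (use m in auto)
qed

end

section \<open>Splitting off a pair of cyclic subspaces\<close>

locale cyclic_split = self_adjoint_op +
  fixes m v v'
  assumes m1: "lead_coeff m = 1" and m2: "0 < degree m" and m3: "\<And>w. w \<in> S \<Longrightarrow> papp e m w = 0"
    and v: "v \<in> S" and v': "v' \<in> S"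
    and vv': "\<And>i. i < degree m \<Longrightarrow> \<omega> ((e ^^ i) v) v' = (if Suc i = degree m then 1 else 0)"
begin

abbreviation d where "d \<equiv> degree m"

lemma pow_mem: "w \<in> S \<Longrightarrow> (e ^^ i) w \<in> S"
  by (rule funpow_mem[OF S(3)])

text \<open>\<open>(m(s) - m(t)) / (s - t)\<close> is the sum of the \<open>coeff m (i + j + 1) * s^i * t^j\<close>.
  It is annihilated by \<open>s - t\<close> modulo \<open>m(s)\<close> and \<open>m(t)\<close>, so \<open>bez p q\<close> commutes with \<open>e\<close>.\<close>

definition bez where
  "bez p q w = (\<Sum>i<d. \<Sum>j<d. (coeff m (i + j + 1) * \<omega> w ((e ^^ j) p)) *s (e ^^ i) q)"

lemma bez_lin: "lin (bez p q)"
  by (intro linI) (simp_all add: bez_def om_simps scale_sum_right ring_distribs scale_left_distrib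
      sum.distrib mult.assoc mult.left_commute)

lemma bez_mem: "q \<in> S \<Longrightarrow> bez p q w \<in> S"
  unfolding bez_def by (intro subspace_sum S subspace_scale pow_mem)

text \<open>The coefficients depend on \<open>i + j\<close> only and \<open>\<omega>\<close> is
  skew, so passing to the adjoint swaps \<open>p\<close> and \<open>q\<close> and changes the sign.
  Consequently the difference of \<open>bez p q\<close> and \<open>bez q p\<close> is self-adjoint
  and their sum is skew-adjoint.\<close>

lemma bez_adj: "\<omega> (bez p q a) b = - \<omega> a (bez q p b)"
proof -
  have "\<omega> (bez p q a) b = (\<Sum>i<d. \<Sum>j<d. coeff m (i + j + 1) * \<omega> a ((e ^^ j) p) * \<omega> ((e ^^ i) q) b)"
    by (simp add: bez_def om_simps om_sum)
  also have "\<dots> = (\<Sum>j<d. \<Sum>i<d. coeff m (i + j + 1) * \<omega> a ((e ^^ j) p) * \<omega> ((e ^^ i) q) b)"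
    by (rule sum.swap)
  also have "\<dots> = (\<Sum>j<d. \<Sum>i<d. - (coeff m (j + i + 1) * \<omega> b ((e ^^ i) q) * \<omega> a ((e ^^ j) p)))"
    by (intro sum.cong refl) (simp add: om_skew[of "(e ^^ _) q" b] ac_simps)
  also have "\<dots> = - \<omega> a (bez q p b)"
    by (simp add: bez_def om_simps om_sum sum_negf)
  finally show ?thesis .
qed

text \<open>Two shifts of the same index square differ only along its borders; as \<open>h\<close>
  vanishes beyond the antidiagonal, the far borders shrink to the corners \<open>h 0 n\<close> and
  \<open>h n 0\<close>.\<close>

lemma antidiagonal_telescope:
  fixes h :: "nat \<Rightarrow> nat \<Rightarrow> 'c::ab_group_add"
  assumes "\<And>i j. n < i + j \<Longrightarrow> h i j = 0"
  shows "(\<Sum>i<n. \<Sum>j<n. h i (Suc j)) - (\<Sum>i<n. \<Sum>j<n. h (Suc i) j) = (\<Sum>j\<le>n. h 0 j) - (\<Sum>i\<le>n. h i 0)"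
proof (cases n)
  case (Suc k)
  have a: "(\<Sum>j<n. g (Suc j)) = (\<Sum>j<n. g j) + g n - g 0" for g :: "nat \<Rightarrow> 'c"
    using sum.lessThan_Suc_shift[of g n] sum.lessThan_Suc[of g n] by (simp add: algebra_simps)
  have "(\<Sum>i<n. h i n) = (\<Sum>i\<in>{0}. h i n)" "(\<Sum>j<n. h n j) = (\<Sum>j\<in>{0}. h n j)"
    by (intro sum.mono_neutral_right; use assms Suc in auto)+
  then have hn: "(\<Sum>i<n. h i n) = h 0 n" "(\<Sum>j<n. h n j) = h n 0" by auto
  have 1: "(\<Sum>i<n. \<Sum>j<n. h i (Suc j)) = (\<Sum>i<n. \<Sum>j<n. h i j) + h 0 n - (\<Sum>i<n. h i 0)"
    unfolding a by (simp add: sum.distrib sum_subtractf hn)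
  have 2: "(\<Sum>i<n. \<Sum>j<n. h (Suc i) j) = (\<Sum>i<n. \<Sum>j<n. h i j) + h n 0 - (\<Sum>j<n. h 0 j)"
    using a[of "\<lambda>i. \<Sum>j<n. h i j"] hn by simp
  show ?thesis unfolding 1 2 by (simp add: lessThan_Suc_atMost[symmetric] algebra_simps)
qed (use assms in simp)

text \<open>Self-adjointness makes both sides sums of the same terms \<open>?h\<close>, shifted in
  \<open>j\<close> on the left and in \<open>i\<close> on the right. The border sums that survive
  assemble into \<open>m(e) p\<close> and \<open>m(e) q\<close>, which are zero.\<close>

lemma bez_commute:
  assumes p: "p \<in> S" and q: "q \<in> S" shows "bez p q (e w) = e (bez p q w)"
proof -
  let ?h = "\<lambda>i j. (coeff m (i + j) * \<omega> w ((e ^^ j) p)) *s (e ^^ i) q"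
  have "bez p q (e w) = (\<Sum>i<d. \<Sum>j<d. ?h i (Suc j))"
    by (simp add: bez_def e_adj)
  moreover have "e (bez p q w) = (\<Sum>i<d. \<Sum>j<d. ?h (Suc i) j)"
    by (simp add: bez_def lin_sum[OF e_lin] lin_scale[OF e_lin])
  ultimately have "bez p q (e w) - e (bez p q w) = (\<Sum>j\<le>d. ?h 0 j) - (\<Sum>i\<le>d. ?h i 0)"
    using antidiagonal_telescope[of d ?h] by (simp add: coeff_eq_0)
  also have "(\<Sum>j\<le>d. ?h 0 j) = \<omega> w (papp e m p) *s q"
    by (simp add: papp_def om_sum om_simps scale_sum_left)
  also have "(\<Sum>i\<le>d. ?h i 0) = \<omega> w p *s papp e m q"
    by (simp add: papp_def scale_sum_right mult.commute)
  finally show ?thesis using m3 p q by (simp add: om_simps)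
qed

text \<open>Only \<open>j = d - 1\<close> contributes; its coefficient
  \<open>coeff m (i + d)\<close> is 1 for \<open>i = 0\<close>, since \<open>m\<close> is monic, and
  0 for larger \<open>i\<close>.\<close>

lemma bez_unit:
  assumes "\<And>j. j < d \<Longrightarrow> \<omega> w ((e ^^ j) p) = (if Suc j = d then c else 0)"
  shows "bez p q w = c *s q"
proof -
  obtain n where n: "d = Suc n" using m2 gr0_implies_Suc by blast
  have "bez p q w = (\<Sum>i<d. (coeff m (i + d) * c) *s (e ^^ i) q)"
    unfolding bez_def
  proof (intro sum.cong refl)
    fix i
    have "(\<Sum>j<d. (coeff m (i + j + 1) * \<omega> w ((e ^^ j) p)) *s (e ^^ i) q)
      = (\<Sum>j<d. if j = n then (coeff m (i + d) * c) *s (e ^^ i) q else 0)"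
      using assms n by (intro sum.cong refl) auto
    then show "(\<Sum>j<d. (coeff m (i + j + 1) * \<omega> w ((e ^^ j) p)) *s (e ^^ i) q)
      = (coeff m (i + d) * c) *s (e ^^ i) q" using n by simp
  qed
  also have "\<dots> = (\<Sum>i<d. if i = 0 then c *s q else 0)"
    using m1 by (intro sum.cong refl) (auto simp: coeff_eq_0)
  finally show ?thesis using m2 by simp
qed

lemma bez_zero: "(\<And>j. j < d \<Longrightarrow> \<omega> w ((e ^^ j) p) = 0) \<Longrightarrow> bez p q w = 0"
  using bez_unit[of w p 0 q] by simp

text \<open>Powers of \<open>e\<close> are self-adjoint, so \<open>\<omega>(e^k a, b)\<close> is
  again skew in \<open>a\<close> and \<open>b\<close>. This is why cyclic subspaces have to be taken
  in pairs.\<close>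

lemma isotropic: "\<omega> ((e ^^ i) x) ((e ^^ j) x) = 0"
proof -
  have "\<omega> ((e ^^ k) x) x = 0" for k
    using pow_adj[of k x x] om_skew[of "(e ^^ k) x" x] by simp
  moreover have "\<omega> ((e ^^ i) x) ((e ^^ j) x) = \<omega> ((e ^^ (j + i)) x) x"
    by (simp add: pow_adj[of j, symmetric] funpow_add)
  ultimately show ?thesis by simp
qed

lemma pairing: "\<omega> ((e ^^ i) v) ((e ^^ j) v') = \<omega> ((e ^^ (i + j)) v) v'"
  by (simp add: pow_adj[of j, symmetric] add.commute[of i] funpow_add)

lemma bez_v: "bez v' q v = q" "bez v q v = 0" "bez v q v' = - q" "bez v' q v' = 0"
proof -
  show "bez v' q v = q"
    using bez_unit[of v v' 1 q] vv' pow_adj[of _ v v'] by simp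
  have "\<omega> v' ((e ^^ j) v) = (if Suc j = d then - 1 else 0)" if "j < d" for j
    using vv'[OF that] om_skew[of v'] by simp
  from bez_unit[OF this] show "bez v q v' = - q" by simp
  show "bez v q v = 0" "bez v' q v' = 0"
    using isotropic[of 0] by (auto intro: bez_zero)
qed

text \<open>On \<open>S\<close>, the orthogonal projection onto the sum of the cyclic subspaces of
  \<open>v\<close> and \<open>v'\<close>. As a difference of two Bezoutians with swapped arguments
  it is self-adjoint and commutes with \<open>e\<close>.\<close>

definition pr where "pr w = bez v' v w - bez v v' w"

lemma pr_lin: "lin pr"
  by (intro linI) (simp_all add: pr_def lin_add[OF bez_lin] lin_scale[OF bez_lin] scale_right_diff_distrib)

lemma pr_self_adjoint: "self_adjoint pr"
  unfolding self_adjoint_def using pr_lin by (simp add: pr_def om_simps bez_adj)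

lemma pr_commute: "pr (e w) = e (pr w)"
  by (simp add: pr_def bez_commute v v' lin_diff[OF e_lin])

lemma pr_commute_pow: "pr ((e ^^ i) w) = (e ^^ i) (pr w)"
  by (induction i) (simp_all add: pr_commute)

lemma pr_mem: "pr w \<in> S"
  unfolding pr_def by (intro subspace_diff S bez_mem v v')

lemma pr_v: "pr v = v" "pr v' = v'"
  by (simp_all add: pr_def bez_v)

lemma linf_pr:
  assumes f: "linf f" and z: "\<And>i. i < d \<Longrightarrow> f ((e ^^ i) v) = 0" "\<And>i. i < d \<Longrightarrow> f ((e ^^ i) v') = 0"
  shows "f (pr w) = 0"
  using z by (simp add: pr_def bez_def linf_diff[OF f] linf_sum[OF f] linf_scale[OF f])

text \<open>All powers of \<open>e\<close> are quantified over, which makes stability under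
  \<open>e\<close> immediate.\<close>

definition perp where
  "perp = {w \<in> S. \<forall>i. \<omega> ((e ^^ i) v) w = 0 \<and> \<omega> ((e ^^ i) v') w = 0}"

lemma perp_subset: "perp \<subseteq> S"
  by (auto simp: perp_def)

lemma perp_orth:
  assumes "w \<in> perp"
  shows "\<omega> ((e ^^ i) v) w = 0" "\<omega> ((e ^^ i) v') w = 0" "\<omega> w ((e ^^ i) v) = 0" "\<omega> w ((e ^^ i) v') = 0"
  using assms om_skew[of w] by (auto simp: perp_def)

lemma perp_subspace: "subspace perp"
  using S(1) by (auto simp: subspace_def perp_def om_simps)

lemma perp_stable: "e ` perp \<subseteq> perp"
proof -
  have "\<omega> ((e ^^ i) x) (e w) = \<omega> ((e ^^ Suc i) x) w" for i x w
    by (simp add: e_adj)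
  then show ?thesis using S(3) by (auto simp: perp_def simp del: funpow.simps)
qed

lemma perp_pow: "w \<in> perp \<Longrightarrow> (e ^^ i) w \<in> perp"
  by (rule funpow_mem[OF perp_stable])

lemma pr_perp: "w \<in> perp \<Longrightarrow> pr w = 0"
  by (simp add: pr_def bez_zero perp_orth)

text \<open>\<open>pr\<close> is self-adjoint and fixes the vectors \<open>e^i v\<close> and
  \<open>e^i v'\<close>, so \<open>w\<close> and \<open>pr w\<close> have the same products with
  them.\<close>

lemma diff_pr_perp: assumes "w \<in> S" shows "w - pr w \<in> perp"
proof -
  have "\<omega> ((e ^^ i) x) (w - pr w) = 0" if "pr x = x" for i x
  proof -
    have "\<omega> ((e ^^ i) x) (pr w) = \<omega> (pr ((e ^^ i) x)) w"
      using pr_self_adjoint by (simp add: self_adjoint_def)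
    then show ?thesis by (simp add: om_simps pr_commute_pow that)
  qed
  then show ?thesis using assms pr_mem S(1) by (simp add: perp_def subspace_diff pr_v)
qed

text \<open>A vector of \<open>perp\<close> is orthogonal to the range of \<open>pr\<close>, so
  being orthogonal to \<open>perp\<close> makes it orthogonal to all of \<open>S\<close>.\<close>

lemma perp_nondeg: "nondeg perp"
  unfolding nondeg_def
proof (intro ballI impI)
  fix x assume x: "x \<in> perp" "\<forall>y\<in>perp. \<omega> x y = 0"
  show "x = 0"
  proof (rule nondeg_left)
    show "x \<in> S" using x perp_subset by blast
    fix y assume y: "y \<in> S"
    have "\<omega> x (pr y) = \<omega> (pr x) y"
      using pr_self_adjoint by (simp add: self_adjoint_def)
    also have "\<dots> = 0" using x by (simp add: pr_perp om_simps)
    finally show "\<omega> x y = 0"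
      using x(2)[rule_format, OF diff_pr_perp[OF y]] by (simp add: om_simps)
  qed
qed

lemma perp_self_adjoint_op: "self_adjoint_op scale \<omega> e perp"
  by unfold_locales (use e perp_subspace fin_span_subset[OF S(2) perp_subset] perp_stable perp_nondeg in auto)

lemma dim_perp: "dim S = 2 * d + dim perp"
proof (rule antisym)
  let ?P = "(\<lambda>i. (e ^^ i) v) ` {..<d} \<union> (\<lambda>i. (e ^^ i) v') ` {..<d}"
  have "dim S \<le> dim perp + card ?P"
  proof (rule dim_ge_of_functionals)
    fix f x assume f: "linf f" "\<And>x. x \<in> perp \<union> ?P \<Longrightarrow> f x = 0" and x: "x \<in> S"
    have "f (pr x) = 0" by (rule linf_pr) (use f in auto)
    moreover have "f (x - pr x) = 0" using f(2) diff_pr_perp[OF x] by blast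
    ultimately show "f x = 0" using linf_diff[OF f(1)] by simp
  qed (use S(2) perp_subset in auto)
  moreover have "card ?P \<le> d + d"
    by (intro order_trans[OF card_Un_le] add_mono order_trans[OF card_image_le]) auto
  ultimately show "dim S \<le> 2 * d + dim perp" by simp
next
  \<comment> \<open>In the order \<open>v, ..., e^(d-1) v, v', ..., e^(d-1) v'\<close> the vectors
    pair triangularly with these functionals: \<open>e^k v\<close> is matched with
    \<open>e^(d-1-k) v'\<close> and conversely, and each half is isotropic.\<close>
  define f where "f k x = (if k < d then \<omega> x ((e ^^ (d - 1 - k)) v') else \<omega> x ((e ^^ (d - 1 - (k - d))) v))" for k x
  define w where "w k = (if k < d then (e ^^ k) v else (e ^^ (k - d)) v')" for k
  have a: "\<omega> ((e ^^ i) v) ((e ^^ (d - Suc k)) v') = (if i = k then 1 else 0)" if "i \<le> k" "k < d" for i k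
    using vv'[of "i + (d - Suc k)"] that by (auto simp: pairing)
  have b: "\<omega> ((e ^^ i) v') ((e ^^ (d - Suc k)) v) = (if i = k then - 1 else 0)" if "i \<le> k" "k < d" for i k
    using a[OF that] om_skew[of "(e ^^ i) v'"] that pairing[of i "d - Suc k"] pairing[of "d - Suc k" i]
    by (simp add: add.commute)
  have "dim perp + 2 * d \<le> dim S"
  proof (rule dim_le_of_functionals[where f = f and w = w])
    show "linf (f k)" for k unfolding f_def using om_linear(1) by (cases "k < d") simp_all
    show "f k b = 0" if "b \<in> perp" for k b using perp_orth[OF that] by (simp add: f_def)
    show "w k \<in> S" for k by (simp add: w_def pow_mem v v')
    show "f k (w i) = 0" if "k < 2 * d" "i < k" for i k
      using that a[of i k] b[of "i - d" "k - d"] isotropic by (auto simp: f_def w_def)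
    show "f k (w k) \<noteq> 0" if "k < 2 * d" for k
    proof -
      have "k - d < d" using that m2 by linarith
      then have "\<omega> ((e ^^ (k - d)) v') ((e ^^ (d - 1 - (k - d))) v) = - 1"
        using b[of "k - d" "k - d"] by simp
      then show ?thesis using a[of k k] unfolding f_def w_def by (cases "k < d") auto
    qed
  qed (use S(2) perp_subset in auto)
  then show "2 * d + dim perp \<le> dim S" by simp
qed

end

context skew_space
begin

text \<open>A piece has dimension \<open>2 d > 0\<close>, so the dimension drops. The full
  orthogonal decomposition is never formed; whatever is needed about it is proved by this
  induction.\<close>

lemma symplectic_induct [consumes 1, case_names zero split]:
  assumes "self_adjoint_op scale \<omega> e S"
    and zero: "P {0}"
    and split: "\<And>S m v v'. cyclic_split scale \<omega> e S m v v' \<Longrightarrow>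
      P (cyclic_split.perp \<omega> e S v v') \<Longrightarrow> P S"
  shows "P S"
  using assms(1)
proof (induction "dim S" arbitrary: S rule: less_induct)
  case less
  interpret self_adjoint_op scale \<omega> e S by fact
  show ?case
  proof (cases "S = {0}")
    case False
    then obtain m v v' where "lead_coeff m = 1" "0 < degree m" "\<And>w. w \<in> S \<Longrightarrow> papp e m w = 0"
      "v \<in> S" "v' \<in> S" "\<And>i. i < degree m \<Longrightarrow> \<omega> ((e ^^ i) v) v' = (if Suc i = degree m then 1 else 0)"
      using cyclic_pair by blast
    then interpret cyclic_split scale \<omega> e S m v v' by unfold_locales
    have "P perp" using less.hyps[OF _ perp_self_adjoint_op] dim_perp m2 by simp
    then show ?thesis using split cyclic_split_axioms by blast
  qed (use zero in simp)
qed

end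

definition wedge_scale :: "'k::comm_ring_1 \<Rightarrow> ('k \<times> 'x \<times> 'y) list \<Rightarrow> ('k \<times> 'x \<times> 'y) list" where
  "wedge_scale t us = map (\<lambda>(c, a, b). (t * c, a, b)) us"

lemma wedge_scale_simps [simp]:
  "wedge_scale t [] = []" "wedge_scale t ((c, a, b) # us) = (t * c, a, b) # wedge_scale t us"
  by (simp_all add: wedge_scale_def)

lemma wedge_eval_scale: "wedge_eval \<beta> (wedge_scale t us) = t * wedge_eval \<beta> us"
  by (induction us) (auto simp: ring_distribs mult.assoc)

lemma wedge_act_scale: "wedge_act x (wedge_scale t us) = wedge_scale t (wedge_act x us)"
  by (induction us) auto

lemma wedge_scale_subset: "set us \<subseteq> UNIV \<times> S \<Longrightarrow> set (wedge_scale t us) \<subseteq> UNIV \<times> S"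
  by (auto simp: wedge_scale_def)

context char0_space
begin

lemma dim_zero: "dim {0} = 0"
  using dim_le_card[of "{0}" "{}"] by simp

end

context skew_space
begin

lemma skew_adjointI:
  "lin x \<Longrightarrow> (\<And>a b. \<omega> (x a) b = - \<omega> a (x b)) \<Longrightarrow> skew_adjoint x"
  by (simp add: skew_adjoint_def)

lemma alternating_pow:
  assumes \<beta>: "\<And>a b. a \<in> S \<Longrightarrow> b \<in> S \<Longrightarrow> \<beta> (e a) b = \<beta> a (e b)" and "e ` S \<subseteq> S" "a \<in> S" "b \<in> S"
  shows "\<beta> ((e ^^ i) a) b = \<beta> a ((e ^^ i) b)"
  using assms(3,4)
proof (induction i arbitrary: b)
  case (Suc i)
  have "\<beta> ((e ^^ Suc i) a) b = \<beta> ((e ^^ i) a) (e b)"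
    using \<beta> Suc.prems funpow_mem[OF assms(2)] by simp
  also have "\<dots> = \<beta> a ((e ^^ Suc i) b)"
    using Suc assms(2) by (simp add: image_subset_iff funpow_swap1)
  finally show ?case .
qed simp

end

section \<open>Commuting operators and forms attached to a split pair\<close>

context cyclic_split
begin

text \<open>These operators give the forms \<open>\<omega>(e^k a, b)\<close> of one piece, extended
  by 0 to the complement.\<close>

lemma self_adjoint_pow_pr: "self_adjoint (\<lambda>w. (e ^^ k) (pr w))"
  unfolding self_adjoint_def
proof (intro conjI allI)
  show "lin (\<lambda>w. (e ^^ k) (pr w))"
    by (intro linI) (simp_all add: lin_add[OF lin_funpow[OF e_lin]] lin_scale[OF lin_funpow[OF e_lin]]
        lin_add[OF pr_lin] lin_scale[OF pr_lin])
  show "\<omega> ((e ^^ k) (pr a)) b = \<omega> a ((e ^^ k) (pr b))" for a b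
    using pr_self_adjoint by (simp add: pow_adj self_adjoint_def pr_commute_pow[symmetric])
qed

lemma bez_lin_first: "lin (\<lambda>p. bez p q w)"
  by (intro linI)
    (simp_all add: bez_def om_simps scale_sum_right ring_distribs scale_left_distrib sum.distrib
      lin_add[OF lin_funpow[OF e_lin]] lin_scale[OF lin_funpow[OF e_lin]] mult.left_commute)

lemma bez_perp: "q \<in> perp \<Longrightarrow> bez p q w \<in> perp"
  unfolding bez_def by (intro subspace_sum perp_subspace subspace_scale perp_pow)

text \<open>The symmetrised Bezoutian is skew-adjoint by \<open>bez_adj\<close>, hence an element of
  the Lie algebra, and for \<open>p\<close> and \<open>q\<close> in \<open>S\<close> it commutes
  with \<open>e\<close>. It is the element of the stabiliser that mixes a piece with its
  complement.\<close>

abbreviation sbez where "sbez p q \<equiv> \<lambda>w. bez p q w + bez q p w"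

lemma sbez_skew_adjoint: "skew_adjoint (sbez p q)"
  by (rule skew_adjointI)
    (auto intro!: linI simp: lin_add[OF bez_lin] lin_scale[OF bez_lin] scale_right_distrib om_simps bez_adj)

lemma sbez_commute: "p \<in> S \<Longrightarrow> q \<in> S \<Longrightarrow> sbez p q (e a) = e (sbez p q a)"
  by (simp add: bez_commute lin_add[OF e_lin])

lemma sbez_range: "p \<in> S \<Longrightarrow> q \<in> S \<Longrightarrow> range (sbez p q) \<subseteq> S"
  by (auto intro!: subspace_add S(1) bez_mem)

text \<open>With \<open>p\<close> in \<open>perp\<close>, the summand \<open>bez p q\<close> kills
  \<open>v\<close> and \<open>v'\<close>, while \<open>bez q p\<close> kills \<open>q\<close> and
  sends the other of the two to \<open>\<plusminus> p\<close>. In both cases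
  \<open>v \<and> v'\<close> goes to \<open>p \<and> q\<close>.\<close>

lemma sbez_wedge:
  assumes \<beta>: "alternating \<beta>" and p: "p \<in> perp" and q: "q = v \<or> q = v'"
  shows "wedge_eval \<beta> (wedge_act (sbez p q) [(1, v, v')]) = - \<beta> q p"
proof -
  have z: "bez p y v = 0" "bez p y v' = 0" for y
    using perp_orth(1,2)[OF perp_pow[OF p], of 0] by (auto intro: bez_zero)
  show ?thesis
    using q alternating_skew[OF \<beta>, of p v'] by (auto simp: z bez_v alternating_simps[OF \<beta>])
qed

text \<open>The operator \<open>R\<close> that records the effect of \<open>sbez p q\<close> on a
  bivector \<open>us\<close> of the complement: for forms symmetric under \<open>e\<close>, the
  result has the same value as \<open>R p \<and> q\<close>. It is linear in \<open>p\<close> and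
  independent of \<open>q\<close>.\<close>

definition bez_op where
  "bez_op us p = (\<Sum>(c, a, b)\<leftarrow>us. c *s (bez p a b - bez p b a))"

lemma bez_op_simps [simp]:
  "bez_op [] p = 0" "bez_op ((c, a, b) # us) p = c *s (bez p a b - bez p b a) + bez_op us p"
  by (simp_all add: bez_op_def)

lemma bez_op_lin: "lin (bez_op us)"
proof (induction us)
  case (Cons u us)
  obtain c a b where u: "u = (c, a, b)" by (cases u)
  show ?case
    by (rule linI)
      (simp_all add: u lin_add[OF Cons.IH] lin_scale[OF Cons.IH]
      lin_add[OF bez_lin_first] lin_scale[OF bez_lin_first] algebra_simps)
qed (auto intro!: linI)

lemma bez_op_perp:
  assumes "set us \<subseteq> UNIV \<times> perp \<times> perp" shows "bez_op us p \<in> perp"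
  using assms
proof (induction us)
  case (Cons u us)
  then show ?case
    by (auto intro!: subspace_add subspace_scale subspace_diff perp_subspace bez_perp)
qed (simp add: subspace_0[OF perp_subspace])

text \<open>On \<open>perp\<close> the summand \<open>bez q p\<close> vanishes. The other one,
  \<open>bez p q x\<close>, is a combination of the \<open>e^i q\<close>; symmetry of
  \<open>\<beta>\<close> under \<open>e\<close> shifts these powers to the second entry
  \<open>y\<close>, which turns \<open>\<beta>(bez p q x, y)\<close> into
  \<open>\<beta>(q, bez p y x)\<close>.\<close>

lemma sbez_wedge_perp:
  assumes \<beta>: "alternating \<beta>" "\<And>a b. a \<in> S \<Longrightarrow> b \<in> S \<Longrightarrow> \<beta> (e a) b = \<beta> a (e b)"
    and q: "q = v \<or> q = v'" and us: "set us \<subseteq> UNIV \<times> perp \<times> perp"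
  shows "wedge_eval \<beta> (wedge_act (sbez p q) us) = - \<beta> q (bez_op us p)"
  using us
proof (induction us)
  case Nil
  then show ?case by (simp add: alternating_simps[OF \<beta>(1)])
next
  case (Cons u us)
  obtain c a b where u: "u = (c, a, b)" by (cases u)
  have ab: "a \<in> perp" "b \<in> perp" using Cons.prems u by auto
  have qS: "q \<in> S" using q v v' by blast
  have z: "bez q p w = 0" if "w \<in> perp" for w
    using q perp_orth(3,4)[OF that] by (auto intro: bez_zero)
  have k: "\<beta> (bez p q x) y = \<beta> q (bez p y x)" if "x \<in> perp" "y \<in> perp" for x y
  proof -
    have "\<beta> ((e ^^ i) q) y = \<beta> q ((e ^^ i) y)" for i
      using alternating_pow[where \<beta> = \<beta> and e = e and S = S, OF \<beta>(2) S(3) qS] that perp_subset by blast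
    then show ?thesis by (simp add: bez_def alternating_sum[OF \<beta>(1)] alternating_simps[OF \<beta>(1)])
  qed
  have "\<beta> a (bez p q b) = - \<beta> (bez p q b) a" by (rule alternating_skew[OF \<beta>(1)])
  then have "wedge_eval \<beta> (wedge_act (sbez p q) [u]) = - \<beta> q (c *s (bez p a b - bez p b a))"
    using ab by (simp add: u z k alternating_simps[OF \<beta>(1)] right_diff_distrib)
  then show ?case
    using Cons by (simp add: u alternating_simps[OF \<beta>(1)])
qed

text \<open>Skew-adjointness turns a range orthogonal to \<open>a\<close> into a kernel containing
  \<open>a\<close>. Such operators therefore do not move \<open>v \<and> v'\<close>.\<close>

lemma skew_adjoint_perp:
  assumes x: "skew_adjoint x" "range x \<subseteq> perp" and a: "a = v \<or> a = v'"
  shows "x a = 0"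
proof (rule nondeg_left)
  show "x a \<in> S" using x(2) perp_subset by blast
  fix y
  have "\<omega> (x a) y = - \<omega> a (x y)" using x(1) by (simp add: skew_adjoint_def)
  moreover have "x y \<in> perp" using x(2) by auto
  then have "- \<omega> a (x y) = 0" using a perp_orth(1,2)[of "x y" 0] by auto
  ultimately show "\<omega> (x a) y = 0" by simp
qed

text \<open>Symmetry under \<open>e\<close> makes \<open>\<beta>\<close> vanish on each single
  cyclic subspace, just like \<open>\<omega>\<close>, and reduces its values on the piece to the
  numbers \<open>\<beta>(e^i v, v')\<close>. This is why \<open>d\<close> test pairs suffice for a
  piece of dimension \<open>2 d\<close>.\<close>

lemma alternating_vanish:
  assumes \<beta>: "alternating \<beta>" "\<And>a b. a \<in> S \<Longrightarrow> b \<in> S \<Longrightarrow> \<beta> (e a) b = \<beta> a (e b)"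
    and z: "\<And>i. i < d \<Longrightarrow> \<beta> ((e ^^ i) v) v' = 0"
    and vp: "\<And>p. p \<in> perp \<Longrightarrow> \<beta> v p = 0" "\<And>p. p \<in> perp \<Longrightarrow> \<beta> v' p = 0"
    and pp: "\<And>p q. p \<in> perp \<Longrightarrow> q \<in> perp \<Longrightarrow> \<beta> p q = 0"
    and ab: "a \<in> S" "b \<in> S"
  shows "\<beta> a b = 0"
proof -
  have sym: "\<beta> ((e ^^ i) a) b = \<beta> a ((e ^^ i) b)" if "a \<in> S" "b \<in> S" for i a b
    by (rule alternating_pow[OF _ S(3) that]) (rule \<beta>(2))
  \<comment> \<open>For \<open>i \<ge> d\<close>, the identity \<open>pr (e^i v) = e^i v\<close>
    expresses the vector by the powers below \<open>d\<close>.\<close>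
  have tau: "\<beta> ((e ^^ i) v) v' = 0" for i
  proof -
    have "pr ((e ^^ i) v) = (e ^^ i) v" by (simp add: pr_commute_pow pr_v)
    then have "(e ^^ i) v = bez v' v ((e ^^ i) v)"
      using isotropic by (simp add: pr_def bez_zero)
    also have "\<beta> \<dots> v' = 0"
      using z by (simp add: bez_def alternating_sum[OF \<beta>(1)] alternating_simps[OF \<beta>(1)])
    finally show ?thesis .
  qed
  have iso: "\<beta> ((e ^^ i) x) ((e ^^ j) x) = 0" if x: "x \<in> S" for i j x
  proof -
    have "\<beta> ((e ^^ k) x) x = 0" for k
      using sym[OF x x, of k] alternating_skew[OF \<beta>(1), of "(e ^^ k) x" x] by simp
    moreover have "\<beta> ((e ^^ i) x) ((e ^^ j) x) = \<beta> ((e ^^ (j + i)) x) x"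
      using sym[OF pow_mem[OF x] x, of j i] by (simp add: funpow_add)
    ultimately show ?thesis by simp
  qed
  have c: "\<beta> ((e ^^ i) v) ((e ^^ j) v') = 0" for i j
    using sym[OF pow_mem[OF v] v', of j i] tau[of "j + i"] by (simp add: funpow_add)
  have c': "\<beta> ((e ^^ i) v') ((e ^^ j) v) = 0" for i j
    using c[of j i] alternating_skew[OF \<beta>(1), of "(e ^^ i) v'"] by simp
  have 1: "\<beta> ((e ^^ i) x) (pr s) = 0" if "x = v \<or> x = v'" for i x s
    by (rule linf_pr[OF alternating_linear(2)[OF \<beta>(1)]]) (use that iso[OF v] iso[OF v'] c c' in auto)
  have 2: "\<beta> ((e ^^ i) x) p = 0" if "x = v \<or> x = v'" "p \<in> perp" for i x p
  proof -
    have "\<beta> ((e ^^ i) x) p = \<beta> x ((e ^^ i) p)"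
      using sym that v v' perp_subset by blast
    then show ?thesis using vp perp_pow[OF that(2)] that(1) by auto
  qed
  have 3: "\<beta> ((e ^^ i) x) s = 0" if "x = v \<or> x = v'" "s \<in> S" for i x s
    using 1[OF that(1), of i s] 2[OF that(1) diff_pr_perp[OF that(2)], of i]
    by (simp add: alternating_simps[OF \<beta>(1)])
  have 4: "\<beta> (pr t) s = 0" if "s \<in> S" for t s
    by (rule linf_pr[OF alternating_linear(1)[OF \<beta>(1)]]) (use that 3 in auto)
  have "\<beta> (a - pr a) (b - pr b) = 0" using pp diff_pr_perp ab by blast
  moreover have "\<beta> (pr a) b = 0" "\<beta> (pr a) (pr b) = 0" using 4 ab pr_mem by blast+
  moreover have "\<beta> a (pr b) = 0" using 4[OF ab(1), of b] alternating_skew[OF \<beta>(1), of a "pr b"] by simp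
  ultimately show ?thesis by (simp add: alternating_simps[OF \<beta>(1)])
qed

end

section \<open>The two counts by induction over the pieces\<close>

context skew_space
begin

text \<open>Each \<open>y j\<close> yields an alternating form \<open>\<omega>(y j a, b)\<close>
  symmetric under \<open>e\<close>. Its triangular values at the bivectors
  \<open>p i \<and> q i\<close> certify that these \<open>n\<close> functionals are
  independent.\<close>

lemma self_adjoint_commutant:
  assumes "self_adjoint_op scale \<omega> e S"
  shows "\<exists>n y p q. dim S = 2 * n \<and>
    (\<forall>j<n. self_adjoint (y j) \<and> (\<forall>a. y j (e a) = e (y j a)) \<and> range (y j) \<subseteq> S \<and>
      p j \<in> S \<and> q j \<in> S \<and> \<omega> (y j (p j)) (q j) \<noteq> 0) \<and>
    (\<forall>j<n. \<forall>i<j. \<omega> (y j (p i)) (q i) = 0)"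
  using assms
proof (induction rule: symplectic_induct)
  case zero
  show ?case by (rule exI[of _ 0]) (simp add: dim_zero)
next
  case (split S m v v')
  interpret cyclic_split scale \<omega> e S m v v' by fact
  obtain n y p q where *: "dim perp = 2 * n \<and>
    (\<forall>j<n. self_adjoint (y j) \<and> (\<forall>a. y j (e a) = e (y j a)) \<and> range (y j) \<subseteq> perp \<and>
      p j \<in> perp \<and> q j \<in> perp \<and> \<omega> (y j (p j)) (q j) \<noteq> 0) \<and>
    (\<forall>j<n. \<forall>i<j. \<omega> (y j (p i)) (q i) = 0)"
    using split(2) by (elim exE) (rule that)
  have n: "dim perp = 2 * n" using * by (elim conjE)
  have y: "self_adjoint (y j) \<and> (\<forall>a. y j (e a) = e (y j a)) \<and> range (y j) \<subseteq> perp \<and>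
      p j \<in> perp \<and> q j \<in> perp \<and> \<omega> (y j (p j)) (q j) \<noteq> 0" if "j < n" for j
    using *[THEN conjunct2, THEN conjunct1, rule_format, OF that] by simp
  have tr: "\<omega> (y j (p i)) (q i) = 0" if "j < n" "i < j" for i j
    using *[THEN conjunct2, THEN conjunct2] that by simp
  \<comment> \<open>The new piece is placed before those of \<open>perp\<close>. Pairing
    \<open>e^(d-1-j)\<close> with \<open>v \<and> e^i v'\<close> gives 0 for \<open>i < j\<close>
    and 1 for \<open>i = j\<close>, which dictates the reversed exponent.\<close>
  define y' where "y' j = (if j < d then \<lambda>w. (e ^^ (d - Suc j)) (pr w) else y (j - d))" for j
  define p' where "p' j = (if j < d then v else p (j - d))" for j
  define q' where "q' j = (if j < d then (e ^^ j) v' else q (j - d))" for j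
  have vv: "\<omega> ((e ^^ (d - Suc j)) v) ((e ^^ i) v') = (if i = j then 1 else 0)" if "i \<le> j" "j < d" for i j
    using that vv'[of "d - Suc j + i"] by (auto simp: pairing)
  have "self_adjoint (y' j) \<and> (\<forall>a. y' j (e a) = e (y' j a)) \<and> range (y' j) \<subseteq> S \<and>
      p' j \<in> S \<and> q' j \<in> S \<and> \<omega> (y' j (p' j)) (q' j) \<noteq> 0" if "j < d + n" for j
  proof (cases "j < d")
    case True
    then show ?thesis
      using vv[of j j] self_adjoint_pow_pr pow_mem pr_mem v v'
      by (auto simp: y'_def p'_def q'_def pr_v pr_commute funpow_swap1)
  next
    case False
    then have k: "j - d < n" and eqs: "y' j = y (j - d)" "p' j = p (j - d)" "q' j = q (j - d)"
      using that by (simp_all add: y'_def p'_def q'_def)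
    have *: "self_adjoint (y (j - d))" "\<forall>a. y (j - d) (e a) = e (y (j - d) a)"
      "range (y (j - d)) \<subseteq> perp" "p (j - d) \<in> perp" "q (j - d) \<in> perp"
      "\<omega> (y (j - d) (p (j - d))) (q (j - d)) \<noteq> 0"
      using y[OF k] by simp_all
    show ?thesis
      unfolding eqs by (intro conjI * order_trans[OF *(3) perp_subset] subsetD[OF perp_subset])
  qed
  moreover have "\<omega> (y' j (p' i)) (q' i) = 0" if "j < d + n" "i < j" for i j
  proof -
    consider "j < d" | "d \<le> j" "i < d" | "d \<le> i" using that by linarith
    then show ?thesis
    proof cases
      case 1
      then show ?thesis using that vv[of i j] by (simp add: y'_def p'_def q'_def pr_v)
    next
      case 2
      \<comment> \<open>Moved across the form, \<open>?y\<close> takes \<open>e^i v'\<close> into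
        \<open>perp\<close>, which is orthogonal to \<open>v\<close>.\<close>
      let ?y = "y (j - d)"
      have yj: "self_adjoint ?y" "range ?y \<subseteq> perp" using y[of "j - d"] that 2 by auto
      have "\<omega> (?y v) ((e ^^ i) v') = \<omega> v (?y ((e ^^ i) v'))"
        using yj(1) by (simp add: self_adjoint_def)
      moreover have "?y ((e ^^ i) v') \<in> perp" using yj(2) by auto
      then have "\<omega> v (?y ((e ^^ i) v')) = 0" using perp_orth(1)[of "?y ((e ^^ i) v')" 0] by simp
      ultimately show ?thesis using 2 by (simp add: y'_def p'_def q'_def)
    next
      case 3
      then show ?thesis using that tr[of "j - d" "i - d"] by (simp add: y'_def p'_def q'_def)
    qed
  qed
  moreover have "dim S = 2 * (d + n)" using dim_perp n by simp
  ultimately show ?case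
    by (intro exI[of _ "d + n"] exI[of _ y'] exI[of _ p'] exI[of _ q']) simp
qed

text \<open>\<open>us\<close> is the sum of the bivectors \<open>v \<and> v'\<close> over the summands of a decomposition of \<open>S\<close> into pairs
  of cyclic subspaces, with generic coefficients, and \<open>P\<close> consists of the pairs \<open>(e^i v, v')\<close>.\<close>

lemma generic_wedge:
  assumes "self_adjoint_op scale \<omega> e S"
  shows "\<exists>us P. set us \<subseteq> UNIV \<times> S \<times> S \<and> finite P \<and> P \<subseteq> S \<times> S \<and> 2 * card P \<le> dim S \<and>
    (\<forall>\<beta>. alternating \<beta> \<and> (\<forall>a\<in>S. \<forall>b\<in>S. \<beta> (e a) b = \<beta> a (e b)) \<and>
      (\<forall>x. skew_adjoint x \<longrightarrow> (\<forall>a. x (e a) = e (x a)) \<longrightarrow> range x \<subseteq> S \<longrightarrow>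
        wedge_eval \<beta> (wedge_act x us) = 0) \<and>
      (\<forall>(p, q)\<in>P. \<beta> p q = 0) \<longrightarrow> (\<forall>a\<in>S. \<forall>b\<in>S. \<beta> a b = 0))"
  using assms
proof (induction rule: symplectic_induct)
  case zero
  have "\<beta> 0 0 = 0" if "alternating \<beta>" for \<beta> using alternating_self[OF that] .
  then have "\<forall>\<beta>. alternating \<beta> \<longrightarrow> (\<forall>a\<in>{0}. \<forall>b\<in>{0}. \<beta> a b = 0)" by simp
  then show ?case
    by (intro exI[of _ "[]"] exI[of _ "{}"] conjI) (simp_all add: dim_zero)
next
  case (split S m v v')
  interpret cyclic_split scale \<omega> e S m v v' by fact
  let ?hyp = "\<lambda>S us P \<beta>. alternating \<beta> \<and> (\<forall>a\<in>S. \<forall>b\<in>S. \<beta> (e a) b = \<beta> a (e b)) \<and>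
      (\<forall>x. skew_adjoint x \<longrightarrow> (\<forall>a. x (e a) = e (x a)) \<longrightarrow> range x \<subseteq> S \<longrightarrow>
        wedge_eval \<beta> (wedge_act x us) = 0) \<and> (\<forall>(p, q)\<in>P. \<beta> p q = 0)"
  obtain us P where us: "set us \<subseteq> UNIV \<times> perp \<times> perp"
    and P: "finite P" "P \<subseteq> perp \<times> perp" "2 * card P \<le> dim perp"
    and IH: "\<And>\<beta> a b. ?hyp perp us P \<beta> \<Longrightarrow> a \<in> perp \<Longrightarrow> b \<in> perp \<Longrightarrow> \<beta> a b = 0"
  proof -
    from split(2) obtain us P where *: "set us \<subseteq> UNIV \<times> perp \<times> perp \<and> finite P \<and>
      P \<subseteq> perp \<times> perp \<and> 2 * card P \<le> dim perp \<and>
      (\<forall>\<beta>. ?hyp perp us P \<beta> \<longrightarrow> (\<forall>a\<in>perp. \<forall>b\<in>perp. \<beta> a b = 0))"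
      by (elim exE)
    show thesis
    proof (rule that)
      fix \<beta> a b assume h: "?hyp perp us P \<beta>" "a \<in> perp" "b \<in> perp"
      have "?hyp perp us P \<beta> \<longrightarrow> (\<forall>a\<in>perp. \<forall>b\<in>perp. \<beta> a b = 0)"
        using * by (elim conjE) (erule spec)
      from mp[OF this h(1)] show "\<beta> a b = 0" using h(2,3) by simp
    qed (use * in simp_all)
  qed
  \<comment> \<open>\<open>t\<close> is chosen so that \<open>1 + t R\<close> maps
    \<open>perp\<close> onto itself; then every vector of \<open>perp\<close> is reached in the
    mixing argument below.\<close>
  obtain t where t: "t \<noteq> 0" "\<And>w. w \<in> perp \<Longrightarrow> \<exists>w'\<in>perp. w' + t *s bez_op us w' = w"
  proof -
    have "bez_op us ` perp \<subseteq> perp" using bez_op_perp[OF us] by auto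
    from generic_invertible[OF bez_op_lin perp_subspace fin_span_subset[OF S(2) perp_subset] this]
    show thesis using that by metis
  qed
  define us' where "us' = (1, v, v') # wedge_scale t us"
  define P' where "P' = P \<union> (\<lambda>i. ((e ^^ i) v, v')) ` {..<d}"
  have ev: "wedge_eval \<beta> (wedge_act x us') =
    wedge_eval \<beta> (wedge_act x [(1, v, v')]) + t * wedge_eval \<beta> (wedge_act x us)" for \<beta> x
    by (simp add: us'_def wedge_act_scale wedge_eval_scale)
  have main: "\<beta> a b = 0" if \<beta>: "?hyp S us' P' \<beta>" and ab: "a \<in> S" "b \<in> S" for \<beta> a b
  proof -
    have alt: "alternating \<beta>" using \<beta> by blast
    have sym: "\<beta> (e a) b = \<beta> a (e b)" if "a \<in> S" "b \<in> S" for a b using \<beta> that by simp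
    have inv: "wedge_eval \<beta> (wedge_act x us') = 0"
      if "skew_adjoint x" "\<And>a. x (e a) = e (x a)" "range x \<subseteq> S" for x using \<beta> that by simp
    have P'0: "\<forall>(p, q)\<in>P'. \<beta> p q = 0" using \<beta> by (elim conjE)
    \<comment> \<open>Elements of the stabiliser with range in \<open>perp\<close> kill
      \<open>v\<close> and \<open>v'\<close>, so they act on \<open>us'\<close> as on
      \<open>t us\<close>; as \<open>t\<close> is nonzero, invariance passes down to
      \<open>us\<close>.\<close>
    have "?hyp perp us P \<beta>"
    proof (intro conjI ballI allI impI)
      show "alternating \<beta>" by (rule alt)
      show "\<beta> (e a) b = \<beta> a (e b)" if "a \<in> perp" "b \<in> perp" for a b
        using that perp_subset by (intro sym) auto
      show "case pq of (p, q) \<Rightarrow> \<beta> p q = 0" if "pq \<in> P" for pq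
        using P'0 that by (simp add: P'_def)
      fix x assume x: "skew_adjoint x" "\<forall>a. x (e a) = e (x a)" "range x \<subseteq> perp"
      have "range x \<subseteq> S" using x(3) perp_subset by blast
      then have "wedge_eval \<beta> (wedge_act x us') = 0" using x(1,2) by (intro inv) simp_all
      moreover have "x v = 0" "x v' = 0" using skew_adjoint_perp[OF x(1,3)] by auto
      ultimately show "wedge_eval \<beta> (wedge_act x us) = 0"
        using t(1) by (simp add: ev alternating_simps[OF alt])
    qed
    then have pp: "\<beta> p q = 0" if "p \<in> perp" "q \<in> perp" for p q by (rule IH) (rule that)+
    \<comment> \<open>Applied to \<open>sbez w q\<close>, invariance says
      \<open>\<beta>(q, w + t R w) = 0\<close>, and \<open>w\<close> solves
      \<open>w + t R w = p\<close>.\<close>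
    have qp: "\<beta> q p = 0" if q: "q = v \<or> q = v'" and p: "p \<in> perp" for q p
    proof -
      obtain w where w: "w \<in> perp" "w + t *s bez_op us w = p" using t(2)[OF p] by blast
      have wS: "w \<in> S" and qS: "q \<in> S" using w perp_subset q v v' by auto
      have "wedge_eval \<beta> (wedge_act (sbez w q) us') = 0"
        by (rule inv[OF sbez_skew_adjoint sbez_commute[OF wS qS] sbez_range[OF wS qS]])
      moreover have "wedge_eval \<beta> (wedge_act (sbez w q) us) = - \<beta> q (bez_op us w)"
        by (rule sbez_wedge_perp[OF alt _ q us]) (rule sym)
      ultimately have "\<beta> q w + t * \<beta> q (bez_op us w) = 0"
        unfolding ev sbez_wedge[OF alt w(1) q] by (simp add: add_eq_0_iff)
      then show ?thesis by (simp add: w(2)[symmetric] alternating_simps[OF alt])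
    qed
    show ?thesis
    proof (rule alternating_vanish[OF alt _ _ _ _ _ ab])
      show "\<beta> (e a) b = \<beta> a (e b)" if "a \<in> S" "b \<in> S" for a b by (rule sym[OF that])
      show "\<beta> p q = 0" if "p \<in> perp" "q \<in> perp" for p q by (rule pp[OF that])
      show "\<beta> v p = 0" "\<beta> v' p = 0" if "p \<in> perp" for p using qp that by blast+
      show "\<beta> ((e ^^ i) v) v' = 0" if "i < d" for i
        using P'0 that unfolding P'_def by fastforce
    qed
  qed
  have "\<forall>\<beta>. ?hyp S us' P' \<beta> \<longrightarrow> (\<forall>a\<in>S. \<forall>b\<in>S. \<beta> a b = 0)"
    by (intro allI impI ballI) (rule main)
  moreover have "set us' \<subseteq> UNIV \<times> S \<times> S" "finite P'" "P' \<subseteq> S \<times> S"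
  proof -
    have "set us \<subseteq> UNIV \<times> S \<times> S" using us perp_subset by blast
    then show "set us' \<subseteq> UNIV \<times> S \<times> S"
      using wedge_scale_subset[of us "S \<times> S" t] v v' by (simp add: us'_def)
    show "finite P'" "P' \<subseteq> S \<times> S"
      using P pow_mem[OF v] v' perp_subset by (auto simp: P'_def)
  qed
  moreover have "2 * card P' \<le> dim S"
  proof -
    have "card P' \<le> card P + d"
      unfolding P'_def by (intro order_trans[OF card_Un_le] add_mono order_trans[OF card_image_le]) auto
    then show ?thesis using P(3) dim_perp by simp
  qed
  ultimately show ?case
    by (intro exI[of _ us'] exI[of _ P'] conjI)
qed

end

section \<open>Bivectors as self-adjoint operators\<close>

context skew_space
begin

definition op_of :: "('a \<times> 'b \<times> 'b) list \<Rightarrow> 'b \<Rightarrow> 'b" where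
  "op_of us w = (\<Sum>(c, a, b)\<leftarrow>us. (c * \<omega> w a) *s b - (c * \<omega> w b) *s a)"

lemma op_of_simps [simp]:
  "op_of [] w = 0" "op_of ((c, a, b) # us) w = (c * \<omega> w a) *s b - (c * \<omega> w b) *s a + op_of us w"
  by (simp_all add: op_of_def)

lemma op_of_lin: "lin (op_of us)"
proof (induction us)
  case (Cons u us)
  then show ?case
    by (cases u) (auto intro!: linI simp: lin_add lin_scale om_simps algebra_simps)
qed (auto intro!: linI)

lemma op_of_self_adjoint: "self_adjoint (op_of us)"
proof -
  have "\<omega> (op_of us a) b = \<omega> a (op_of us b)" for a b
  proof (induction us)
    case (Cons u us)
    obtain c x y where u: "u = (c, x, y)" by (cases u)
    show ?case
      using Cons.IH om_skew[of y b] om_skew[of x b] by (simp add: u om_simps)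
  qed (simp add: om_0)
  then show ?thesis using op_of_lin by (simp add: self_adjoint_def)
qed

lemma op_of_mem: "subspace S \<Longrightarrow> set us \<subseteq> UNIV \<times> S \<times> S \<Longrightarrow> op_of us w \<in> S"
  by (induction us) (auto intro!: subspace_add subspace_diff subspace_scale subspace_0)

text \<open>The image of the symmetric product of \<open>p\<close> and \<open>q\<close> under the
  identification of the symmetric square with the symplectic Lie algebra.\<close>

definition rank_one :: "'b \<Rightarrow> 'b \<Rightarrow> 'b \<Rightarrow> 'b" where
  "rank_one p q w = \<omega> w p *s q + \<omega> w q *s p"

lemma rank_one_skew_adjoint: "skew_adjoint (rank_one p q)"
proof (rule skew_adjointI)
  show "\<omega> (rank_one p q a) b = - \<omega> a (rank_one p q b)" for a b
    using om_skew[of p b] om_skew[of q b] by (simp add: rank_one_def om_simps)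
qed (auto intro!: linI simp: rank_one_def om_simps algebra_simps)

text \<open>Explains the condition \<open>\<beta>(e p, q) = \<beta>(p, e q)\<close>: it says that
  \<open>\<beta>\<close> vanishes on the images of the bivector under the rank one operators, which
  span the Lie algebra.\<close>

lemma wedge_eval_rank_one:
  assumes "alternating \<beta>"
  shows "wedge_eval \<beta> (wedge_act (rank_one p q) us) = \<beta> (op_of us p) q - \<beta> p (op_of us q)"
proof (induction us)
  case (Cons u us)
  obtain c a b where u: "u = (c, a, b)" by (cases u)
  show ?case
    using Cons.IH alternating_skew[OF assms, of a] alternating_skew[OF assms, of b q] om_skew[of a] om_skew[of b]
    by (simp add: u rank_one_def alternating_simps[OF assms] algebra_simps)
qed (simp add: alternating_simps[OF assms])

text \<open>Equivariance of \<open>op_of\<close>. It makes an element of the Lie algebra that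
  commutes with \<open>op_of us\<close> send the bivector to one whose operator is zero.\<close>

lemma op_of_wedge_act:
  assumes "skew_adjoint x"
  shows "op_of (wedge_act x us) w = x (op_of us w) - op_of us (x w)"
proof -
  have x: "lin x" "\<And>a b. \<omega> a (x b) = - \<omega> (x a) b" using assms by (auto simp: skew_adjoint_def)
  show ?thesis
  proof (induction us)
    case (Cons u us)
    obtain c a b where u: "u = (c, a, b)" by (cases u)
    show ?case
      using Cons.IH by (simp add: u x(2) lin_add[OF x(1)] lin_diff[OF x(1)] lin_scale[OF x(1)])
  qed (simp add: lin_zero[OF x(1)])
qed

text \<open>The decomposition for \<open>e = 0\<close>, where the pieces are hyperbolic planes,
  gives a symplectic basis without a construction of its own.\<close>

lemma dual_bases:
  assumes "subspace S" "fin_span S" "nondeg S"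
  shows "\<exists>ks. set ks \<subseteq> S \<times> S \<and> (\<forall>w\<in>S. w = (\<Sum>(k, l)\<leftarrow>ks. \<omega> w l *s k))"
proof -
  have "self_adjoint_op scale \<omega> (\<lambda>_. 0) S"
    by unfold_locales (use assms subspace_0 in \<open>auto simp: self_adjoint_def om_0 intro!: linI\<close>)
  then show ?thesis
  proof (induction rule: symplectic_induct)
    case zero
    show ?case by (rule exI[of _ "[]"]) simp
  next
    case (split S m v v')
    interpret cyclic_split scale \<omega> "\<lambda>_. 0" S m v v' by fact
    obtain ks where ks: "set ks \<subseteq> perp \<times> perp" "\<And>w. w \<in> perp \<Longrightarrow> w = (\<Sum>(k, l)\<leftarrow>ks. \<omega> w l *s k)"
      using split(2) by blast
    have p0: "((\<lambda>_::'b. 0::'b) ^^ j) x = 0" if "1 \<le> j" for j x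
      using that by (cases j) auto
    \<comment> \<open>For \<open>d > 1\<close> the vector \<open>e^(d-1) v\<close> would be 0, yet
      it pairs to 1 with \<open>v'\<close>.\<close>
    have d: "d = 1"
    proof (rule ccontr)
      assume "d \<noteq> 1"
      then have k: "1 \<le> d - 1" "d - 1 < d" "Suc (d - 1) = d" using m2 by linarith+
      then have "\<omega> (((\<lambda>_. 0) ^^ (d - 1)) v) v' = 1" using vv'[OF k(2)] by presburger
      then show False unfolding p0[OF k(1)] by (simp add: om_0)
    qed
    have pr: "pr w = \<omega> w v' *s v - \<omega> w v *s v'" for w
      using m1 d by (simp add: pr_def bez_def)
    have "w = (\<Sum>(k, l)\<leftarrow>(v, v') # (- v', v) # ks. \<omega> w l *s k)" if w: "w \<in> S" for w
    proof -
      have "(\<Sum>(k, l)\<leftarrow>ks. \<omega> (w - pr w) l *s k) = (\<Sum>(k, l)\<leftarrow>ks. \<omega> w l *s k)"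
      proof (intro arg_cong[of _ _ sum_list] map_cong refl)
        fix kl assume "kl \<in> set ks"
        then have l: "snd kl \<in> perp" using ks(1) by auto
        have "\<omega> (pr w) (snd kl) = \<omega> w (pr (snd kl))"
          using pr_self_adjoint by (simp add: self_adjoint_def)
        then have "\<omega> (pr w) (snd kl) = 0" by (simp add: pr_perp[OF l] om_0)
        then show "(case kl of (k, l) \<Rightarrow> \<omega> (w - pr w) l *s k) = (case kl of (k, l) \<Rightarrow> \<omega> w l *s k)"
          by (simp add: case_prod_unfold om_simps)
      qed
      then have "w - pr w = (\<Sum>(k, l)\<leftarrow>ks. \<omega> w l *s k)" using ks(2)[OF diff_pr_perp[OF w]] by simp
      then show ?thesis by (simp add: pr algebra_simps)
    qed
    moreover have "set ((v, v') # (- v', v) # ks) \<subseteq> S \<times> S"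
      using ks(1) perp_subset v v' subspace_neg[OF S(1)] by auto
    ultimately show ?case by blast
  qed
qed

lemma linf_sum_list: "linf f \<Longrightarrow> f (\<Sum>x\<leftarrow>xs. g x) = (\<Sum>x\<leftarrow>xs. f (g x))"
  by (induction xs) (simp_all add: linf_zero linf_add)

lemma lin_sum_list: "lin f \<Longrightarrow> f (\<Sum>x\<leftarrow>xs. g x) = (\<Sum>x\<leftarrow>xs. f (g x))"
  by (induction xs) (simp_all add: lin_zero lin_add)

text \<open>Contracting \<open>\<beta>\<close> with the operator over dual bases recovers the value
  of \<open>\<beta>\<close> on the bivector up to the factor \<open>- 2\<close>. So the passage from
  bivectors to operators is injective.\<close>

lemma wedge_eval_eq_0:
  assumes S: "subspace S" "fin_span S" "nondeg S" and us: "set us \<subseteq> UNIV \<times> S \<times> S"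
    and z: "\<And>w. w \<in> S \<Longrightarrow> op_of us w = 0" and \<beta>: "alternating \<beta>"
  shows "wedge_eval \<beta> us = 0"
proof -
  obtain ks where ks: "set ks \<subseteq> S \<times> S" "\<And>w. w \<in> S \<Longrightarrow> w = (\<Sum>(k, l)\<leftarrow>ks. \<omega> w l *s k)"
    using dual_bases[OF S] by blast
  have "2 * wedge_eval \<beta> us = - (\<Sum>(k, l)\<leftarrow>ks. \<beta> k (op_of us l))"
    using us
  proof (induction us)
    case Nil
    have "(\<Sum>(k, l)\<leftarrow>ks. \<beta> k (op_of [] l)) = (\<Sum>kl\<leftarrow>ks. 0)"
      by (intro arg_cong[of _ _ sum_list] map_cong refl) (auto simp: alternating_simps[OF \<beta>])
    then show ?case by simp
  next
    case (Cons u us)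
    obtain c a b where u: "u = (c, a, b)" by (cases u)
    have k: "\<beta> x y = (\<Sum>(k, l)\<leftarrow>ks. \<omega> x l * \<beta> k y)" if "x \<in> S" for x y
    proof -
      have "\<beta> x y = \<beta> (\<Sum>(k, l)\<leftarrow>ks. \<omega> x l *s k) y" using ks(2)[OF that] by simp
      then show ?thesis
        by (simp add: linf_sum_list[OF alternating_linear(1)[OF \<beta>]] case_prod_unfold alternating_simps[OF \<beta>])
    qed
    \<comment> \<open>The factor 2 arises because the two terms in the operator of
      \<open>a \<and> b\<close> contribute equally.\<close>
    have "2 * (c * \<beta> a b) = c * \<beta> a b - c * \<beta> b a"
      using alternating_skew[OF \<beta>, of b a] by simp
    also have "\<dots> = - (\<Sum>(k, l)\<leftarrow>ks. \<beta> k ((c * \<omega> l a) *s b - (c * \<omega> l b) *s a))"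
    proof -
      have "\<beta> k ((c * \<omega> l a) *s b - (c * \<omega> l b) *s a) = c * (\<omega> b l * \<beta> k a) - c * (\<omega> a l * \<beta> k b)" for k l
        using om_skew[of l a] om_skew[of l b] by (simp add: alternating_simps[OF \<beta>])
      then show ?thesis
        using Cons.prems u k[of a b] k[of b a]
        by (simp add: case_prod_unfold sum_list_subtractf sum_list_const_mult)
    qed
    finally have "2 * wedge_eval \<beta> (u # us) = - (\<Sum>(k, l)\<leftarrow>ks. \<beta> k ((c * \<omega> l a) *s b - (c * \<omega> l b) *s a))
        - (\<Sum>(k, l)\<leftarrow>ks. \<beta> k (op_of us l))"
      using Cons by (simp add: u ring_distribs)
    also have "\<dots> = - (\<Sum>(k, l)\<leftarrow>ks. \<beta> k (op_of (u # us) l))"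
      by (simp add: u case_prod_unfold sum_list_addf alternating_simps[OF \<beta>])
    finally show ?case .
  qed
  also have "(\<Sum>(k, l)\<leftarrow>ks. \<beta> k (op_of us l)) = (\<Sum>kl\<leftarrow>ks. 0)"
    using ks(1) z by (intro arg_cong[of _ _ sum_list] map_cong refl) (auto simp: alternating_simps[OF \<beta>])
  finally show ?thesis by simp
qed

text \<open>Applying \<open>x\<close> to the expansion of \<open>w\<close> gives \<open>x w\<close>
  as the sum of the \<open>\<omega>(w, l) x k\<close>; skew-adjointness gives it also as the sum of
  the \<open>\<omega>(w, x k) l\<close>. Adding both produces rank one operators and the factor
  2.\<close>

lemma skew_adjoint_rank_ones:
  assumes S: "subspace S" "fin_span S" "nondeg S" and x: "skew_adjoint x" "x ` S \<subseteq> S"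
  shows "\<exists>ks. set ks \<subseteq> S \<times> S \<and> (\<forall>w\<in>S. 2 *s x w = (\<Sum>(p, q)\<leftarrow>ks. rank_one p q w))"
proof -
  obtain ks where ks: "set ks \<subseteq> S \<times> S" "\<And>w. w \<in> S \<Longrightarrow> w = (\<Sum>(k, l)\<leftarrow>ks. \<omega> w l *s k)"
    using dual_bases[OF S] by blast
  have lx: "lin x" and xa: "\<And>a b. \<omega> a (x b) = - \<omega> (x a) b" using x by (auto simp: skew_adjoint_def)
  have 1: "(\<Sum>(k, l)\<leftarrow>ks. \<omega> w l *s x k) = x w" if "w \<in> S" for w
    using arg_cong[OF ks(2)[OF that], of x]
    by (simp add: lin_sum_list[OF lx] case_prod_unfold lin_scale[OF lx])
  \<comment> \<open>Tested against \<open>s\<close> in \<open>S\<close>: skew-adjointness moves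
    \<open>x\<close> from \<open>k\<close> to \<open>w\<close>, and what remains is the expansion of
    \<open>s\<close>.\<close>
  have 2: "(\<Sum>(k, l)\<leftarrow>ks. \<omega> w (x k) *s l) = x w" if w: "w \<in> S" for w
  proof -
    let ?z = "(\<Sum>(k, l)\<leftarrow>ks. \<omega> w (x k) *s l)"
    have zS: "?z \<in> S" using ks(1)
      by (induction ks) (auto intro!: subspace_add subspace_scale subspace_0 S(1))
    have "\<omega> (?z - x w) s = 0" if s: "s \<in> S" for s
    proof -
      have "\<omega> ?z s = (\<Sum>(k, l)\<leftarrow>ks. \<omega> s l * \<omega> (x w) k)"
        unfolding linf_sum_list[OF om_linear(1)]
        by (intro arg_cong[of _ _ sum_list] map_cong refl)
          (auto simp: om_simps xa om_skew[of _ s])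
      also have "\<dots> = \<omega> (x w) (\<Sum>(k, l)\<leftarrow>ks. \<omega> s l *s k)"
        by (simp add: linf_sum_list[OF om_linear(2)] case_prod_unfold om_simps)
      finally show ?thesis using ks(2)[OF s] by (simp add: om_simps)
    qed
    moreover have "?z - x w \<in> S" using zS x(2) w S(1) by (auto intro: subspace_diff)
    ultimately show ?thesis using S(3) unfolding nondeg_def by fastforce
  qed
  have "2 *s x w = (\<Sum>(p, q)\<leftarrow>map (\<lambda>(k, l). (l, x k)) ks. rank_one p q w)" if "w \<in> S" for w
  proof -
    have "2 *s x w = x w + x w" by (metis one_add_one scale_left_distrib scale_one)
    also have "\<dots> = (\<Sum>(k, l)\<leftarrow>ks. \<omega> w l *s x k) + (\<Sum>(k, l)\<leftarrow>ks. \<omega> w (x k) *s l)"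
      using 1[OF that] 2[OF that] by simp
    also have "\<dots> = (\<Sum>(k, l)\<leftarrow>ks. rank_one l (x k) w)"
      by (simp add: sum_list_addf[symmetric] case_prod_unfold rank_one_def)
    finally show ?thesis by (simp add: comp_def case_prod_unfold)
  qed
  moreover have "set (map (\<lambda>(k, l). (l, x k)) ks) \<subseteq> S \<times> S" using ks(1) x(2) by auto
  ultimately show ?thesis by blast
qed

text \<open>The converse of testing with rank one operators: twice \<open>x\<close> is a sum of
  these on \<open>S\<close>, and for each of them \<open>wedge_eval_rank_one\<close> turns the
  symmetry of \<open>\<beta>\<close> into vanishing.\<close>

lemma wedge_eval_invariant:
  assumes S: "subspace S" "fin_span S" "nondeg S" and us: "set us \<subseteq> UNIV \<times> S \<times> S"
    and x: "skew_adjoint x" "x ` S \<subseteq> S" and \<beta>: "alternating \<beta>"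
    and sym: "\<And>a b. a \<in> S \<Longrightarrow> b \<in> S \<Longrightarrow> \<beta> (op_of us a) b = \<beta> a (op_of us b)"
  shows "wedge_eval \<beta> (wedge_act x us) = 0"
proof -
  obtain ks where ks: "set ks \<subseteq> S \<times> S" "\<And>w. w \<in> S \<Longrightarrow> 2 *s x w = (\<Sum>(p, q)\<leftarrow>ks. rank_one p q w)"
    using skew_adjoint_rank_ones[OF S x] by blast
  have "2 * wedge_eval \<beta> (wedge_act x vs) = (\<Sum>(p, q)\<leftarrow>ks. wedge_eval \<beta> (wedge_act (rank_one p q) vs))"
    if "set vs \<subseteq> UNIV \<times> S \<times> S" for vs
    using that
  proof (induction vs)
    case Nil
    have "(\<Sum>(p, q)\<leftarrow>ks. wedge_eval \<beta> (wedge_act (rank_one p q) [])) = (\<Sum>kl\<leftarrow>ks. 0)"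
      by (intro arg_cong[of _ _ sum_list] map_cong refl) auto
    then show ?case by simp
  next
    case (Cons u vs)
    obtain c a b where u: "u = (c, a, b)" by (cases u)
    have ab: "a \<in> S" "b \<in> S" using Cons.prems u by auto
    have "2 * \<beta> (x a) b = (\<Sum>(p, q)\<leftarrow>ks. \<beta> (rank_one p q a) b)"
      using arg_cong[OF ks(2)[OF ab(1)], of "\<lambda>w. \<beta> w b"]
      by (simp add: linf_sum_list[OF alternating_linear(1)[OF \<beta>]] case_prod_unfold alternating_simps[OF \<beta>])
    moreover have "2 * \<beta> a (x b) = (\<Sum>(p, q)\<leftarrow>ks. \<beta> a (rank_one p q b))"
      using arg_cong[OF ks(2)[OF ab(2)], of "\<beta> a"]
      by (simp add: linf_sum_list[OF alternating_linear(2)[OF \<beta>]] case_prod_unfold alternating_simps[OF \<beta>])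
    moreover have "2 * wedge_eval \<beta> (wedge_act x (u # vs)) =
        c * (2 * \<beta> (x a) b) + c * (2 * \<beta> a (x b)) + 2 * wedge_eval \<beta> (wedge_act x vs)"
      by (simp add: u ring_distribs)
    ultimately show ?case
      using Cons by (simp add: u case_prod_unfold sum_list_addf sum_list_const_mult)
  qed
  note this[OF us]
  also have "(\<Sum>(p, q)\<leftarrow>ks. wedge_eval \<beta> (wedge_act (rank_one p q) us)) = (\<Sum>kl\<leftarrow>ks. 0)"
    using ks(1) sym by (intro arg_cong[of _ _ sum_list] map_cong refl) (auto simp: wedge_eval_rank_one[OF \<beta>])
  finally show ?thesis by simp
qed

end

section \<open>Coordinates of finite-dimensional spaces\<close>

definition fun_scale :: "'k::times \<Rightarrow> ('i \<Rightarrow> 'k) \<Rightarrow> 'i \<Rightarrow> 'k" where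
  "fun_scale c f = (\<lambda>i. c * f i)"

interpretation fs: char0_space "fun_scale :: 'k::{alg_closed_field,field_char_0} \<Rightarrow> ('i \<Rightarrow> 'k) \<Rightarrow> 'i \<Rightarrow> 'k"
  by unfold_locales (auto simp: fun_scale_def fun_eq_iff algebra_simps)

lemma sum_fun_apply: "(\<Sum>i\<in>I. f i) x = (\<Sum>i\<in>I. (f i x :: 'k::comm_monoid_add))"
  by (induction I rule: infinite_finite_induct) auto

abbreviation linear_hom where "linear_hom U W \<equiv> LinearCombinations.module_hom class_ring U W"
abbreviation kdim where "kdim U \<equiv> vectorspace.dim class_ring U"
abbreviation ksubspace where "ksubspace W U \<equiv> VectorSpace.subspace class_ring W U"

lemma linear_hom_iff:
  "f \<in> linear_hom U W \<longleftrightarrow> f \<in> carrier U \<rightarrow> carrier W \<and>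
    (\<forall>u\<in>carrier U. \<forall>v\<in>carrier U. f (u \<oplus>\<^bsub>U\<^esub> v) = f u \<oplus>\<^bsub>W\<^esub> f v) \<and>
    (\<forall>c. \<forall>u\<in>carrier U. f (c \<odot>\<^bsub>U\<^esub> u) = c \<odot>\<^bsub>W\<^esub> f u)"
  unfolding LinearCombinations.module_hom_def by auto

lemma
  assumes "f \<in> linear_hom U W" "u \<in> carrier U"
  shows linear_hom_mem: "f u \<in> carrier W"
    and linear_hom_add: "v \<in> carrier U \<Longrightarrow> f (u \<oplus>\<^bsub>U\<^esub> v) = f u \<oplus>\<^bsub>W\<^esub> f v"
    and linear_hom_smult: "f (c \<odot>\<^bsub>U\<^esub> u) = c \<odot>\<^bsub>W\<^esub> f u"
  using assms unfolding linear_hom_iff by auto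

locale kspace = vectorspace "class_ring :: 'k ring" U
  for U :: "('k::{alg_closed_field,field_char_0}, 'u) module"
begin

lemma ksubspaceI:
  assumes "W \<subseteq> carrier U" "\<zero>\<^bsub>U\<^esub> \<in> W" "\<And>u v. u \<in> W \<Longrightarrow> v \<in> W \<Longrightarrow> u \<oplus>\<^bsub>U\<^esub> v \<in> W"
    "\<And>c u. u \<in> W \<Longrightarrow> c \<odot>\<^bsub>U\<^esub> u \<in> W"
  shows "ksubspace W U"
  by (intro VectorSpace.subspace.intro submodule.intro vectorspace_axioms module_axioms assms)

lemma
  assumes "ksubspace W U"
  shows ksubspace_subset: "W \<subseteq> carrier U"
    and ksubspace_zero: "\<zero>\<^bsub>U\<^esub> \<in> W"
    and ksubspace_add: "u \<in> W \<Longrightarrow> v \<in> W \<Longrightarrow> u \<oplus>\<^bsub>U\<^esub> v \<in> W"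
    and ksubspace_smult: "u \<in> W \<Longrightarrow> c \<odot>\<^bsub>U\<^esub> u \<in> W"
proof -
  interpret submodule class_ring W U using assms by (rule VectorSpace.subspace.submod)
  show "W \<subseteq> carrier U" "\<zero>\<^bsub>U\<^esub> \<in> W" "u \<in> W \<Longrightarrow> v \<in> W \<Longrightarrow> u \<oplus>\<^bsub>U\<^esub> v \<in> W"
    "u \<in> W \<Longrightarrow> c \<odot>\<^bsub>U\<^esub> u \<in> W"
    using subset by auto
qed

lemma smult_zero_left: "u \<in> carrier U \<Longrightarrow> 0 \<odot>\<^bsub>U\<^esub> u = \<zero>\<^bsub>U\<^esub>"
  using lmult_0[of u] by simp

lemma a_minus_eq: "u \<in> carrier U \<Longrightarrow> v \<in> carrier U \<Longrightarrow> u \<ominus>\<^bsub>U\<^esub> v = u \<oplus>\<^bsub>U\<^esub> (- 1) \<odot>\<^bsub>U\<^esub> v"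
  using smult_minus_1[of v] by (simp add: a_minus_def class_ring_simps)

end

lemma linear_mapI:
  assumes "vectorspace class_ring U" "vectorspace class_ring W" "f \<in> linear_hom U W"
  shows "linear_map class_ring U W f"
proof -
  interpret U: vectorspace class_ring U by fact
  interpret W: vectorspace class_ring W by fact
  show ?thesis
    by (intro linear_map.intro mod_hom.intro mod_hom_axioms.intro assms U.module_axioms W.module_axioms)
qed

lemma linear_hom_zero:
  assumes "vectorspace class_ring U" "vectorspace class_ring W" "f \<in> linear_hom U W"
  shows "f \<zero>\<^bsub>U\<^esub> = \<zero>\<^bsub>W\<^esub>"
proof -
  interpret linear_map class_ring U W f by (rule linear_mapI[OF assms])
  show ?thesis by simp
qed

text \<open>The bridge from spaces given by a carrier to spaces that are whole types, where the
  linear algebra above lives. Coordinates are extended by 0 outside \<open>A\<close>, and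
  \<open>D\<close> ignores the values there, so that \<open>D\<close> is linear on all
  functions.\<close>

locale coordinates = kspace U for U :: "('k::{alg_closed_field,field_char_0}, 'u) module" +
  fixes A :: "'u set" and C :: "'u \<Rightarrow> 'u \<Rightarrow> 'k" and D :: "('u \<Rightarrow> 'k) \<Rightarrow> 'u"
  assumes A: "finite A"
    and D_mem: "D f \<in> carrier U"
    and D_add: "D (f + g) = D f \<oplus>\<^bsub>U\<^esub> D g"
    and D_scale: "D (fun_scale c f) = c \<odot>\<^bsub>U\<^esub> D f"
    and DC: "u \<in> carrier U \<Longrightarrow> D (C u) = u"
    and CD: "C (D f) = (\<lambda>x. if x \<in> A then f x else 0)"
begin

lemma C_outside: "u \<in> carrier U \<Longrightarrow> x \<notin> A \<Longrightarrow> C u x = 0"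
  using CD[of "C u"] DC by (metis (no_types, lifting))

lemma CD_id: "(\<And>x. x \<notin> A \<Longrightarrow> f x = 0) \<Longrightarrow> C (D f) = f"
  by (auto simp: CD)

lemma C_add: "u \<in> carrier U \<Longrightarrow> v \<in> carrier U \<Longrightarrow> C (u \<oplus>\<^bsub>U\<^esub> v) = C u + C v"
  using D_add[of "C u" "C v"] CD_id[of "C u + C v"] by (simp add: DC C_outside)

lemma C_scale: "u \<in> carrier U \<Longrightarrow> C (c \<odot>\<^bsub>U\<^esub> u) = fun_scale c (C u)"
  using D_scale[of c "C u"] CD_id[of "fun_scale c (C u)"] by (simp add: DC C_outside fun_scale_def)

lemma D_zero: "D 0 = \<zero>\<^bsub>U\<^esub>"
  using D_scale[of 0 0] smult_zero_left[OF D_mem] by (simp add: fun_scale_def zero_fun_def)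

lemma C_zero: "C \<zero>\<^bsub>U\<^esub> = 0"
  using CD_id[of 0] by (simp add: D_zero)

lemma C_inj: "u \<in> carrier U \<Longrightarrow> v \<in> carrier U \<Longrightarrow> C u = C v \<Longrightarrow> u = v"
  using DC by metis

lemma C_image: "C ` carrier U = {f. \<forall>x. x \<notin> A \<longrightarrow> f x = 0}"
proof (intro equalityI subsetI)
  fix f assume "f \<in> {f. \<forall>x. x \<notin> A \<longrightarrow> f x = (0::'k)}"
  then have "f = C (D f)" using CD_id[of f] by auto
  then show "f \<in> C ` carrier U" using D_mem by blast
qed (use C_outside in auto)

lemma C_image_subspace:
  assumes "ksubspace W U" shows "fs.subspace (C ` W)"
  unfolding fs.subspace_def
proof (intro conjI ballI allI)
  note W = ksubspace_subset[OF assms] ksubspace_zero[OF assms] ksubspace_add[OF assms] ksubspace_smult[OF assms]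
  show "0 \<in> C ` W" using W(2) C_zero by force
  show "x + y \<in> C ` W" if xy: "x \<in> C ` W" "y \<in> C ` W" for x y
  proof -
    obtain u v where u: "u \<in> W" "v \<in> W" "x = C u" "y = C v" using xy by blast
    then have "x + y = C (u \<oplus>\<^bsub>U\<^esub> v)" using W(1) by (simp add: C_add subset_iff)
    then show ?thesis using W(3) u by blast
  qed
  show "fun_scale c x \<in> C ` W" if x: "x \<in> C ` W" for c x
  proof -
    obtain u where u: "u \<in> W" "x = C u" using x by blast
    then have "fun_scale c x = C (c \<odot>\<^bsub>U\<^esub> u)" using W(1) by (simp add: C_scale subset_iff)
    then show ?thesis using W(4) u by blast
  qed
qed

lemma carrier_subspace: "ksubspace (carrier U) U"
  by (rule ksubspaceI) auto

lemma fin_span_C: "fs.fin_span (C ` carrier U)"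
  unfolding fs.fin_span_def
proof (intro exI conjI)
  let ?e = "\<lambda>a x. if x = a then 1 else (0::'k)"
  show "finite (?e ` A)" using A by simp
  show "C ` carrier U \<subseteq> fs.span (?e ` A)"
  proof
    fix f assume "f \<in> C ` carrier U"
    then have "\<And>x. x \<notin> A \<Longrightarrow> f x = 0" unfolding C_image by blast
    then have "f = (\<Sum>a\<in>A. fun_scale (f a) (?e a))"
      using A by (auto simp: fun_eq_iff fun_scale_def sum_fun_apply if_distrib[of "\<lambda>x. _ * x"] cong: if_cong)
    also have "\<dots> \<in> fs.span (?e ` A)"
      by (intro fs.span_sum fs.span_scale fs.span_base) auto
    finally show "f \<in> fs.span (?e ` A)" .
  qed
qed

lemma lincomb_eq_D:
  assumes W: "ksubspace W U" and B: "finite B" "B \<subseteq> W"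
  shows "LinearCombinations.module.lincomb (U\<lparr>carrier := W\<rparr>) a B = D (\<Sum>x\<in>B. fun_scale (a x) (C x))"
proof -
  interpret W: vectorspace class_ring "U\<lparr>carrier := W\<rparr>" by (rule subspace_is_vs[OF W])
  note Ws = ksubspace_subset[OF W]
  from B show ?thesis
  proof (induction B)
    case empty
    then show ?case by (simp add: W.lincomb_def D_zero[unfolded zero_fun_def])
  next
    case (insert b B)
    have bU: "b \<in> carrier U" using insert.prems Ws by auto
    have "W.lincomb a (insert b B) = a b \<odot>\<^bsub>U\<^esub> b \<oplus>\<^bsub>U\<^esub> W.lincomb a B"
      using insert W.lincomb_insert2[of B a b] by auto
    also have "\<dots> = D (fun_scale (a b) (C b)) \<oplus>\<^bsub>U\<^esub> D (\<Sum>x\<in>B. fun_scale (a x) (C x))"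
      using insert by (simp add: D_scale DC[OF bU])
    also have "\<dots> = D (fun_scale (a b) (C b) + (\<Sum>x\<in>B. fun_scale (a x) (C x)))"
      by (rule D_add[symmetric])
    also have "fun_scale (a b) (C b) + (\<Sum>x\<in>B. fun_scale (a x) (C x)) = (\<Sum>x\<in>insert b B. fun_scale (a x) (C x))"
      by (rule sum.insert[OF insert.hyps, symmetric])
    finally show ?case .
  qed
qed

text \<open>A basis of the coordinate image is carried back by \<open>D\<close>, so both notions of
  dimension count the same vectors.\<close>

lemma
  assumes W: "ksubspace W U"
  shows kdim_subspace: "kdim (U\<lparr>carrier := W\<rparr>) = fs.dim (C ` W)"
    and fin_dim_subspace: "vectorspace.fin_dim class_ring (U\<lparr>carrier := W\<rparr>)"
proof -
  interpret W: vectorspace class_ring "U\<lparr>carrier := W\<rparr>" by (rule subspace_is_vs[OF W])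
  note Ws = ksubspace_subset[OF W]
  have sub: "C ` W \<subseteq> C ` carrier U" using Ws by blast
  obtain B where B: "finite B" "B \<subseteq> C ` W" "fs.independent B" "C ` W \<subseteq> fs.span B" "card B = fs.dim (C ` W)"
    using fs.fin_spanE[OF fs.fin_span_subset[OF fin_span_C sub]] by blast
  have CDB: "C (D b) = b" and DBm: "D b \<in> W" if b: "b \<in> B" for b
  proof -
    obtain w where w: "w \<in> W" "b = C w" using b B(2) by blast
    then have "D b = w" using Ws DC by auto
    then show "C (D b) = b" "D b \<in> W" using w by simp_all
  qed
  have inj: "inj_on D B" using CDB by (metis inj_onI)
  have DB: "D ` B \<subseteq> W" using DBm by blast
  have fin: "finite (D ` B)" using B(1) by simp
  have "W.span (D ` B) = W"
  proof
    show "W.span (D ` B) \<subseteq> W" using W.span_is_subset2[of "D ` B"] DB by simp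
    show "W \<subseteq> W.span (D ` B)"
    proof
      fix w assume w: "w \<in> W"
      then have "C w \<in> fs.span B" using B(4) by blast
      then obtain a where a: "C w = (\<Sum>b\<in>B. fun_scale (a b) b)"
        using fs.span_finite[OF B(1)] by auto
      have "w = D (\<Sum>b\<in>B. fun_scale (a b) b)" using a[symmetric] w Ws DC by auto
      also have "(\<Sum>b\<in>B. fun_scale (a b) b) = (\<Sum>x\<in>D ` B. fun_scale (a (C x)) (C x))"
        using CDB by (simp add: sum.reindex[OF inj])
      also have "D \<dots> = W.lincomb (\<lambda>x. a (C x)) (D ` B)"
        using lincomb_eq_D[OF W fin DB, of "\<lambda>x. a (C x)"] by simp
      finally show "w \<in> W.span (D ` B)" using fin unfolding W.span_def by auto
    qed
  qed
  moreover have "W.lin_indpt (D ` B)"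
  proof
    assume "W.lin_dep (D ` B)"
    then obtain E a v where E: "finite E" "E \<subseteq> D ` B" "W.lincomb a E = \<zero>\<^bsub>U\<^esub>" "v \<in> E" "a v \<noteq> 0"
      unfolding W.lin_dep_def by auto
    let ?s = "\<Sum>x\<in>E. fun_scale (a x) (C x)"
    have EW: "E \<subseteq> W" using E(2) DB by blast
    have "?s \<in> C ` carrier U"
      by (intro fs.subspace_sum fs.subspace_scale C_image_subspace carrier_subspace) (use EW Ws in auto)
    then have "?s = C (D ?s)" using DC by auto
    also have "D ?s = \<zero>\<^bsub>U\<^esub>" using lincomb_eq_D[OF W E(1) EW] E(3) by simp
    also have "C \<zero>\<^bsub>U\<^esub> = 0" by (rule C_zero)
    finally have s0: "?s = 0" .
    have CE: "C ` E \<subseteq> B" using E(2) CDB by auto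
    have "inj_on C (carrier U)" using C_inj by (rule inj_onI)
    then have injC: "inj_on C E" by (rule inj_on_subset) (use EW Ws in blast)
    have "(\<Sum>b\<in>C ` E. fun_scale (a (D b)) b) = ?s"
      using EW Ws DC by (simp add: sum.reindex[OF injC] subset_iff)
    then have "(\<Sum>b\<in>C ` E. fun_scale (a (D b)) b) = 0" unfolding s0 .
    from fs.independentD[where u = "\<lambda>b. a (D b)", OF B(3) finite_imageI[OF E(1)] CE this imageI[OF E(4)]]
    have "a (D (C v)) = 0" .
    moreover have "D (C v) = v" using E(4) EW Ws DC by auto
    ultimately show False using E(5) by simp
  qed
  ultimately have "W.basis (D ` B)" using DB by (simp add: W.basis_def)
  then show "kdim (U\<lparr>carrier := W\<rparr>) = fs.dim (C ` W)"
    using W.dim_basis[OF fin] B(5) card_image[OF inj] by simp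
  show "vectorspace.fin_dim class_ring (U\<lparr>carrier := W\<rparr>)"
    unfolding W.fin_dim_def using fin DB \<open>W.span (D ` B) = W\<close> by (intro exI[of _ "D ` B"]) simp
qed

lemma kdim_eq: "kdim U = fs.dim (C ` carrier U)"
  using kdim_subspace[OF carrier_subspace] by simp

end

lemma coordinates_exist:
  fixes U :: "('k::{alg_closed_field,field_char_0}, 'u) module"
  assumes U: "vectorspace class_ring U" and fd: "vectorspace.fin_dim class_ring U"
  shows "\<exists>A C D. coordinates U A C D"
proof -
  interpret vectorspace class_ring U by fact
  obtain A where A: "finite A" "basis A" using finite_basis_exists[OF fd] by blast
  have AU: "A \<subseteq> carrier U" using A(2) by (simp add: basis_def)
  let ?D = "\<lambda>f. lincomb f A"
  have ex: "\<exists>!a. a \<in> A \<rightarrow>\<^sub>E UNIV \<and> ?D a = u" if "u \<in> carrier U" for u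
    using basis_criterion[OF A(1) AU, THEN iffD1, OF A(2), rule_format, OF that] by simp
  define c where "c u = (THE a. a \<in> A \<rightarrow>\<^sub>E UNIV \<and> ?D a = u)" for u
  have c: "c u \<in> A \<rightarrow>\<^sub>E UNIV \<and> ?D (c u) = u" if "u \<in> carrier U" for u
    unfolding c_def by (rule theI'[OF ex[OF that]])
  \<comment> \<open>\<open>c u\<close> is \<open>undefined\<close> outside \<open>A\<close>; the
    value 0 is needed there for additivity.\<close>
  define C where "C u = (\<lambda>x. if x \<in> A then c u x else 0)" for u
  have cong: "?D f = ?D g" if "\<And>x. x \<in> A \<Longrightarrow> f x = g x" for f g
    using that by (intro lincomb_restrict[OF AU]) (auto simp: restrict_def fun_eq_iff)
  have mem: "?D f \<in> carrier U" for f by (rule lincomb_closed[OF AU]) simp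
  have "coordinates U A C ?D"
  proof
    show "?D (f + g) = ?D f \<oplus>\<^bsub>U\<^esub> ?D g" for f g
      using lincomb_sum[OF A(1) AU, of f g] by (simp add: plus_fun_def)
    show "?D (fun_scale c f) = c \<odot>\<^bsub>U\<^esub> ?D f" for c f
      using lincomb_smult[OF AU, of f c] by (simp add: fun_scale_def)
    show "?D (C u) = u" if "u \<in> carrier U" for u
      using c[OF that] cong[of "C u" "c u"] by (simp add: C_def)
    show "C (?D f) = (\<lambda>x. if x \<in> A then f x else 0)" for f
    proof -
      have "c (?D f) = restrict f A"
      proof -
        have "restrict f A \<in> A \<rightarrow>\<^sub>E UNIV \<and> ?D (restrict f A) = ?D f"
          using cong[of "restrict f A" f] by auto
        then show ?thesis using ex[OF mem[of f]] c[OF mem[of f]] by blast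
      qed
      then show ?thesis by (auto simp: C_def)
    qed
  qed (use A mem in auto)
  then show ?thesis by blast
qed

section \<open>Duals\<close>

lemma dual_carrier: "carrier (dual U) = linear_hom U scalars \<inter> extensional (carrier U)"
  by (simp add: dual_def)

lemma dual_simps:
  "f \<oplus>\<^bsub>dual U\<^esub> g = (\<lambda>u\<in>carrier U. f u + g u)"
  "c \<odot>\<^bsub>dual U\<^esub> f = (\<lambda>u\<in>carrier U. c * f u)"
  "\<zero>\<^bsub>dual U\<^esub> = (\<lambda>u\<in>carrier U. 0)"
  by (simp_all add: dual_def ring.func_space_def[OF class_ring.ring_axioms])

lemma dual_iff:
  "f \<in> carrier (dual U) \<longleftrightarrow> f \<in> extensional (carrier U) \<and>
    (\<forall>u\<in>carrier U. \<forall>v\<in>carrier U. f (u \<oplus>\<^bsub>U\<^esub> v) = f u + f v) \<and>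
    (\<forall>c. \<forall>u\<in>carrier U. f (c \<odot>\<^bsub>U\<^esub> u) = c * f u)"
  by (auto simp: dual_carrier linear_hom_iff scalars_def)

lemma
  assumes "f \<in> carrier (dual U)" "u \<in> carrier U"
  shows dual_add: "v \<in> carrier U \<Longrightarrow> f (u \<oplus>\<^bsub>U\<^esub> v) = f u + f v"
    and dual_smult: "f (c \<odot>\<^bsub>U\<^esub> u) = c * f u"
  using assms by (auto simp: dual_iff)

context kspace
begin

lemma dual_vectorspace: "vectorspace class_ring (dual U)"
proof -
  let ?F = "ring.func_space class_ring (carrier U) :: ('k, 'u \<Rightarrow> 'k) module"
  interpret F: kspace ?F by (rule kspace.intro) (rule func_space_is_vs)
  have F: "carrier ?F = carrier U \<rightarrow>\<^sub>E UNIV" "\<And>f g. f \<oplus>\<^bsub>?F\<^esub> g = (\<lambda>u\<in>carrier U. f u + g u)"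
    "\<And>c f. c \<odot>\<^bsub>?F\<^esub> f = (\<lambda>u\<in>carrier U. c * f u)" "\<zero>\<^bsub>?F\<^esub> = (\<lambda>u\<in>carrier U. 0)"
    by (simp_all add: ring.func_space_def[OF class_ring.ring_axioms])
  have "ksubspace (carrier (dual U)) ?F"
  proof (rule F.ksubspaceI)
    show "carrier (dual U) \<subseteq> carrier ?F" unfolding F by (auto simp: dual_iff PiE_def)
  qed (auto simp: F dual_iff algebra_simps)
  then have "vectorspace class_ring (?F\<lparr>carrier := carrier (dual U)\<rparr>)" by (rule F.subspace_is_vs)
  moreover have "?F\<lparr>carrier := carrier (dual U)\<rparr> = dual U" by (simp add: dual_def)
  ultimately show ?thesis by simp
qed

lemma dual_zero_arg: "f \<in> carrier (dual U) \<Longrightarrow> f \<zero>\<^bsub>U\<^esub> = 0"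
  using dual_smult[of f U "\<zero>\<^bsub>U\<^esub>" 0] smult_zero_left[of "\<zero>\<^bsub>U\<^esub>"] by simp

lemma linear_hom_kernel_inj:
  fixes W :: "('k, 'x) module"
  assumes W: "vectorspace class_ring W" and h: "h \<in> linear_hom U W"
    and k: "\<And>u. u \<in> carrier U \<Longrightarrow> h u = \<zero>\<^bsub>W\<^esub> \<Longrightarrow> u = \<zero>\<^bsub>U\<^esub>"
  shows "inj_on h (carrier U)"
proof -
  interpret linear_map class_ring U W h by (rule linear_mapI[OF vectorspace_axioms W h])
  show ?thesis
    using k by (intro Ke0_imp_inj) (auto simp: ker_def)
qed

lemma preimage_ksubspace:
  fixes W :: "('k, 'x) module"
  assumes W: "vectorspace class_ring W" and h: "h \<in> linear_hom U W" and P: "ksubspace P W"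
  shows "ksubspace {a \<in> carrier U. h a \<in> P} U"
proof -
  interpret W: kspace W by (rule kspace.intro) (rule W)
  show ?thesis
    by (rule ksubspaceI)
      (use W.ksubspace_zero[OF P] W.ksubspace_add[OF P] W.ksubspace_smult[OF P]
        linear_hom_zero[OF vectorspace_axioms W h] linear_hom_add[OF h] linear_hom_smult[OF h] in auto)
qed

lemma image_ksubspace:
  fixes W' :: "('k, 'x) module"
  assumes W': "vectorspace class_ring W'" and h: "h \<in> linear_hom U W'" and W: "ksubspace W U"
  shows "ksubspace (h ` W) W'"
proof -
  interpret W': kspace W' by (rule kspace.intro) (rule W')
  note Ws = ksubspace_subset[OF W] ksubspace_zero[OF W] ksubspace_add[OF W] ksubspace_smult[OF W]
  show ?thesis
  proof (rule W'.ksubspaceI)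
    show "h ` W \<subseteq> carrier W'" using linear_hom_mem[OF h] Ws(1) by blast
    show "\<zero>\<^bsub>W'\<^esub> \<in> h ` W"
      using linear_hom_zero[OF vectorspace_axioms W' h] Ws(2) by (metis imageI)
    show "x \<oplus>\<^bsub>W'\<^esub> y \<in> h ` W" if xy: "x \<in> h ` W" "y \<in> h ` W" for x y
    proof -
      obtain a b where ab: "a \<in> W" "b \<in> W" "x = h a" "y = h b" using xy by blast
      then have "x \<oplus>\<^bsub>W'\<^esub> y = h (a \<oplus>\<^bsub>U\<^esub> b)" using linear_hom_add[OF h] Ws(1) by (simp add: subset_iff)
      then show ?thesis using Ws(3) ab by blast
    qed
    show "c \<odot>\<^bsub>W'\<^esub> x \<in> h ` W" if x: "x \<in> h ` W" for c x
    proof -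
      obtain a where a: "a \<in> W" "x = h a" using x by blast
      then have "c \<odot>\<^bsub>W'\<^esub> x = h (c \<odot>\<^bsub>U\<^esub> a)" using linear_hom_smult[OF h] Ws(1) by (simp add: subset_iff)
      then show ?thesis using Ws(4) a by blast
    qed
  qed
qed

end

context coordinates
begin

lemma kdim_image:
  fixes W' :: "('k, 'x) module"
  assumes W': "vectorspace class_ring W'" and h: "h \<in> linear_hom U W'" "inj_on h (carrier U)"
    and W: "ksubspace W U"
  shows "kdim (W'\<lparr>carrier := h ` W\<rparr>) = kdim (U\<lparr>carrier := W\<rparr>)"
proof -
  interpret W': kspace W' by (rule kspace.intro) (rule W')
  have "vectorspace class_ring (W'\<lparr>carrier := h ` W\<rparr>)"
    by (rule W'.subspace_is_vs[OF image_ksubspace[OF W' h(1) W]])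
  moreover have "h \<in> linear_hom (U\<lparr>carrier := W\<rparr>) (W'\<lparr>carrier := h ` W\<rparr>)"
    using h(1) ksubspace_subset[OF W] by (auto simp: linear_hom_iff subset_iff)
  ultimately interpret linear_map class_ring "U\<lparr>carrier := W\<rparr>" "W'\<lparr>carrier := h ` W\<rparr>" h
    by (intro linear_mapI subspace_is_vs W)
  show ?thesis
    using dim_eq[OF fin_dim_subspace[OF W]] inj_on_subset[OF h(2) ksubspace_subset[OF W]] by simp
qed

lemma dual_linf: assumes f: "f \<in> carrier (dual U)" shows "fs.linf (\<lambda>g. f (D g))"
  by (rule fs.linfI) (use dual_add[OF f D_mem D_mem] dual_smult[OF f D_mem] in \<open>simp_all only: D_add D_scale\<close>)

lemma linf_dual:
  assumes "fs.linf g" shows "(\<lambda>u\<in>carrier U. g (C u)) \<in> carrier (dual U)"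
  unfolding dual_iff using fs.linf_add[OF assms] fs.linf_scale[OF assms] by (auto simp only: C_add C_scale
      restrict_apply a_closed smult_closed if_True UNIV_I restrict_extensional carrier_vs_is_self) auto

lemma linf_expand:
  fixes g :: "('u \<Rightarrow> 'k) \<Rightarrow> 'k"
  assumes "fs.linf g" "\<And>x. x \<notin> A \<Longrightarrow> f x = 0"
  shows "g f = (\<Sum>a\<in>A. f a * g (\<lambda>x. if x = a then 1 else 0))"
proof -
  let ?e = "\<lambda>a x. if x = a then 1 else (0::'k)"
  have "f = (\<Sum>a\<in>A. fun_scale (f a) (?e a))"
    using A assms(2) by (auto simp: fun_eq_iff fun_scale_def sum_fun_apply if_distrib[of "\<lambda>x. _ * x"] cong: if_cong)
  then have "g f = g (\<Sum>a\<in>A. fun_scale (f a) (?e a))" by (rule arg_cong)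
  also have "\<dots> = (\<Sum>a\<in>A. f a * g (?e a))"
    by (simp only: fs.linf_sum[OF assms(1)] fs.linf_scale[OF assms(1)])
  finally show ?thesis .
qed

text \<open>The identification with the dual by the standard form of the coordinates. That this form
  is symmetric is what later makes \<open>eval_at\<close> surjective.\<close>

definition to_dual :: "'u \<Rightarrow> 'u \<Rightarrow> 'k" where
  "to_dual u = (\<lambda>w\<in>carrier U. \<Sum>x\<in>A. C u x * C w x)"

lemma to_dual_hom: "to_dual \<in> linear_hom U (dual U)"
  unfolding linear_hom_iff
  by (auto simp: to_dual_def dual_iff dual_simps C_add C_scale fun_scale_def
      ring_distribs sum.distrib sum_distrib_left mult.assoc mult.left_commute fun_eq_iff)

lemma to_dual_inj: "inj_on to_dual (carrier U)"
proof (rule linear_hom_kernel_inj[OF dual_vectorspace to_dual_hom])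
  fix u assume u: "u \<in> carrier U" "to_dual u = \<zero>\<^bsub>dual U\<^esub>"
  have "C u a = 0" if a: "a \<in> A" for a
  proof -
    let ?w = "D (\<lambda>x. if x = a then 1 else 0)"
    have "to_dual u ?w = (\<Sum>x\<in>A. if x = a then C u x else 0)"
      using a by (auto simp: to_dual_def D_mem CD intro!: sum.cong)
    then show ?thesis using A a u(2) by (simp add: dual_simps D_mem)
  qed
  then have "C u = C \<zero>\<^bsub>U\<^esub>" using C_outside[OF u(1)] C_zero by (auto simp: fun_eq_iff)
  then show "u = \<zero>\<^bsub>U\<^esub>" using C_inj u(1) by blast
qed

lemma to_dual_surj: "to_dual ` carrier U = carrier (dual U)"
proof (intro equalityI subsetI)
  fix f assume f: "f \<in> carrier (dual U)"
  let ?u = "D (\<lambda>a. f (D (\<lambda>x. if x = a then 1 else 0)))"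
  have "to_dual ?u w = f w" for w
  proof (cases "w \<in> carrier U")
    case True
    have "f w = f (D (C w))" by (simp add: DC True)
    also have "\<dots> = (\<Sum>a\<in>A. C w a * f (D (\<lambda>x. if x = a then 1 else 0)))"
      by (rule linf_expand[OF dual_linf[OF f]]) (rule C_outside[OF True])
    finally show ?thesis by (auto simp: to_dual_def True CD mult.commute intro!: sum.cong)
  next
    case False
    then show ?thesis using f by (auto simp: to_dual_def dual_iff extensional_def)
  qed
  then have "f = to_dual ?u" by (auto simp: fun_eq_iff)
  then show "f \<in> to_dual ` carrier U" using D_mem by blast
qed (use linear_hom_mem[OF to_dual_hom] in auto)

lemma fin_dim: "fin_dim"
  using fin_dim_subspace[OF carrier_subspace] by simp

lemma kdim_dual: "kdim (dual U) = kdim U"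
proof -
  interpret linear_map class_ring U "dual U" to_dual
    by (rule linear_mapI[OF vectorspace_axioms dual_vectorspace to_dual_hom])
  show ?thesis using dim_eq[OF fin_dim to_dual_inj to_dual_surj] by simp
qed

definition eval_at :: "'u \<Rightarrow> ('u \<Rightarrow> 'k) \<Rightarrow> 'k" where
  "eval_at u = (\<lambda>f\<in>carrier (dual U). f u)"

lemma dual_closed:
  assumes "f \<in> carrier (dual U)"
  shows "g \<in> carrier (dual U) \<Longrightarrow> (\<lambda>u\<in>carrier U. f u + g u) \<in> carrier (dual U)"
    and "(\<lambda>u\<in>carrier U. c * f u) \<in> carrier (dual U)"
  using assms by (auto simp: dual_iff algebra_simps)

lemma eval_at_hom: "eval_at \<in> linear_hom U (dual (dual U))"
  unfolding linear_hom_iff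
  by (auto simp: eval_at_def dual_iff[of _ "dual U"] dual_simps dual_closed dual_add dual_smult fun_eq_iff)

lemma separating:
  assumes "u \<in> carrier U" "\<And>f. f \<in> carrier (dual U) \<Longrightarrow> f u = 0" shows "u = \<zero>\<^bsub>U\<^esub>"
proof -
  have "C u a = 0" for a
  proof -
    have "fs.linf (\<lambda>g. g a)" by (rule fs.linfI) (auto simp: fun_scale_def)
    from linf_dual[OF this] show ?thesis using assms(2) assms(1) by fastforce
  qed
  then have "C u = C \<zero>\<^bsub>U\<^esub>" using C_zero by (auto simp: fun_eq_iff)
  then show ?thesis using C_inj assms(1) by blast
qed

lemma dual_dual_vectorspace: "vectorspace class_ring (dual (dual U))"
proof -
  interpret d: kspace "dual U" by (rule kspace.intro) (rule dual_vectorspace)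
  show ?thesis by (rule d.dual_vectorspace)
qed

lemma eval_at_inj: "inj_on eval_at (carrier U)"
proof (rule linear_hom_kernel_inj[OF dual_dual_vectorspace eval_at_hom])
  fix u assume u: "u \<in> carrier U" "eval_at u = \<zero>\<^bsub>dual (dual U)\<^esub>"
  show "u = \<zero>\<^bsub>U\<^esub>"
  proof (rule separating[OF u(1)])
    show "f u = 0" if "f \<in> carrier (dual U)" for f
      using fun_cong[OF u(2), of f] that by (simp add: eval_at_def dual_simps)
  qed
qed

lemma eval_at_surj: "eval_at ` carrier U = carrier (dual (dual U))"
proof (intro equalityI subsetI)
  fix F assume F: "F \<in> carrier (dual (dual U))"
  have "(\<lambda>w\<in>carrier U. F (to_dual w)) \<in> carrier (dual U)"
    using linear_hom_mem[OF to_dual_hom] linear_hom_add[OF to_dual_hom] linear_hom_smult[OF to_dual_hom]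
    by (auto simp: dual_iff[of _ U] dual_add[OF F] dual_smult[OF F])
  then obtain u where u: "u \<in> carrier U" "(\<lambda>w\<in>carrier U. F (to_dual w)) = to_dual u"
    using to_dual_surj by (metis imageE)
  have "F f = eval_at u f" for f
  proof (cases "f \<in> carrier (dual U)")
    case True
    then obtain w where w: "w \<in> carrier U" "f = to_dual w" using to_dual_surj by blast
    have "F f = to_dual u w" using fun_cong[OF u(2), of w] w by simp
    also have "\<dots> = to_dual w u" using w(1) u(1) by (simp add: to_dual_def mult.commute)
    finally show ?thesis using True w(2) by (simp add: eval_at_def)
  next
    case False
    then show ?thesis using F by (simp add: eval_at_def dual_iff[of F] extensional_def)
  qed
  then have "F = eval_at u" by (rule ext)
  then show "F \<in> eval_at ` carrier U" using u(1) by blast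
qed (use linear_hom_mem[OF eval_at_hom] in auto)

text \<open>The signs of the two contragredient actions cancel, so \<open>eval_at\<close> is
  equivariant.\<close>

lemma orbit_dual_dual:
  assumes act: "\<And>x. x \<in> q \<Longrightarrow> act x \<in> linear_hom U U" and u: "u \<in> carrier U"
  shows "orbit q (dual_act (dual U) (dual_act U act)) (eval_at u) = eval_at ` orbit q act u"
proof -
  have "dual_act (dual U) (dual_act U act) x (eval_at u) = eval_at (act x u)" if x: "x \<in> q" for x
  proof -
    have "dual_act U act x f \<in> carrier (dual U)" if f: "f \<in> carrier (dual U)" for f
      using linear_hom_mem[OF act[OF x]] linear_hom_add[OF act[OF x]] linear_hom_smult[OF act[OF x]]
      by (auto simp: dual_act_def dual_iff[of _ U] dual_add[OF f] dual_smult[OF f])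
    then show ?thesis
      using u linear_hom_mem[OF act[OF x]]
      by (auto simp: dual_act_def[of "dual U"] eval_at_def fun_eq_iff) (simp add: dual_act_def)
  qed
  then show ?thesis unfolding orbit_def by (auto simp: image_image)
qed

text \<open>The index of \<open>dual U\<close> maximises over functionals on \<open>dual U\<close>;
  \<open>eval_at\<close> turns these into vectors of \<open>U\<close> and their orbits into orbits
  in \<open>U\<close>.\<close>

lemma ind_dual:
  assumes act: "\<And>x. x \<in> q \<Longrightarrow> act x \<in> linear_hom U U"
    and orb: "\<And>u. u \<in> carrier U \<Longrightarrow> ksubspace (orbit q act u) U"
  shows "ind q (dual_act U act) (dual U) =
    int (kdim U) - int (MAX u\<in>carrier U. kdim (U\<lparr>carrier := orbit q act u\<rparr>))"
proof -
  let ?a = "dual_act (dual U) (dual_act U act)"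
  have "(\<lambda>F. kdim ((dual (dual U))\<lparr>carrier := orbit q ?a F\<rparr>)) ` carrier (dual (dual U)) =
    (\<lambda>u. kdim ((dual (dual U))\<lparr>carrier := orbit q ?a (eval_at u)\<rparr>)) ` carrier U"
    unfolding eval_at_surj[symmetric] by (simp add: image_image)
  also have "\<dots> = (\<lambda>u. kdim (U\<lparr>carrier := orbit q act u\<rparr>)) ` carrier U"
    by (intro image_cong refl)
      (simp add: orbit_dual_dual[OF act] kdim_image[OF dual_dual_vectorspace eval_at_hom eval_at_inj] orb)
  finally show ?thesis by (simp add: ind_def kdim_dual)
qed

end

section \<open>Quotients\<close>

locale kquot = kspace U for U :: "('k::{alg_closed_field,field_char_0}, 'u) module" +
  fixes S :: "'u set"
  assumes S: "ksubspace S U"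
begin

lemma S_abelian_subgroup: "abelian_subgroup S U"
proof (rule abelian_subgroupI3)
  show "abelian_group U" by (rule M.abelian_group_axioms)
  show "additive_subgroup S U"
  proof (rule additive_subgroupI, rule subgroup.intro)
    show "inv\<^bsub>add_monoid U\<^esub> x \<in> S" if "x \<in> S" for x
    proof -
      have "\<ominus>\<^bsub>U\<^esub> x = (- 1) \<odot>\<^bsub>U\<^esub> x"
        using smult_minus_1[of x] ksubspace_subset[OF S] that by (auto simp: class_ring_simps)
      then show ?thesis using ksubspace_smult[OF S that, of "- 1"] by (simp add: a_inv_def)
    qed
  qed (use ksubspace_subset[OF S] ksubspace_zero[OF S] ksubspace_add[OF S] in auto)
qed

interpretation sub: abelian_subgroup S U by (rule S_abelian_subgroup)

abbreviation coset :: "'u \<Rightarrow> 'u set" where "coset u \<equiv> S +>\<^bsub>U\<^esub> u"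

lemma coset_self: "u \<in> carrier U \<Longrightarrow> u \<in> coset u"
  by (rule sub.a_rcos_self)

lemma coset_eqI: "w \<in> coset u \<Longrightarrow> u \<in> carrier U \<Longrightarrow> coset w = coset u"
  using sub.a_repr_independence' by blast

lemma mem_coset_iff:
  assumes "u \<in> carrier U" shows "w \<in> coset u \<longleftrightarrow> (\<exists>s\<in>S. w = s \<oplus>\<^bsub>U\<^esub> u)"
  by (auto simp: a_r_coset_def')

lemma coset_add_left: "s \<in> S \<Longrightarrow> u \<in> carrier U \<Longrightarrow> coset (s \<oplus>\<^bsub>U\<^esub> u) = coset u"
  using coset_eqI mem_coset_iff by blast

lemma coset_subset: "s \<in> S \<Longrightarrow> coset s = S"
  by (rule sub.a_rcos_const)

lemma coset_eq_S_iff: "u \<in> carrier U \<Longrightarrow> coset u = S \<longleftrightarrow> u \<in> S"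
  using coset_self coset_subset by blast

lemma union_coset:
  assumes h: "h \<in> linear_hom U U" "h ` S \<subseteq> S" and u: "u \<in> carrier U"
  shows "(\<Union>w\<in>coset u. coset (h w)) = coset (h u)"
proof -
  have "coset (h w) = coset (h u)" if w: "w \<in> coset u" for w
  proof -
    obtain s where s: "s \<in> S" "w = s \<oplus>\<^bsub>U\<^esub> u" using w mem_coset_iff[OF u] by blast
    then have "h w = h s \<oplus>\<^bsub>U\<^esub> h u"
      using linear_hom_add[OF h(1)] u ksubspace_subset[OF S] by blast
    then show ?thesis using coset_add_left[of "h s" "h u"] h(2) s linear_hom_mem[OF h(1) u] by auto
  qed
  then show ?thesis using coset_self[OF u] by blast
qed

lemma quot_act_coset:
  "act x \<in> linear_hom U U \<Longrightarrow> act x ` S \<subseteq> S \<Longrightarrow> u \<in> carrier U \<Longrightarrow>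
    quot_act U S act x (coset u) = coset (act x u)"
  unfolding quot_act_def by (rule union_coset)

lemma smult_hom: "(\<lambda>u. c \<odot>\<^bsub>U\<^esub> u) \<in> linear_hom U U"
  by (auto simp: linear_hom_iff smult_r_distr smult_assoc1[symmetric] mult.commute)

lemma quot_carrier: "carrier (quot U S) = coset ` carrier U"
  by (auto simp: quot_def A_RCOSETS_def')

lemma quot_zero: "\<zero>\<^bsub>quot U S\<^esub> = S"
  by (simp add: quot_def)

lemma quot_add:
  "u \<in> carrier U \<Longrightarrow> v \<in> carrier U \<Longrightarrow> coset u \<oplus>\<^bsub>quot U S\<^esub> coset v = coset (u \<oplus>\<^bsub>U\<^esub> v)"
  by (simp add: quot_def sub.a_rcos_sum)

lemma quot_smult: "u \<in> carrier U \<Longrightarrow> c \<odot>\<^bsub>quot U S\<^esub> coset u = coset (c \<odot>\<^bsub>U\<^esub> u)"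
  using union_coset[OF smult_hom[of c], of u] ksubspace_smult[OF S, of _ c]
  by (simp add: quot_def image_subset_iff)

lemma quot_vectorspace: "vectorspace class_ring (quot U S)"
proof -
  have z: "S = coset \<zero>\<^bsub>U\<^esub>" using coset_subset[OF ksubspace_zero[OF S]] by simp
  have zi: "S \<in> coset ` carrier U" by (subst z) blast
  have az: "coset v \<oplus>\<^bsub>quot U S\<^esub> S = coset v" if "v \<in> carrier U" for v
    using quot_add[OF that M.zero_closed] that by (simp add: z[symmetric])
  have sm: "(a + b) \<odot>\<^bsub>U\<^esub> u = a \<odot>\<^bsub>U\<^esub> u \<oplus>\<^bsub>U\<^esub> b \<odot>\<^bsub>U\<^esub> u" "(a * b) \<odot>\<^bsub>U\<^esub> u = a \<odot>\<^bsub>U\<^esub> (b \<odot>\<^bsub>U\<^esub> u)"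
    "1 \<odot>\<^bsub>U\<^esub> u = u" if "u \<in> carrier U" for a b u
    using smult_l_distr[of a b u] smult_assoc1[of a b u] smult_one[of u] that by simp_all
  have neg: "\<exists>w\<in>carrier U. u \<oplus>\<^bsub>U\<^esub> w = \<zero>\<^bsub>U\<^esub>" if "u \<in> carrier U" for u
    using that by (intro bexI[of _ "\<ominus>\<^bsub>U\<^esub> u"]) (auto simp: M.r_neg)
  show ?thesis
  proof (rule vs_criteria)
    show "field (class_ring :: 'k ring)" by (rule class_field)
    show "\<forall>v\<in>carrier (quot U S). \<exists>w\<in>carrier (quot U S). v \<oplus>\<^bsub>quot U S\<^esub> w = \<zero>\<^bsub>quot U S\<^esub>"
    proof
      fix v assume "v \<in> carrier (quot U S)"
      then obtain u where u: "u \<in> carrier U" "v = coset u" unfolding quot_carrier by blast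
      obtain w where "w \<in> carrier U" "u \<oplus>\<^bsub>U\<^esub> w = \<zero>\<^bsub>U\<^esub>" using neg[OF u(1)] by blast
      then show "\<exists>w\<in>carrier (quot U S). v \<oplus>\<^bsub>quot U S\<^esub> w = \<zero>\<^bsub>quot U S\<^esub>"
        unfolding quot_carrier quot_zero u(2)
        by (intro bexI[of _ "coset w"]) (auto simp: quot_add u(1) z[symmetric])
    qed
  qed (auto simp: quot_carrier quot_zero quot_add quot_smult M.a_ac smult_r_distr smult_l_distr
      sm coset_subset[OF ksubspace_zero[OF S]] zi az)
qed

lemma coset_hom: "coset \<in> linear_hom U (quot U S)"
  by (auto simp: linear_hom_iff quot_carrier quot_add quot_smult)

end

locale coordinates_quot = coordinates U A C D + kquot U S for U A C D S
begin

text \<open>Rank and nullity of the projection restricted to the preimage of \<open>P\<close>, whose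
  kernel is \<open>S\<close>.\<close>

lemma
  assumes P: "ksubspace P (quot U S)"
  shows kdim_quot_subspace:
    "kdim ((quot U S)\<lparr>carrier := P\<rparr>) + kdim (U\<lparr>carrier := S\<rparr>) =
      kdim (U\<lparr>carrier := {u \<in> carrier U. coset u \<in> P}\<rparr>)" (is ?dim)
    and fin_dim_quot_subspace: "vectorspace.fin_dim class_ring ((quot U S)\<lparr>carrier := P\<rparr>)"
proof -
  let ?W = "{u \<in> carrier U. coset u \<in> P}"
  interpret Q: kspace "quot U S" by (rule kspace.intro) (rule quot_vectorspace)
  have W: "ksubspace ?W U" by (rule preimage_ksubspace[OF quot_vectorspace coset_hom P])
  have "coset \<in> linear_hom (U\<lparr>carrier := ?W\<rparr>) ((quot U S)\<lparr>carrier := P\<rparr>)"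
    by (auto simp: linear_hom_iff quot_add quot_smult)
  then interpret linear_map class_ring "U\<lparr>carrier := ?W\<rparr>" "(quot U S)\<lparr>carrier := P\<rparr>" coset
    by (intro linear_mapI subspace_is_vs Q.subspace_is_vs W P)
  have surj: "coset ` ?W = P"
    using Q.ksubspace_subset[OF P] by (auto simp: quot_carrier)
  have im: "im = P" unfolding im_def using surj by simp
  have ker: "ker = S"
    using ksubspace_subset[OF S] coset_subset Q.ksubspace_zero[OF P] coset_eq_S_iff
    unfolding ker_def by (auto simp: quot_zero)
  from rank_nullity_main[OF fin_dim_subspace[OF W]] surj
  show ?dim "vectorspace.fin_dim class_ring ((quot U S)\<lparr>carrier := P\<rparr>)"
    unfolding im ker by simp_all
qed

lemma fin_dim_quot: "vectorspace.fin_dim class_ring (quot U S)"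
  and kdim_quot: "kdim (quot U S) + kdim (U\<lparr>carrier := S\<rparr>) = kdim U"
proof -
  interpret Q: kspace "quot U S" by (rule kspace.intro) (rule quot_vectorspace)
  have P: "ksubspace (carrier (quot U S)) (quot U S)" by (rule Q.ksubspaceI) auto
  have "{u \<in> carrier U. coset u \<in> carrier (quot U S)} = carrier U" by (auto simp: quot_carrier)
  then show "vectorspace.fin_dim class_ring (quot U S)" "kdim (quot U S) + kdim (U\<lparr>carrier := S\<rparr>) = kdim U"
    using fin_dim_quot_subspace[OF P] kdim_quot_subspace[OF P] by simp_all
qed

end

section \<open>The index and stabilisers\<close>

text \<open>\<open>q\<close> is a bare set, so closure under sums, multiples and brackets is
  demanded of the induced operators on the carrier.\<close>

locale lie_action = coordinates U A C D
  for U :: "('k::{alg_closed_field,field_char_0}, 'u) module" and A C D +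
  fixes q :: "'x set" and act :: "'x \<Rightarrow> 'u \<Rightarrow> 'u"
  assumes act_hom: "x \<in> q \<Longrightarrow> act x \<in> linear_hom U U"
    and act_zero: "\<exists>x\<in>q. \<forall>u\<in>carrier U. act x u = \<zero>\<^bsub>U\<^esub>"
    and act_add: "x \<in> q \<Longrightarrow> y \<in> q \<Longrightarrow> \<exists>z\<in>q. \<forall>u\<in>carrier U. act z u = act x u \<oplus>\<^bsub>U\<^esub> act y u"
    and act_smult: "x \<in> q \<Longrightarrow> \<exists>z\<in>q. \<forall>u\<in>carrier U. act z u = c \<odot>\<^bsub>U\<^esub> act x u"
    and act_bracket: "x \<in> q \<Longrightarrow> y \<in> q \<Longrightarrow>
      \<exists>z\<in>q. \<forall>u\<in>carrier U. act x (act y u) = act y (act x u) \<oplus>\<^bsub>U\<^esub> act z u"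
begin

lemmas act_mem = linear_hom_mem[OF act_hom]
lemmas act_linear = linear_hom_add[OF act_hom] linear_hom_smult[OF act_hom]

lemma act_zero_arg: "x \<in> q \<Longrightarrow> act x \<zero>\<^bsub>U\<^esub> = \<zero>\<^bsub>U\<^esub>"
  by (rule linear_hom_zero[OF vectorspace_axioms vectorspace_axioms act_hom])

abbreviation stab where "stab v \<equiv> lie_stabiliser q act U v"

lemma stab_iff: "x \<in> stab v \<longleftrightarrow> x \<in> q \<and> act x v = \<zero>\<^bsub>U\<^esub>"
  by (simp add: lie_stabiliser_def)

text \<open>Covers the full orbits \<open>q u\<close> too, the stabiliser of 0 being
  \<open>q\<close>.\<close>

lemma orbit_stab_ksubspace:
  assumes v: "v \<in> carrier U" and u: "u \<in> carrier U"
  shows "ksubspace (orbit (stab v) act u) U"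
proof (rule ksubspaceI)
  show "orbit (stab v) act u \<subseteq> carrier U" using act_mem u by (auto simp: orbit_def stab_iff)
  show "\<zero>\<^bsub>U\<^esub> \<in> orbit (stab v) act u"
    using act_zero u v by (force simp: orbit_def stab_iff)
  show "a \<oplus>\<^bsub>U\<^esub> b \<in> orbit (stab v) act u"
    if ab: "a \<in> orbit (stab v) act u" "b \<in> orbit (stab v) act u" for a b
  proof -
    obtain x y where xy: "x \<in> stab v" "y \<in> stab v" "a = act x u" "b = act y u"
      using ab unfolding orbit_def by blast
    then obtain z where z: "z \<in> q" "\<forall>u\<in>carrier U. act z u = act x u \<oplus>\<^bsub>U\<^esub> act y u"
      using act_add stab_iff by blast
    have "z \<in> stab v" using z xy v by (simp add: stab_iff)
    moreover have "a \<oplus>\<^bsub>U\<^esub> b = act z u" using z(2) u xy by simp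
    ultimately show ?thesis unfolding orbit_def by blast
  qed
  show "c \<odot>\<^bsub>U\<^esub> a \<in> orbit (stab v) act u" if a: "a \<in> orbit (stab v) act u" for c a
  proof -
    obtain x where x: "x \<in> stab v" "a = act x u" using a unfolding orbit_def by blast
    then obtain z where z: "z \<in> q" "\<forall>u\<in>carrier U. act z u = c \<odot>\<^bsub>U\<^esub> act x u"
      using act_smult stab_iff by blast
    have "z \<in> stab v" using z x v by (simp add: stab_iff)
    moreover have "c \<odot>\<^bsub>U\<^esub> a = act z u" using z(2) u x by simp
    ultimately show ?thesis unfolding orbit_def by blast
  qed
qed

lemma stab_zero: "stab \<zero>\<^bsub>U\<^esub> = q"
  using act_zero_arg by (auto simp: stab_iff)

lemma orbit_ksubspace: "u \<in> carrier U \<Longrightarrow> ksubspace (orbit q act u) U"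
  using orbit_stab_ksubspace[of "\<zero>\<^bsub>U\<^esub>" u] by (simp add: stab_zero)

text \<open>For \<open>x\<close> in the stabiliser,
  \<open>x y v = y x v + [x, y] v = [x, y] v\<close>. This is what makes the quotient a module over
  the stabiliser.\<close>

lemma stab_stable:
  assumes v: "v \<in> carrier U" and x: "x \<in> stab v" shows "act x ` orbit q act v \<subseteq> orbit q act v"
proof
  fix w assume "w \<in> act x ` orbit q act v"
  then obtain y where y: "y \<in> q" "w = act x (act y v)" unfolding orbit_def by blast
  have xq: "x \<in> q" "act x v = \<zero>\<^bsub>U\<^esub>" using x by (auto simp: stab_iff)
  obtain z where z: "z \<in> q" "\<forall>u\<in>carrier U. act x (act y u) = act y (act x u) \<oplus>\<^bsub>U\<^esub> act z u"
    using act_bracket[OF xq(1) y(1)] by blast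
  have "w = act z v" using z v y xq act_zero_arg act_mem by simp
  then show "w \<in> orbit q act v" using z(1) unfolding orbit_def by blast
qed

text \<open>For generic \<open>t\<close>, a basis of \<open>q v + q_v u\<close> deforms to linearly independent elements of
  \<open>q (v + t u)\<close>.\<close>

lemma orbit_deform:
  assumes v: "v \<in> carrier U" and u: "u \<in> carrier U"
    and W: "W \<subseteq> carrier U"
    and span: "\<And>w. w \<in> W \<Longrightarrow> \<exists>a\<in>orbit q act v. \<exists>b\<in>orbit (stab v) act u. w = a \<oplus>\<^bsub>U\<^esub> b"
  shows "\<exists>z\<in>carrier U. fs.dim (C ` W) \<le> fs.dim (C ` orbit q act z)"
proof -
  let ?G = "C ` orbit q act v" and ?H = "C ` orbit (stab v) act u" and ?F = "C ` carrier U"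
  have qv: "orbit q act v \<subseteq> carrier U" and qu: "orbit (stab v) act u \<subseteq> carrier U"
    using act_mem u v by (auto simp: orbit_def stab_iff)
  have GH: "?G \<union> ?H \<subseteq> ?F" using qv qu by blast
  \<comment> \<open>The basis is taken from the union of the two subspaces, so that each of its
    vectors comes from a single element \<open>X p\<close>.\<close>
  obtain P where P: "P \<subseteq> ?G \<union> ?H" "fs.independent P" "?G \<union> ?H \<subseteq> fs.span P"
    using fs.maximal_independent_subset by blast
  have PF: "P \<subseteq> ?F" using P(1) GH by blast
  have finP: "finite P" using fs.independent_card_le(1)[OF fin_span_C P(2) PF] .
  have "C ` W \<subseteq> fs.span P"
  proof
    fix f assume "f \<in> C ` W"
    then obtain w where "w \<in> W" "f = C w" by blast
    then obtain a b where ab: "a \<in> orbit q act v" "b \<in> orbit (stab v) act u" "f = C (a \<oplus>\<^bsub>U\<^esub> b)"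
      using span by blast
    have "f = C a + C b" using ab qv qu by (simp add: C_add subset_iff)
    then show "f \<in> fs.span P" using P(3) ab by (auto intro!: fs.span_add)
  qed
  then have le: "fs.dim (C ` W) \<le> card P" by (rule fs.dim_le_card[OF _ finP])
  have "\<exists>x. (p \<in> ?G \<longrightarrow> x \<in> q \<and> p = C (act x v)) \<and> (p \<notin> ?G \<longrightarrow> x \<in> stab v \<and> p = C (act x u))"
    if "p \<in> P" for p using that P(1) unfolding orbit_def by blast
  then obtain X where X: "\<And>p. p \<in> P \<Longrightarrow> p \<in> ?G \<Longrightarrow> X p \<in> q \<and> p = C (act (X p) v)"
    "\<And>p. p \<in> P \<Longrightarrow> p \<notin> ?G \<Longrightarrow> X p \<in> stab v \<and> p = C (act (X p) u)"
    by metis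
  interpret pr: vector_space_pair "fun_scale :: 'k \<Rightarrow> ('u \<Rightarrow> 'k) \<Rightarrow> 'u \<Rightarrow> 'k" "fun_scale :: 'k \<Rightarrow> ('u \<Rightarrow> 'k) \<Rightarrow> 'u \<Rightarrow> 'k"
    by (rule vector_space_pair.intro; rule fs.vector_space_axioms)
  \<comment> \<open>\<open>x v\<close> deforms to \<open>x (v + t u) = x v + t x u\<close>, with
    correction term \<open>x u\<close>. If \<open>x\<close> stabilises \<open>v\<close>, then
    \<open>x (v + t u) / t\<close> is \<open>x u\<close> itself, hence no correction.\<close>
  define r where "r p = (if p \<in> ?G then C (act (X p) u) else 0)" for p
  obtain R where R: "fs.lin R" "\<And>p. p \<in> P \<Longrightarrow> R p = r p" "range R = fs.span (r ` P)"
    using pr.linear_independent_extend_subspace[OF P(2), of r] by blast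
  have Fsub: "fs.subspace ?F" by (rule C_image_subspace[OF carrier_subspace])
  have "r ` P \<subseteq> ?F"
  proof
    fix g assume "g \<in> r ` P"
    then obtain p where p: "p \<in> P" "g = r p" by blast
    show "g \<in> ?F"
    proof (cases "p \<in> ?G")
      case True
      then show ?thesis using X(1)[OF p(1)] act_mem u p(2) by (auto simp: r_def)
    next
      case False
      then show ?thesis using fs.subspace_0[OF Fsub] p(2) by (simp add: r_def)
    qed
  qed
  then have "fs.span (r ` P) \<subseteq> ?F" by (rule fs.span_minimal[OF _ Fsub])
  then have "R ` ?F \<subseteq> ?F" using R(3) by blast
  \<comment> \<open>The deformation \<open>1 + t R\<close> is injective for this \<open>t\<close>
    and so preserves independence; \<open>t\<close> must be nonzero for the division by
    \<open>t\<close>.\<close>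
  from fs.generic_invertible[OF R(1) Fsub fin_span_C this]
  obtain t where t: "t \<noteq> 0" "\<And>w. w \<in> ?F \<Longrightarrow> w + fun_scale t (R w) = 0 \<Longrightarrow> w = 0" by metis
  define L where "L w = w + fun_scale t (R w)" for w
  have L: "fs.lin L"
  proof (rule fs.linI)
    show "L (x + y) = L x + L y" for x y
      unfolding L_def fs.lin_add[OF R(1)] fs.scale_right_distrib by (simp only: ac_simps)
    show "L (fun_scale c x) = fun_scale c (L x)" for c x
      unfolding L_def fs.lin_scale[OF R(1)] fs.scale_right_distrib
      by (simp only: fs.scale_left_commute[of t c])
  qed
  have inj: "inj_on L (fs.span P)"
  proof (rule inj_onI)
    fix a b assume ab: "a \<in> fs.span P" "b \<in> fs.span P" "L a = L b"
    have "fs.span P \<subseteq> ?F" by (rule fs.span_minimal[OF PF Fsub])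
    then have "a - b \<in> ?F" using ab(1,2) by (intro fs.subspace_diff[OF Fsub]) auto
    moreover have "L (a - b) = 0" using ab(3) by (simp only: fs.lin_diff[OF L]) simp
    ultimately show "a = b" using t(2)[of "a - b"] by (simp only: L_def right_minus_eq)
  qed
  have indL: "fs.independent (L ` P)"
    by (rule pr.linear_independent_injective_image[OF L P(2) inj])
  have cardL: "card (L ` P) = card P"
    by (rule card_image) (rule inj_on_subset[OF inj fs.span_superset])
  let ?z = "v \<oplus>\<^bsub>U\<^esub> t \<odot>\<^bsub>U\<^esub> u"
  have z: "?z \<in> carrier U" using u v by simp
  have Oz: "fs.subspace (C ` orbit q act ?z)" by (rule C_image_subspace[OF orbit_ksubspace[OF z]])
  have az: "C (act x ?z) = C (act x v) + fun_scale t (C (act x u))" if x: "x \<in> q" for x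
    using act_mem[OF x] u v by (simp add: act_linear[OF x] C_add C_scale)
  have "L ` P \<subseteq> C ` orbit q act ?z"
  proof
    fix g assume "g \<in> L ` P"
    then obtain p where p: "p \<in> P" "g = L p" by blast
    show "g \<in> C ` orbit q act ?z"
    proof (cases "p \<in> ?G")
      case True
      then have x: "X p \<in> q" "p = C (act (X p) v)" using X(1)[OF p(1)] by auto
      have "g = C (act (X p) ?z)"
        unfolding p(2) L_def R(2)[OF p(1)] az[OF x(1)] x(2)[symmetric] using True by (simp only: r_def if_True)
      then show ?thesis using x(1) unfolding orbit_def by blast
    next
      case False
      then have x: "X p \<in> q" "act (X p) v = \<zero>\<^bsub>U\<^esub>" "p = C (act (X p) u)"
        using X(2)[OF p(1)] by (auto simp: stab_iff)
      have "C (act (X p) ?z) = fun_scale t p" unfolding az[OF x(1)] x(2) C_zero x(3)[symmetric] by simp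
      then have "p = fun_scale (inverse t) (C (act (X p) ?z))" using t(1) by (simp add: fun_scale_def fun_eq_iff)
      moreover have "C (act (X p) ?z) \<in> C ` orbit q act ?z" using x(1) unfolding orbit_def by blast
      moreover have "g = p" unfolding p(2) L_def R(2)[OF p(1)] using False by (simp add: r_def fun_scale_def zero_fun_def)
      ultimately show ?thesis using fs.subspace_scale[OF Oz] by metis
    qed
  qed
  moreover have "C ` orbit q act ?z \<subseteq> ?F" using ksubspace_subset[OF orbit_ksubspace[OF z]] by blast
  ultimately have "card P \<le> fs.dim (C ` orbit q act ?z)"
    using fs.independent_card_le(2)[OF fs.fin_span_subset[OF fin_span_C] indL] cardL by metis
  then show ?thesis using le z by (meson order_trans)
qed

text \<open>\<open>B\<close> bounds one codimension from above and \<open>C\<close> all of them from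
  below, so both maxima are attained at codimension \<open>n\<close>. On the quotient, the dimension
  of \<open>q v\<close> is subtracted from the space as well as from the maximum and
  cancels.\<close>

lemma ind_stabiliser_eq:
  assumes v: "v \<in> carrier U"
    and B: "\<exists>u\<in>carrier U. \<exists>P\<subseteq>carrier U. finite P \<and> card P \<le> n \<and>
      (\<forall>f\<in>carrier (dual U). (\<forall>x\<in>q. f (act x v) = 0) \<and> (\<forall>x\<in>stab v. f (act x u) = 0) \<and>
        (\<forall>p\<in>P. f p = 0) \<longrightarrow> (\<forall>w\<in>carrier U. f w = 0))"
    and C: "\<And>z. z \<in> carrier U \<Longrightarrow> \<exists>f w. (\<forall>j<n. f j \<in> carrier (dual U) \<and> w j \<in> carrier U \<and>
      (\<forall>x\<in>q. f j (act x z) = 0) \<and> f j (w j) \<noteq> 0 \<and> (\<forall>i<j. f j (w i) = 0))"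
  defines "Q \<equiv> quot U (orbit q act v)"
  shows "ind q (dual_act U act) (dual U) =
    ind (stab v) (dual_act Q (quot_act U (orbit q act v) act)) (dual Q)"
proof -
  let ?S = "orbit q act v" and ?act = "quot_act U (orbit q act v) act"
  interpret cq: coordinates_quot U A C D ?S
    by (intro coordinates_quot.intro coordinates_axioms kquot.intro kquot_axioms.intro kspace_axioms
        orbit_ksubspace v)
  note coset = cq.coset_hom[folded Q_def]
  have Qvs: "vectorspace class_ring Q" unfolding Q_def by (rule cq.quot_vectorspace)
  have Qfd: "vectorspace.fin_dim class_ring Q" unfolding Q_def by (rule cq.fin_dim_quot)
  obtain A' C' D' where "coordinates Q A' C' D'" using coordinates_exist[OF Qvs Qfd] by blast
  then interpret Q: coordinates Q A' C' D' .
  have Qc: "carrier Q = cq.coset ` carrier U" unfolding Q_def by (rule cq.quot_carrier)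
  have act_coset: "?act x (cq.coset u) = cq.coset (act x u)" if "x \<in> stab v" "u \<in> carrier U" for x u
    using that stab_stable[OF v] act_hom by (intro cq.quot_act_coset) (auto simp: stab_iff)
  have Qhom: "?act x \<in> linear_hom Q Q" if x: "x \<in> stab v" for x
  proof -
    have xq: "x \<in> q" using x by (simp add: stab_iff)
    show ?thesis
      unfolding linear_hom_iff Qc
      using act_mem[OF xq] act_linear[OF xq] linear_hom_add[OF coset] linear_hom_smult[OF coset]
      by (auto simp: act_coset[OF x] linear_hom_add[OF coset, symmetric] linear_hom_smult[OF coset, symmetric])
  qed
  have Qorb: "orbit (stab v) ?act (cq.coset u) = cq.coset ` orbit (stab v) act u" if "u \<in> carrier U" for u
    using act_coset that unfolding orbit_def by (auto simp: image_image)
  have Qsub: "ksubspace (orbit (stab v) ?act (cq.coset u)) Q" if "u \<in> carrier U" for u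
    unfolding Qorb[OF that] by (rule image_ksubspace[OF Qvs coset orbit_stab_ksubspace[OF v that]])
  \<comment> \<open>\<open>W u\<close> is \<open>q v + q_v u\<close>, described as the preimage of
    an orbit in the quotient.\<close>
  define W where "W u = {w \<in> carrier U. cq.coset w \<in> orbit (stab v) ?act (cq.coset u)}" for u
  have Wsub: "ksubspace (W u) U" if "u \<in> carrier U" for u
    unfolding W_def by (rule preimage_ksubspace[OF Qvs coset Qsub[OF that]])
  have dimW: "kdim (Q\<lparr>carrier := orbit (stab v) ?act (cq.coset u)\<rparr>) + kdim (U\<lparr>carrier := ?S\<rparr>) = fs.dim (C ` W u)"
    if "u \<in> carrier U" for u
    using cq.kdim_quot_subspace[folded Q_def, OF Qsub[OF that]] kdim_subspace[OF Wsub[OF that]]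
    unfolding W_def by simp
  have orbW: "act x v \<in> W u" "y \<in> stab v \<Longrightarrow> act y u \<in> W u" if "x \<in> q" "u \<in> carrier U" for x y u
  proof -
    have "act x v \<in> ?S" using that unfolding orbit_def by blast
    then have "cq.coset (act x v) = \<zero>\<^bsub>Q\<^esub>" unfolding Q_def cq.quot_zero by (rule cq.coset_subset)
    then show "act x v \<in> W u"
      using Q.ksubspace_zero[OF Qsub[OF that(2)]] act_mem[OF that(1) v] by (simp add: W_def)
    show "act y u \<in> W u" if "y \<in> stab v"
    proof -
      have "act y u \<in> orbit (stab v) act u" using that unfolding orbit_def by blast
      then have "cq.coset (act y u) \<in> orbit (stab v) ?act (cq.coset u)"
        unfolding Qorb[OF \<open>u \<in> carrier U\<close>] by blast
      moreover have "act y u \<in> carrier U" using that \<open>u \<in> carrier U\<close> act_mem by (simp add: stab_iff)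
      ultimately show ?thesis by (simp add: W_def)
    qed
  qed
  have Wsum: "\<exists>a\<in>?S. \<exists>b\<in>orbit (stab v) act u. w = a \<oplus>\<^bsub>U\<^esub> b" if u: "u \<in> carrier U" and w: "w \<in> W u" for u w
  proof -
    obtain b where b: "b \<in> orbit (stab v) act u" "cq.coset w = cq.coset b"
      using w unfolding W_def Qorb[OF u] by blast
    have "b \<in> carrier U" using b(1) ksubspace_subset[OF orbit_stab_ksubspace[OF v u]] by blast
    moreover have "w \<in> cq.coset b" using cq.coset_self[of w] w b(2) by (simp add: W_def)
    ultimately show ?thesis using cq.mem_coset_iff b(1) by blast
  qed
  let ?F = "C ` carrier U"
  have up: "fs.dim (C ` orbit q act z) + n \<le> kdim U" if z: "z \<in> carrier U" for z
  proof -
    obtain f w where f: "\<And>j. j < n \<Longrightarrow> f j \<in> carrier (dual U)" "\<And>j. j < n \<Longrightarrow> w j \<in> carrier U"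
      "\<And>j x. j < n \<Longrightarrow> x \<in> q \<Longrightarrow> f j (act x z) = 0" "\<And>j. j < n \<Longrightarrow> f j (w j) \<noteq> 0"
      "\<And>i j. j < n \<Longrightarrow> i < j \<Longrightarrow> f j (w i) = 0" using C[OF z] by blast
    have "fs.dim (C ` orbit q act z) + n \<le> fs.dim ?F"
    proof (rule fs.dim_le_of_functionals[where f = "\<lambda>j g. f j (D g)" and w = "\<lambda>j. C (w j)"])
      show "C ` orbit q act z \<subseteq> ?F" using ksubspace_subset[OF orbit_ksubspace[OF z]] by blast
      show "f j (D b) = 0" if "j < n" "b \<in> C ` orbit q act z" for j b
        using that f(3)[OF that(1)] act_mem z by (auto simp: orbit_def DC)
    qed (use f fin_span_C dual_linf in \<open>auto simp: DC\<close>)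
    then show ?thesis by (simp add: kdim_eq)
  qed
  have Wup: "fs.dim (C ` W u) + n \<le> kdim U" if u: "u \<in> carrier U" for u
  proof -
    obtain z where "z \<in> carrier U" "fs.dim (C ` W u) \<le> fs.dim (C ` orbit q act z)"
      using orbit_deform[OF v u ksubspace_subset[OF Wsub[OF u]]] Wsum[OF u] by blast
    then show ?thesis using up by fastforce
  qed
  obtain u where u: "u \<in> carrier U" and Wlow: "kdim U \<le> fs.dim (C ` W u) + n"
  proof -
    obtain u P where u: "u \<in> carrier U" and P: "P \<subseteq> carrier U" "finite P" "card P \<le> n"
      and h0: "\<forall>f\<in>carrier (dual U). (\<forall>x\<in>q. f (act x v) = 0) \<and> (\<forall>x\<in>stab v. f (act x u) = 0) \<and>
        (\<forall>p\<in>P. f p = 0) \<longrightarrow> (\<forall>w\<in>carrier U. f w = 0)"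
      using B by (elim bexE exE conjE) (rule that)
    have h: "f w = 0" if "f \<in> carrier (dual U)" "\<And>x. x \<in> q \<Longrightarrow> f (act x v) = 0"
      "\<And>x. x \<in> stab v \<Longrightarrow> f (act x u) = 0" "\<And>p. p \<in> P \<Longrightarrow> f p = 0" "w \<in> carrier U" for f w
      using h0[THEN bspec, OF that(1)] that(2-5) by simp
    have "fs.dim ?F \<le> fs.dim (C ` W u) + card (C ` P)"
    proof (rule fs.dim_ge_of_functionals)
      show "C ` W u \<subseteq> ?F" using ksubspace_subset[OF Wsub[OF u]] by blast
      show "finite (C ` P)" using P(2) by simp
      fix f g assume f: "fs.linf f" "\<And>g. g \<in> C ` W u \<union> C ` P \<Longrightarrow> f g = 0" and g: "g \<in> ?F"
      let ?f = "\<lambda>u\<in>carrier U. f (C u)"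
      obtain w where w: "w \<in> carrier U" "g = C w" using g by blast
      obtain x0 where "x0 \<in> q" using act_zero by blast
      have "?f w = 0"
      proof (rule h[OF linf_dual[OF f(1)] _ _ _ w(1)])
        show "?f (act x v) = 0" if "x \<in> q" for x
          using f(2) orbW(1)[OF that u] act_mem[OF that v] by simp
        show "?f (act x u) = 0" if "x \<in> stab v" for x
          using f(2) orbW(2)[OF \<open>x0 \<in> q\<close> u that] act_mem[of x u] u that by (simp add: stab_iff)
        show "?f p = 0" if "p \<in> P" for p using f(2) that P(1) by auto
      qed
      then show "f g = 0" using w by simp
    qed (rule fin_span_C)
    moreover have "card (C ` P) \<le> n" using card_image_le[OF P(2), of C] P(3) by simp
    ultimately show thesis using that[OF u] by (simp add: kdim_eq)
  qed
  have Wu: "fs.dim (C ` W u) = kdim U - n" using Wup[OF u] Wlow by simp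
  \<comment> \<open>Deforming the optimal sum yields a \<open>z\<close> whose orbit attains the
    bound on the left-hand side of the equation as well.\<close>
  obtain z where z: "z \<in> carrier U" "fs.dim (C ` W u) \<le> fs.dim (C ` orbit q act z)"
    using orbit_deform[OF v u ksubspace_subset[OF Wsub[OF u]]] Wsum[OF u] by blast
  have "(MAX u\<in>carrier U. kdim (U\<lparr>carrier := orbit q act u\<rparr>)) = kdim U - n"
  proof (rule Max_eqI)
    \<comment> \<open>The maximum ranges over all vectors, but only finitely many dimensions
      occur.\<close>
    show "finite ((\<lambda>u. kdim (U\<lparr>carrier := orbit q act u\<rparr>)) ` carrier U)"
      by (rule finite_subset[of _ "{..kdim U}"]) (use up kdim_subspace[OF orbit_ksubspace] in fastforce)+
    show "y \<le> kdim U - n" if "y \<in> (\<lambda>u. kdim (U\<lparr>carrier := orbit q act u\<rparr>)) ` carrier U" for y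
      using that up kdim_subspace[OF orbit_ksubspace] by fastforce
    have "kdim (U\<lparr>carrier := orbit q act z\<rparr>) = kdim U - n"
      using z up[OF z(1)] Wu kdim_subspace[OF orbit_ksubspace[OF z(1)]] by simp
    then show "kdim U - n \<in> (\<lambda>u. kdim (U\<lparr>carrier := orbit q act u\<rparr>)) ` carrier U"
      using z(1) by force
  qed
  moreover have "(MAX c\<in>carrier Q. kdim (Q\<lparr>carrier := orbit (stab v) ?act c\<rparr>)) =
    kdim U - n - kdim (U\<lparr>carrier := ?S\<rparr>)"
  proof (rule Max_eqI)
    let ?M = "(\<lambda>c. kdim (Q\<lparr>carrier := orbit (stab v) ?act c\<rparr>)) ` carrier Q"
    have le: "y \<le> kdim U - n - kdim (U\<lparr>carrier := ?S\<rparr>)" if y: "y \<in> ?M" for y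
    proof -
      obtain u where u: "u \<in> carrier U" "y = kdim (Q\<lparr>carrier := orbit (stab v) ?act (cq.coset u)\<rparr>)"
        using y unfolding Qc by blast
      show ?thesis using dimW[OF u(1)] Wup[OF u(1)] u(2) by linarith
    qed
    then show "y \<le> kdim U - n - kdim (U\<lparr>carrier := ?S\<rparr>)" if "y \<in> ?M" for y using that .
    show "finite ?M" by (rule finite_subset[of _ "{..kdim U - n - kdim (U\<lparr>carrier := ?S\<rparr>)}"]) (use le in auto)
    show "kdim U - n - kdim (U\<lparr>carrier := ?S\<rparr>) \<in> ?M"
      using dimW[OF u] Wu u unfolding Qc by force
  qed
  moreover have "kdim (U\<lparr>carrier := ?S\<rparr>) + n \<le> kdim U"
    using up[OF v] kdim_subspace[OF orbit_ksubspace[OF v]] by simp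
  moreover have "kdim Q + kdim (U\<lparr>carrier := ?S\<rparr>) = kdim U" unfolding Q_def by (rule cq.kdim_quot)
  moreover have "ind (stab v) (dual_act Q ?act) (dual Q) =
      int (kdim Q) - int (MAX c\<in>carrier Q. kdim (Q\<lparr>carrier := orbit (stab v) ?act c\<rparr>))"
    by (rule Q.ind_dual) (use Qhom Qsub Qc in auto)
  moreover have "ind q (dual_act U act) (dual U) =
      int (kdim U) - int (MAX u\<in>carrier U. kdim (U\<lparr>carrier := orbit q act u\<rparr>))"
    by (rule ind_dual) (use act_hom orbit_ksubspace in auto)
  ultimately show ?thesis by simp
qed

end

section \<open>The exterior square\<close>

lemma lookup_scale:
  "Poly_Mapping.lookup (Poly_Mapping.map ((*) c) f) k = (c :: 'k::comm_ring_1) * Poly_Mapping.lookup f k"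
  by (simp add: Poly_Mapping.map.rep_eq when_def)

lemma keys_scale: "Poly_Mapping.keys (Poly_Mapping.map ((*) (c :: 'k::comm_ring_1)) f) \<subseteq> Poly_Mapping.keys f"
  by (auto simp: in_keys_iff lookup_scale)

text \<open>Scaling by 0 shrinks the support; \<open>F k 0 = 0\<close> makes the lost keys
  harmless.\<close>

lemma sum_keys_scale:
  fixes F :: "'b \<Rightarrow> 'k::comm_ring_1 \<Rightarrow> 'm::comm_monoid_add"
  assumes "\<And>k. F k 0 = 0"
  shows "(\<Sum>k\<in>Poly_Mapping.keys (Poly_Mapping.map ((*) c) f). F k (Poly_Mapping.lookup (Poly_Mapping.map ((*) c) f) k))
    = (\<Sum>k\<in>Poly_Mapping.keys f. F k (c * Poly_Mapping.lookup f k))"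
  unfolding lookup_scale
  by (rule sum.mono_neutral_left) (use keys_scale assms in \<open>auto simp: in_keys_iff lookup_scale\<close>)

lemma free_carrier: "f \<in> carrier (free_vs B) \<longleftrightarrow> Poly_Mapping.keys f \<subseteq> B"
  by (simp add: free_vs_def)

lemma free_simps:
  "f \<oplus>\<^bsub>free_vs B\<^esub> g = f + g" "c \<odot>\<^bsub>free_vs B\<^esub> f = Poly_Mapping.map ((*) c) f" "\<zero>\<^bsub>free_vs B\<^esub> = 0"
  by (simp_all add: free_vs_def)

lemma free_vectorspace: "vectorspace class_ring (free_vs B :: ('k::field, 'b \<Rightarrow>\<^sub>0 'k) module)"
proof (rule vs_criteria)
  show "\<forall>f\<in>carrier (free_vs B :: ('k, 'b \<Rightarrow>\<^sub>0 'k) module). \<exists>g\<in>carrier (free_vs B). f \<oplus>\<^bsub>free_vs B\<^esub> g = \<zero>\<^bsub>free_vs B\<^esub>"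
  proof
    fix f :: "'b \<Rightarrow>\<^sub>0 'k" assume "f \<in> carrier (free_vs B)"
    then show "\<exists>g\<in>carrier (free_vs B). f \<oplus>\<^bsub>free_vs B\<^esub> g = \<zero>\<^bsub>free_vs B\<^esub>"
      using keys_scale[of "- 1" f]
      by (intro bexI[of _ "Poly_Mapping.map ((*) (- 1)) f"])
        (auto simp: free_carrier free_simps lookup_scale lookup_add intro!: poly_mapping_eqI)
  qed
  show "\<forall>v w. v \<in> carrier (free_vs B :: ('k, 'b \<Rightarrow>\<^sub>0 'k) module) \<and> w \<in> carrier (free_vs B) \<longrightarrow>
      v \<oplus>\<^bsub>free_vs B\<^esub> w \<in> carrier (free_vs B)"
    using keys_add by (fastforce simp: free_carrier free_simps)
  show "\<forall>c v. c \<in> carrier class_ring \<and> v \<in> carrier (free_vs B :: ('k, 'b \<Rightarrow>\<^sub>0 'k) module) \<longrightarrow>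
      c \<odot>\<^bsub>free_vs B\<^esub> v \<in> carrier (free_vs B)"
    using keys_scale by (fastforce simp: free_carrier free_simps)
qed (auto simp: class_field free_carrier free_simps lookup_scale lookup_add algebra_simps intro!: poly_mapping_eqI)

definition free_sum :: "('k::comm_ring_1 \<times> 'v \<times> 'v) list \<Rightarrow> ('v \<times> 'v) \<Rightarrow>\<^sub>0 'k" where
  "free_sum us = (\<Sum>(c, a, b)\<leftarrow>us. Poly_Mapping.single (a, b) c)"

lemma free_sum_simps [simp]:
  "free_sum [] = 0" "free_sum ((c, a, b) # us) = Poly_Mapping.single (a, b) c + free_sum us"
  by (simp_all add: free_sum_def)

lemma free_sum_exists:
  assumes "Poly_Mapping.keys f \<subseteq> V \<times> V"
  shows "\<exists>us. set us \<subseteq> UNIV \<times> V \<times> V \<and> f = free_sum us"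
proof -
  obtain ks where ks: "set ks = Poly_Mapping.keys f" "distinct ks"
    using finite_distinct_list[OF finite_keys[of f]] by metis
  let ?us = "map (\<lambda>(a, b). (Poly_Mapping.lookup f (a, b), a, b)) ks"
  have "f = (\<Sum>k\<in>Poly_Mapping.keys f. Poly_Mapping.single k (Poly_Mapping.lookup f k))"
    by (intro poly_mapping_eqI) (auto simp: lookup_sum lookup_single when_def in_keys_iff)
  also have "\<dots> = (\<Sum>k\<leftarrow>ks. Poly_Mapping.single k (Poly_Mapping.lookup f k))"
    unfolding ks(1)[symmetric] by (rule sum.distinct_set_conv_list[OF ks(2)])
  also have "\<dots> = free_sum ?us" by (simp add: free_sum_def case_prod_unfold comp_def)
  finally show ?thesis using assms ks(1) by (intro exI[of _ ?us]) auto
qed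

lemma free_sum_carrier: "set us \<subseteq> UNIV \<times> V \<times> V \<Longrightarrow> free_sum us \<in> carrier (free_vs (V \<times> V))"
proof (induction us)
  case (Cons u us)
  obtain c a b where u: "u = (c, a, b)" by (cases u)
  have "Poly_Mapping.keys (Poly_Mapping.single (a, b) c + free_sum us) \<subseteq>
    Poly_Mapping.keys (Poly_Mapping.single (a, b) c) \<union> Poly_Mapping.keys (free_sum us)" by (rule keys_add)
  then show ?case using Cons by (auto simp: u free_carrier split: if_splits)
qed (simp add: free_carrier)

abbreviation lie_single where
  "lie_single x k c \<equiv> Poly_Mapping.single (x (fst k), snd k) c + Poly_Mapping.single (fst k, x (snd k)) c"

lemma free_lie_act_eq:
  "free_lie_act x f = (\<Sum>k\<in>Poly_Mapping.keys f. lie_single x k (Poly_Mapping.lookup f k))"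
  by (simp add: free_lie_act_def case_prod_unfold)

lemma free_lie_act_add: "free_lie_act x (f + g) = free_lie_act x f + free_lie_act x g"
  unfolding free_lie_act_eq
  by (rule setsum_keys_plus_distrib[where f = "lie_single x"]) (simp_all add: single_add ac_simps)

lemma free_lie_act_scale:
  "free_lie_act x (Poly_Mapping.map ((*) c) f) = Poly_Mapping.map ((*) c) (free_lie_act x (f :: ('v \<times> 'v) \<Rightarrow>\<^sub>0 'k::field))"
proof -
  have m: "Poly_Mapping.map ((*) c) (\<Sum>i\<in>I. h i) = (\<Sum>i\<in>I. Poly_Mapping.map ((*) c) (h i))" for I and h :: "'i \<Rightarrow> 'b \<Rightarrow>\<^sub>0 'k"
    by (intro poly_mapping_eqI) (simp add: lookup_scale lookup_sum sum_distrib_left)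
  have a: "Poly_Mapping.map ((*) c) (g + h) = Poly_Mapping.map ((*) c) g + Poly_Mapping.map ((*) c) h" for g h :: "'b \<Rightarrow>\<^sub>0 'k"
    by (intro poly_mapping_eqI) (simp add: lookup_scale lookup_add ring_distribs)
  show ?thesis
    unfolding free_lie_act_eq m a by (subst sum_keys_scale[where F = "lie_single x"]) simp_all
qed

lemma free_lie_act_single:
  "free_lie_act x (Poly_Mapping.single (a, b) c) = Poly_Mapping.single (x a, b) c + Poly_Mapping.single (a, x b) c"
  by (simp add: free_lie_act_def)

lemma free_lie_act_free_sum: "free_lie_act x (free_sum us) = free_sum (wedge_act x us)"
proof (induction us)
  case (Cons u us)
  then show ?case by (cases u) (simp add: free_lie_act_add free_lie_act_single add.assoc)
qed (simp add: free_lie_act_def)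

definition pair_eval :: "('v \<Rightarrow> 'v \<Rightarrow> 'k) \<Rightarrow> (('v \<times> 'v) \<Rightarrow>\<^sub>0 'k::comm_ring_1) \<Rightarrow> 'k" where
  "pair_eval \<beta> f = (\<Sum>k\<in>Poly_Mapping.keys f. Poly_Mapping.lookup f k * \<beta> (fst k) (snd k))"

lemma pair_eval_add: "pair_eval \<beta> (f + g) = pair_eval \<beta> f + pair_eval \<beta> g"
  unfolding pair_eval_def
  by (rule setsum_keys_plus_distrib[where f = "\<lambda>k c. c * \<beta> (fst k) (snd k)"]) (simp_all add: ring_distribs)

lemma pair_eval_diff: "pair_eval \<beta> (f - g) = pair_eval \<beta> f - pair_eval \<beta> g"
  using pair_eval_add[of \<beta> "f - g" g] by simp

lemma pair_eval_scale: "pair_eval \<beta> (Poly_Mapping.map ((*) c) f) = c * pair_eval \<beta> f"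
  unfolding pair_eval_def
  by (subst sum_keys_scale[where F = "\<lambda>k d. d * \<beta> (fst k) (snd k)"]) (simp_all add: sum_distrib_left mult.assoc)

lemma pair_eval_single: "pair_eval \<beta> (Poly_Mapping.single (a, b) c) = c * \<beta> a b"
  by (simp add: pair_eval_def)

lemma pair_eval_free_sum: "pair_eval \<beta> (free_sum us) = wedge_eval \<beta> us"
proof (induction us)
  case (Cons u us)
  then show ?case by (cases u) (simp add: pair_eval_add pair_eval_single)
qed (simp add: pair_eval_def)

definition alternating_form :: "('k::field, 'v) module \<Rightarrow> ('v \<Rightarrow> 'v \<Rightarrow> 'k) \<Rightarrow> bool" where
  "alternating_form V \<beta> \<longleftrightarrow>
    (\<forall>a\<in>carrier V. \<forall>b\<in>carrier V. \<forall>u\<in>carrier V. \<beta> (a \<oplus>\<^bsub>V\<^esub> b) u = \<beta> a u + \<beta> b u \<and> \<beta> u (a \<oplus>\<^bsub>V\<^esub> b) = \<beta> u a + \<beta> u b) \<and>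
    (\<forall>a\<in>carrier V. \<forall>u\<in>carrier V. \<forall>c. \<beta> (c \<odot>\<^bsub>V\<^esub> a) u = c * \<beta> a u \<and> \<beta> u (c \<odot>\<^bsub>V\<^esub> a) = c * \<beta> u a) \<and>
    (\<forall>a\<in>carrier V. \<beta> a a = 0)"

lemma
  assumes "alternating_form V \<beta>" "a \<in> carrier V" "u \<in> carrier V"
  shows alternating_form_add: "b \<in> carrier V \<Longrightarrow> \<beta> (a \<oplus>\<^bsub>V\<^esub> b) u = \<beta> a u + \<beta> b u"
      "b \<in> carrier V \<Longrightarrow> \<beta> u (a \<oplus>\<^bsub>V\<^esub> b) = \<beta> u a + \<beta> u b"
    and alternating_form_smult: "\<beta> (c \<odot>\<^bsub>V\<^esub> a) u = c * \<beta> a u" "\<beta> u (c \<odot>\<^bsub>V\<^esub> a) = c * \<beta> u a"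
  using assms by (auto simp: alternating_form_def)

lemma alternating_form_self: "alternating_form V \<beta> \<Longrightarrow> a \<in> carrier V \<Longrightarrow> \<beta> a a = 0"
  by (auto simp: alternating_form_def)

lemma alternating_form_skew:
  assumes V: "vectorspace class_ring V" and \<beta>: "alternating_form V \<beta>" and ab: "a \<in> carrier V" "b \<in> carrier V"
  shows "\<beta> a b = - \<beta> b a"
proof -
  interpret vectorspace class_ring V by fact
  have "0 = \<beta> (a \<oplus>\<^bsub>V\<^esub> b) (a \<oplus>\<^bsub>V\<^esub> b)" using alternating_form_self[OF \<beta>, of "a \<oplus>\<^bsub>V\<^esub> b"] ab by simp
  also have "\<dots> = (\<beta> a a + \<beta> a b) + (\<beta> b a + \<beta> b b)"
    using ab by (simp only: alternating_form_add[OF \<beta>] M.a_closed ac_simps)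
  also have "\<dots> = \<beta> a b + \<beta> b a"
    using ab alternating_form_self[OF \<beta>] by simp
  finally show ?thesis by (simp add: eq_neg_iff_add_eq_0)
qed

section \<open>Classes of bivectors and alternating forms\<close>

locale ext_square = coordinates V A C D for V :: "('k::{alg_closed_field,field_char_0}, 'v) module" and A C D
begin

abbreviation F where "F \<equiv> free_vs (carrier V \<times> carrier V) :: ('k, ('v \<times> 'v) \<Rightarrow>\<^sub>0 'k) module"
abbreviation R where "R \<equiv> ext_rel_space V"
abbreviation entries :: "('k \<times> 'v \<times> 'v) list \<Rightarrow> bool" where
  "entries us \<equiv> set us \<subseteq> UNIV \<times> carrier V \<times> carrier V"

sublocale free: kspace F
  by (rule kspace.intro) (rule free_vectorspace)

lemma single_carrier: "a \<in> carrier V \<Longrightarrow> b \<in> carrier V \<Longrightarrow> Poly_Mapping.single (a, b) c \<in> carrier F"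
  by (simp add: free_carrier)

lemma diff_carrier: "f \<in> carrier F \<Longrightarrow> g \<in> carrier F \<Longrightarrow> f - g \<in> carrier F"
  using keys_diff[of f g] by (auto simp: free_carrier)

lemma relations_carrier: "ext_relations V \<subseteq> carrier F"
  unfolding ext_relations_def
  by (intro Un_least subsetI; elim CollectE exE conjE; hypsubst;
      (intro diff_carrier single_carrier M.a_closed smult_closed UNIV_I; simp)?)

lemma relations_subset: "ext_relations V \<subseteq> R"
  unfolding ext_rel_space_def by (rule free.in_own_span[OF relations_carrier])

lemma R_ksubspace: "ksubspace R F"
  unfolding ext_rel_space_def by (rule free.span_is_subspace[OF relations_carrier])

sublocale cq: kquot F R
  by (intro kquot.intro kquot_axioms.intro free.kspace_axioms R_ksubspace)

definition cls :: "('k \<times> 'v \<times> 'v) list \<Rightarrow> (('v \<times> 'v) \<Rightarrow>\<^sub>0 'k) set" where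
  "cls us = cq.coset (free_sum us)"

abbreviation U where "U \<equiv> ext2 V"
abbreviation act where "act \<equiv> ext2_lie_act V"

lemma ext2_eq: "U = quot F R"
  by (simp add: ext2_def)

lemma ext_vectorspace: "vectorspace class_ring U"
  unfolding ext2_eq by (rule cq.quot_vectorspace)

lemma cls_exists: assumes "u \<in> carrier U" shows "\<exists>us. entries us \<and> u = cls us"
proof -
  obtain f where f: "f \<in> carrier F" "u = cq.coset f"
    using assms unfolding ext2_eq cq.quot_carrier by blast
  then obtain us where "entries us" "f = free_sum us"
    using free_sum_exists[of f "carrier V"] unfolding free_carrier by blast
  then show ?thesis using f(2) unfolding cls_def by blast
qed

lemma cls_mem: "entries us \<Longrightarrow> cls us \<in> carrier U"
  unfolding ext2_eq cq.quot_carrier cls_def using free_sum_carrier by blast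

lemma pair_eval_rel:
  assumes \<beta>: "alternating_form V \<beta>" and f: "f \<in> R" shows "pair_eval \<beta> f = 0"
proof -
  let ?K = "{f \<in> carrier F. pair_eval \<beta> f = 0}"
  have K: "ksubspace ?K F"
    by (rule free.ksubspaceI)
      (use free.M.a_closed free.smult_closed in \<open>auto simp: free_simps pair_eval_add pair_eval_scale pair_eval_def[of _ 0] free_carrier\<close>)
  have "ext_relations V \<subseteq> ?K"
  proof
    fix f assume f: "f \<in> ext_relations V"
    then have "pair_eval \<beta> f = 0"
      unfolding ext_relations_def
      by (auto simp: pair_eval_diff pair_eval_single alternating_form_add[OF \<beta>] alternating_form_smult[OF \<beta>]
          alternating_form_self[OF \<beta>])
    then show "f \<in> ?K" using f relations_carrier by blast
  qed
  then have "R \<subseteq> ?K" unfolding ext_rel_space_def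
    by (rule free.span_is_subset) (rule VectorSpace.subspace.submod[OF K])
  then show ?thesis using f by blast
qed

text \<open>The universal property of the exterior square: \<open>\<beta>\<close> kills the
  relations, so evaluating it at an arbitrarily chosen representative is well defined.\<close>

lemma form_functional:
  assumes \<beta>: "alternating_form V \<beta>"
  shows "\<exists>f\<in>carrier (dual U). \<forall>us. entries us \<longrightarrow> f (cls us) = wedge_eval \<beta> us"
proof -
  define r where "r c = (SOME f. f \<in> carrier F \<and> cq.coset f = c)" for c
  define h where "h = (\<lambda>c\<in>carrier U. pair_eval \<beta> (r c))"
  have h: "h (cq.coset f) = pair_eval \<beta> f" if f: "f \<in> carrier F" for f
  proof -
    have r: "r (cq.coset f) \<in> carrier F \<and> cq.coset (r (cq.coset f)) = cq.coset f"
      unfolding r_def by (rule someI[of _ f]) (use f in simp)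
    then have "r (cq.coset f) \<in> cq.coset f" using cq.coset_self by blast
    then obtain s where s: "s \<in> R" "r (cq.coset f) = s + f"
      using cq.mem_coset_iff[OF f] by (auto simp: free_simps)
    have "cq.coset f \<in> carrier U" unfolding ext2_eq cq.quot_carrier using f by blast
    then show ?thesis by (simp add: h_def s(2) pair_eval_add pair_eval_rel[OF \<beta> s(1)])
  qed
  have "h \<in> carrier (dual U)"
    unfolding dual_iff
  proof (intro conjI ballI allI)
    show "h \<in> extensional (carrier U)" by (simp add: h_def)
    show "h (u \<oplus>\<^bsub>U\<^esub> v) = h u + h v" if "u \<in> carrier U" "v \<in> carrier U" for u v
      using that free.M.a_closed unfolding ext2_eq cq.quot_carrier
      by (auto simp: cq.quot_add h) (simp add: free_simps pair_eval_add)
    show "h (c \<odot>\<^bsub>U\<^esub> u) = c * h u" if "u \<in> carrier U" for c u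
      using that free.smult_closed unfolding ext2_eq cq.quot_carrier
      by (auto simp: cq.quot_smult h) (simp add: free_simps pair_eval_scale)
  qed
  moreover have "h (cls us) = wedge_eval \<beta> us" if "entries us" for us
    unfolding cls_def h[OF free_sum_carrier[OF that]] by (rule pair_eval_free_sum)
  ultimately show ?thesis by blast
qed

abbreviation wedge :: "'v \<Rightarrow> 'v \<Rightarrow> (('v \<times> 'v) \<Rightarrow>\<^sub>0 'k) set" where "wedge a b \<equiv> cls [(1, a, b)]"

lemma wedge_mem: "a \<in> carrier V \<Longrightarrow> b \<in> carrier V \<Longrightarrow> wedge a b \<in> carrier U"
  by (rule cls_mem) simp

lemma coset_eq_of_rel:
  assumes "f - g \<in> R" "g \<in> carrier F" shows "cq.coset f = cq.coset g"
  using cq.coset_add_left[OF assms] by (simp add: free_simps)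

lemma cls_Cons:
  assumes "a \<in> carrier V" "b \<in> carrier V" "entries us"
  shows "cls ((c, a, b) # us) = c \<odot>\<^bsub>U\<^esub> wedge a b \<oplus>\<^bsub>U\<^esub> cls us"
proof -
  have g: "gen a b \<in> carrier F" by (rule single_carrier[OF assms(1,2)])
  have "Poly_Mapping.single (a, b) c = c \<odot>\<^bsub>F\<^esub> gen a b" by (simp add: free_simps)
  then show ?thesis
    unfolding cls_def ext2_eq using g free_sum_carrier[OF assms(3)] free.smult_closed[OF _ g, of c]
    by (simp add: cq.quot_smult cq.quot_add free_simps)
qed

lemma wedge_add:
  assumes a: "a \<in> carrier V" and b: "b \<in> carrier V" and u: "u \<in> carrier V"
  shows "wedge (a \<oplus>\<^bsub>V\<^esub> b) u = wedge a u \<oplus>\<^bsub>U\<^esub> wedge b u"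
    and "wedge u (a \<oplus>\<^bsub>V\<^esub> b) = wedge u a \<oplus>\<^bsub>U\<^esub> wedge u b"
proof -
  note g = single_carrier[OF a u] single_carrier[OF b u] single_carrier[OF u a] single_carrier[OF u b]
  have rel: "gen (a \<oplus>\<^bsub>V\<^esub> b) u - (gen a u + gen b u) \<in> R" "gen u (a \<oplus>\<^bsub>V\<^esub> b) - (gen u a + gen u b) \<in> R"
    unfolding diff_diff_eq[symmetric]
    by (intro subsetD[OF relations_subset]; use a b u in \<open>unfold ext_relations_def, blast\<close>)+
  have s: "gen a u + gen b u \<in> carrier F" "gen u a + gen u b \<in> carrier F"
    using free.M.a_closed[OF g(1,2)] free.M.a_closed[OF g(3,4)] by (simp_all add: free_simps)
  show "wedge (a \<oplus>\<^bsub>V\<^esub> b) u = wedge a u \<oplus>\<^bsub>U\<^esub> wedge b u" "wedge u (a \<oplus>\<^bsub>V\<^esub> b) = wedge u a \<oplus>\<^bsub>U\<^esub> wedge u b"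
    unfolding cls_def ext2_eq using coset_eq_of_rel[OF rel(1) s(1)] coset_eq_of_rel[OF rel(2) s(2)] g
    by (simp_all add: cq.quot_add free_simps)
qed

lemma wedge_smult:
  assumes a: "a \<in> carrier V" and u: "u \<in> carrier V"
  shows "wedge (c \<odot>\<^bsub>V\<^esub> a) u = c \<odot>\<^bsub>U\<^esub> wedge a u"
    and "wedge u (c \<odot>\<^bsub>V\<^esub> a) = c \<odot>\<^bsub>U\<^esub> wedge u a"
proof -
  note g = single_carrier[OF a u] single_carrier[OF u a]
  have rel: "gen (c \<odot>\<^bsub>V\<^esub> a) u - Poly_Mapping.single (a, u) c \<in> R" "gen u (c \<odot>\<^bsub>V\<^esub> a) - Poly_Mapping.single (u, a) c \<in> R"
    by (intro subsetD[OF relations_subset]; use a u in \<open>unfold ext_relations_def, blast\<close>)+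
  show "wedge (c \<odot>\<^bsub>V\<^esub> a) u = c \<odot>\<^bsub>U\<^esub> wedge a u" "wedge u (c \<odot>\<^bsub>V\<^esub> a) = c \<odot>\<^bsub>U\<^esub> wedge u a"
    unfolding cls_def ext2_eq using coset_eq_of_rel[OF rel(1) g(1)] coset_eq_of_rel[OF rel(2) g(2)] g
    by (simp_all add: cq.quot_smult free_simps)
qed

lemma wedge_self: assumes a: "a \<in> carrier V" shows "wedge a a = \<zero>\<^bsub>U\<^esub>"
proof -
  have "gen a a \<in> R"
    by (intro subsetD[OF relations_subset]) (use a in \<open>unfold ext_relations_def, blast\<close>)
  from cq.coset_subset[OF this] show ?thesis unfolding cls_def ext2_eq cq.quot_zero by simp
qed

lemmas wedge_bilinear = wedge_add wedge_smult wedge_self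

lemma functional_form:
  assumes f: "f \<in> carrier (dual U)" shows "alternating_form V (\<lambda>a b. f (wedge a b))"
proof -
  interpret E: kspace U by (rule kspace.intro) (rule ext_vectorspace)
  show ?thesis
    unfolding alternating_form_def
  proof (intro conjI ballI allI)
    fix a b u c assume a: "a \<in> carrier V" and u: "u \<in> carrier V"
    show "f (wedge (a \<oplus>\<^bsub>V\<^esub> b) u) = f (wedge a u) + f (wedge b u)"
      "f (wedge u (a \<oplus>\<^bsub>V\<^esub> b)) = f (wedge u a) + f (wedge u b)" if "b \<in> carrier V"
      unfolding wedge_add[OF a that u] by (intro dual_add[OF f] wedge_mem a u that)+
    show "f (wedge (c \<odot>\<^bsub>V\<^esub> a) u) = c * f (wedge a u)" "f (wedge u (c \<odot>\<^bsub>V\<^esub> a)) = c * f (wedge u a)"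
      unfolding wedge_smult[OF a u] by (intro dual_smult[OF f] wedge_mem a u)+
    show "f (wedge a a) = 0" unfolding wedge_self[OF a] by (rule E.dual_zero_arg[OF f])
  qed
qed

text \<open>With \<open>form_functional\<close>, this identifies functionals on the exterior square
  with alternating forms and reduces computations with classes to lists.\<close>

lemma functional_cls:
  assumes f: "f \<in> carrier (dual U)" and us: "entries us"
  shows "f (cls us) = wedge_eval (\<lambda>a b. f (wedge a b)) us"
proof -
  interpret E: kspace U by (rule kspace.intro) (rule ext_vectorspace)
  from us show ?thesis
  proof (induction us)
    case Nil
    have "cls [] = \<zero>\<^bsub>U\<^esub>"
      unfolding cls_def ext2_eq cq.quot_zero using cq.coset_subset[OF free.ksubspace_zero[OF R_ksubspace]]
      by (simp add: free_simps)
    then show ?case by (simp add: E.dual_zero_arg[OF f])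
  next
    case (Cons u us)
    then obtain c a b where u: "u = (c, a, b)" "a \<in> carrier V" "b \<in> carrier V" "entries us" by auto
    have "f (cls (u # us)) = c * f (wedge a b) + f (cls us)"
      unfolding u(1) cls_Cons[OF u(2-4)] using wedge_mem[OF u(2,3)] cls_mem[OF u(4)]
      by (simp add: dual_add[OF f] dual_smult[OF f])
    then show ?case using Cons.IH[OF u(4)] by (simp add: u(1))
  qed
qed

text \<open>The wedges of a finite spanning set span, by linearity in one argument at a
  time.\<close>

lemma ext_fin_dim: "vectorspace.fin_dim class_ring U"
proof -
  interpret E: kspace U by (rule kspace.intro) (rule ext_vectorspace)
  obtain B where B: "finite B" "B \<subseteq> carrier V" "span B = carrier V" using fin_dim unfolding fin_dim_def by blast
  let ?G = "(\<lambda>(a, b). wedge a b) ` (B \<times> B)"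
  have G: "?G \<subseteq> carrier U" using B(2) wedge_mem by auto
  have T: "ksubspace (E.span ?G) U" by (rule E.span_is_subspace[OF G])
  have all: "carrier V \<subseteq> N" if N: "ksubspace N V" "B \<subseteq> N" for N
    using span_is_subset[OF N(2) VectorSpace.subspace.submod[OF N(1)]] B(3) by simp
  have l: "(\<lambda>a. wedge a b) \<in> linear_hom V U" "(\<lambda>a. wedge b a) \<in> linear_hom V U"
    if "b \<in> carrier V" for b
    using that by (auto simp: linear_hom_iff wedge_bilinear wedge_mem)
  have 1: "wedge a b \<in> E.span ?G" if a: "a \<in> carrier V" and b: "b \<in> B" for a b
  proof -
    have "carrier V \<subseteq> {a \<in> carrier V. wedge a b \<in> E.span ?G}"
      using b B(2) E.in_own_span[OF G] by (intro all preimage_ksubspace[OF ext_vectorspace l(1) T]) auto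
    then show ?thesis using a by blast
  qed
  have 2: "wedge a b \<in> E.span ?G" if a: "a \<in> carrier V" and b: "b \<in> carrier V" for a b
  proof -
    have "carrier V \<subseteq> {b \<in> carrier V. wedge a b \<in> E.span ?G}"
      using a B(2) 1[OF a] by (intro all preimage_ksubspace[OF ext_vectorspace l(2) T]) auto
    then show ?thesis using b by blast
  qed
  have "cls us \<in> E.span ?G" if "entries us" for us
    using that
  proof (induction us)
    case Nil
    have "cls [] = \<zero>\<^bsub>U\<^esub>"
      unfolding cls_def ext2_eq cq.quot_zero using cq.coset_subset[OF free.ksubspace_zero[OF R_ksubspace]]
      by (simp add: free_simps)
    then show ?case using E.ksubspace_zero[OF T] by simp
  next
    case (Cons u us)
    then obtain c a b where u: "u = (c, a, b)" "a \<in> carrier V" "b \<in> carrier V" "entries us" by auto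
    show ?case
      unfolding u(1) cls_Cons[OF u(2-4)]
      by (intro E.ksubspace_add[OF T] E.ksubspace_smult[OF T] 2 u Cons.IH)
  qed
  then have "carrier U \<subseteq> E.span ?G" using cls_exists by blast
  then have "E.span ?G = carrier U" using E.ksubspace_subset[OF T] by blast
  then show ?thesis unfolding E.fin_dim_def using B(1) G by (intro exI[of _ ?G] conjI) auto
qed

end

section \<open>The action of linear maps on the exterior square\<close>

context ext_square
begin

lemma ext_coordinates_exist: "\<exists>A C D. coordinates U A C D"
  by (rule coordinates_exist[OF ext_vectorspace ext_fin_dim])

text \<open>The dual separates points; equality of classes can thus be checked on alternating
  forms.\<close>

lemma ext_eqI:
  assumes "u \<in> carrier U" "v \<in> carrier U"
    "\<And>f. f \<in> carrier (dual U) \<Longrightarrow> f u = f v"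
  shows "u = v"
proof -
  obtain A' C' D' where "coordinates U A' C' D'" using ext_coordinates_exist by blast
  then interpret E: coordinates U A' C' D' .
  let ?w = "u \<oplus>\<^bsub>U\<^esub> (- 1) \<odot>\<^bsub>U\<^esub> v"
  have "?w = \<zero>\<^bsub>U\<^esub>"
  proof (rule E.separating)
    show "?w \<in> carrier U" using assms(1,2) by simp
    fix f assume f: "f \<in> carrier (dual U)"
    have "(- 1) \<odot>\<^bsub>U\<^esub> v \<in> carrier U" using assms(2) by simp
    from dual_add[OF f assms(1) this] show "f ?w = 0"
      using assms(3)[OF f] by (simp add: dual_smult[OF f assms(2)])
  qed
  then have "u \<ominus>\<^bsub>U\<^esub> v = \<zero>\<^bsub>U\<^esub>" using E.a_minus_eq[OF assms(1,2)] by simp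
  then show ?thesis using assms(1,2) by simp
qed

lemma entries_wedge_act: "x \<in> carrier V \<rightarrow> carrier V \<Longrightarrow> entries us \<Longrightarrow> entries (wedge_act x us)"
  by (auto simp: wedge_act_def)

lemma alternating_form_act:
  assumes \<beta>: "alternating_form V \<beta>" and x: "x \<in> linear_hom V V"
  shows "alternating_form V (\<lambda>a b. \<beta> (x a) b + \<beta> a (x b))"
  unfolding alternating_form_def
proof (intro conjI ballI allI)
  fix a b u c assume a: "a \<in> carrier V" and u: "u \<in> carrier V"
  note xm = linear_hom_mem[OF x a] linear_hom_mem[OF x u]
  show "\<beta> (x (a \<oplus>\<^bsub>V\<^esub> b)) u + \<beta> (a \<oplus>\<^bsub>V\<^esub> b) (x u) = (\<beta> (x a) u + \<beta> a (x u)) + (\<beta> (x b) u + \<beta> b (x u))"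
    "\<beta> (x u) (a \<oplus>\<^bsub>V\<^esub> b) + \<beta> u (x (a \<oplus>\<^bsub>V\<^esub> b)) = (\<beta> (x u) a + \<beta> u (x a)) + (\<beta> (x u) b + \<beta> u (x b))"
    if b: "b \<in> carrier V"
    using a u b xm linear_hom_mem[OF x b]
    by (simp_all add: linear_hom_add[OF x] alternating_form_add[OF \<beta>])
  show "\<beta> (x (c \<odot>\<^bsub>V\<^esub> a)) u + \<beta> (c \<odot>\<^bsub>V\<^esub> a) (x u) = c * (\<beta> (x a) u + \<beta> a (x u))"
    "\<beta> (x u) (c \<odot>\<^bsub>V\<^esub> a) + \<beta> u (x (c \<odot>\<^bsub>V\<^esub> a)) = c * (\<beta> (x u) a + \<beta> u (x a))"
    using a u xm by (simp_all add: linear_hom_smult[OF x] alternating_form_smult[OF \<beta>] ring_distribs)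
  show "\<beta> (x a) a + \<beta> a (x a) = 0"
    using alternating_form_skew[OF vectorspace_axioms \<beta> a xm(1)] by simp
qed

lemma wedge_eval_act:
  "wedge_eval \<beta> (wedge_act x us) = wedge_eval (\<lambda>a b. \<beta> (x a) b + \<beta> a (x b)) us"
proof (induction us)
  case (Cons u us)
  then show ?case by (cases u) (simp add: ring_distribs)
qed simp

lemma free_lie_act_hom:
  assumes x: "x \<in> carrier V \<rightarrow> carrier V" shows "free_lie_act x \<in> linear_hom F F"
proof -
  have "free_lie_act x f \<in> carrier F" if f: "f \<in> carrier F" for f
  proof -
    obtain us where us: "entries us" "f = free_sum us"
      using f free_sum_exists[of f "carrier V"] unfolding free_carrier by blast
    show ?thesis unfolding us(2) free_lie_act_free_sum
      by (rule free_sum_carrier[OF entries_wedge_act[OF x us(1)]])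
  qed
  then show ?thesis by (auto simp: linear_hom_iff free_simps free_lie_act_add free_lie_act_scale)
qed

text \<open>Avoids going through the kinds of relations: a functional at the class of
  \<open>x f\<close> is the value at \<open>f\<close> of another alternating form, which is 0 on
  relations, and functionals separate classes.\<close>

lemma free_lie_act_rel:
  assumes x: "x \<in> linear_hom V V" shows "free_lie_act x ` R \<subseteq> R"
proof
  fix g assume "g \<in> free_lie_act x ` R"
  then obtain f where f: "f \<in> R" "g = free_lie_act x f" by blast
  have xV: "x \<in> carrier V \<rightarrow> carrier V" using linear_hom_mem[OF x] by blast
  have "f \<in> carrier F" using f(1) free.ksubspace_subset[OF R_ksubspace] by blast
  then obtain us where us: "entries us" "f = free_sum us"
    using free_sum_exists[of f "carrier V"] unfolding free_carrier by blast
  have g: "g = free_sum (wedge_act x us)" unfolding f(2) us(2) by (rule free_lie_act_free_sum)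
  have ent: "entries (wedge_act x us)" by (rule entries_wedge_act[OF xV us(1)])
  have "cls (wedge_act x us) = cls []"
  proof (rule ext_eqI)
    show "cls (wedge_act x us) \<in> carrier U" "cls [] \<in> carrier U"
      using ent by (auto intro!: cls_mem)
    fix h assume h: "h \<in> carrier (dual U)"
    let ?b = "\<lambda>a b. h (wedge a b)"
    have "h (cls (wedge_act x us)) = wedge_eval ?b (wedge_act x us)" by (rule functional_cls[OF h ent])
    also have "\<dots> = pair_eval (\<lambda>a b. ?b (x a) b + ?b a (x b)) f"
      unfolding wedge_eval_act us(2) by (rule pair_eval_free_sum[symmetric])
    also have "\<dots> = 0" by (rule pair_eval_rel[OF alternating_form_act[OF functional_form[OF h] x] f(1)])
    also have "0 = h (cls [])" using functional_cls[OF h, of "[]"] by simp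
    finally show "h (cls (wedge_act x us)) = h (cls [])" .
  qed
  then have "cq.coset g = R"
    unfolding cls_def g[symmetric] using cq.coset_subset[OF free.ksubspace_zero[OF R_ksubspace]]
    by (simp add: free_simps)
  then show "g \<in> R" using cq.coset_eq_S_iff[of g] free_sum_carrier[OF ent] unfolding g by blast
qed

lemma ext2_lie_act_cls:
  assumes x: "x \<in> linear_hom V V" and us: "entries us"
  shows "act x (cls us) = cls (wedge_act x us)"
proof -
  have xV: "x \<in> carrier V \<rightarrow> carrier V" using linear_hom_mem[OF x] by blast
  show ?thesis
    unfolding ext2_lie_act_def cls_def free_lie_act_free_sum[symmetric]
    by (rule cq.quot_act_coset[where act = free_lie_act and x = x,
        OF free_lie_act_hom[OF xV] free_lie_act_rel[OF x] free_sum_carrier[OF us]])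
qed

lemma functional_act:
  assumes "f \<in> carrier (dual U)" "x \<in> linear_hom V V" "entries us"
  shows "f (act x (cls us)) = wedge_eval (\<lambda>a b. f (wedge a b)) (wedge_act x us)"
proof -
  have "x \<in> carrier V \<rightarrow> carrier V" using linear_hom_mem[OF assms(2)] by blast
  then show ?thesis
    using ext2_lie_act_cls[OF assms(2,3)] functional_cls[OF assms(1) entries_wedge_act[OF _ assms(3)]] by simp
qed

lemma ext2_lie_act_mem:
  assumes "x \<in> linear_hom V V" "u \<in> carrier U" shows "act x u \<in> carrier U"
proof -
  obtain us where us: "entries us" "u = cls us" using cls_exists[OF assms(2)] by blast
  have "x \<in> carrier V \<rightarrow> carrier V" using linear_hom_mem[OF assms(1)] by blast
  then show ?thesis unfolding us(2) ext2_lie_act_cls[OF assms(1) us(1)] by (intro cls_mem entries_wedge_act us(1))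
qed

lemma ext2_lie_act_hom:
  assumes x: "x \<in> linear_hom V V" shows "act x \<in> linear_hom U U"
proof -
  interpret E: kspace U by (rule kspace.intro) (rule ext_vectorspace)
  have xV: "x \<in> carrier V \<rightarrow> carrier V" using linear_hom_mem[OF x] by blast
  note h = free_lie_act_hom[OF xV] and r = free_lie_act_rel[OF x]
  note ac = cq.quot_act_coset[where act = free_lie_act and x = x, OF h r, folded ext2_lie_act_def]
  show ?thesis
    unfolding linear_hom_iff
  proof (intro conjI ballI allI)
    show "act x \<in> carrier U \<rightarrow> carrier U" using ext2_lie_act_mem[OF x] by blast
    fix u v c assume u: "u \<in> carrier U"
    obtain f where f: "f \<in> carrier F" "u = cq.coset f" using u unfolding ext2_eq cq.quot_carrier by blast
    note hf = linear_hom_mem[OF h f(1)]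
    show "act x (c \<odot>\<^bsub>U\<^esub> u) = c \<odot>\<^bsub>U\<^esub> act x u"
      unfolding f(2) ext2_eq using f(1) hf
      by (simp add: cq.quot_smult ac linear_hom_smult[OF h])
    assume v: "v \<in> carrier U"
    obtain g where g: "g \<in> carrier F" "v = cq.coset g" using v unfolding ext2_eq cq.quot_carrier by blast
    show "act x (u \<oplus>\<^bsub>U\<^esub> v) = act x u \<oplus>\<^bsub>U\<^esub> act x v"
      unfolding f(2) g(2) ext2_eq using f(1) g(1) hf linear_hom_mem[OF h g(1)]
      by (simp add: cq.quot_add ac linear_hom_add[OF h])
  qed
qed

end

section \<open>The symplectic Lie algebra\<close>

locale symplectic = ext_square V A C D for V :: "('k::{alg_closed_field,field_char_0}, 'v) module" and A C D +
  fixes \<omega> :: "'v \<Rightarrow> 'v \<Rightarrow> 'k"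
  assumes form: "symplectic_form V \<omega>"
begin

lemma om_add_left: "a \<in> carrier V \<Longrightarrow> b \<in> carrier V \<Longrightarrow> u \<in> carrier V \<Longrightarrow> \<omega> (a \<oplus>\<^bsub>V\<^esub> b) u = \<omega> a u + \<omega> b u"
  and om_smult_left: "a \<in> carrier V \<Longrightarrow> u \<in> carrier V \<Longrightarrow> \<omega> (c \<odot>\<^bsub>V\<^esub> a) u = c * \<omega> a u"
  and om_anti: "a \<in> carrier V \<Longrightarrow> u \<in> carrier V \<Longrightarrow> \<omega> a u = - \<omega> u a"
  and om_nondeg: "a \<in> carrier V \<Longrightarrow> (\<And>u. u \<in> carrier V \<Longrightarrow> \<omega> a u = 0) \<Longrightarrow> a = \<zero>\<^bsub>V\<^esub>"
proof -
  have h: "(\<lambda>u. \<omega> u v) \<in> linear_hom V scalars" if "v \<in> carrier V" for v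
    using form that by (simp add: symplectic_form_def)
  show "\<omega> (a \<oplus>\<^bsub>V\<^esub> b) u = \<omega> a u + \<omega> b u" if "a \<in> carrier V" "b \<in> carrier V" "u \<in> carrier V" for a b u
    using linear_hom_add[OF h[OF that(3)] that(1,2)] by (simp add: scalars_def)
  show "\<omega> (c \<odot>\<^bsub>V\<^esub> a) u = c * \<omega> a u" if "a \<in> carrier V" "u \<in> carrier V" for a u c
    using linear_hom_smult[OF h[OF that(2)] that(1)] by (simp add: scalars_def)
  show "\<omega> a u = - \<omega> u a" if "a \<in> carrier V" "u \<in> carrier V" for a u
    using form that unfolding symplectic_form_def by blast
  show "a = \<zero>\<^bsub>V\<^esub>" if "a \<in> carrier V" "\<And>u. u \<in> carrier V \<Longrightarrow> \<omega> a u = 0" for a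
  proof -
    have "\<forall>v\<in>carrier V. (\<forall>w\<in>carrier V. \<omega> v w = 0) \<longrightarrow> v = \<zero>\<^bsub>V\<^esub>"
      using form unfolding symplectic_form_def by (elim conjE)
    then show ?thesis using that by blast
  qed
qed

lemma om_add_right: "a \<in> carrier V \<Longrightarrow> b \<in> carrier V \<Longrightarrow> u \<in> carrier V \<Longrightarrow> \<omega> u (a \<oplus>\<^bsub>V\<^esub> b) = \<omega> u a + \<omega> u b"
  by (simp only: om_anti[of u] om_add_left M.a_closed minus_add_distrib)

lemma om_smult_right: "a \<in> carrier V \<Longrightarrow> u \<in> carrier V \<Longrightarrow> \<omega> u (c \<odot>\<^bsub>V\<^esub> a) = c * \<omega> u a"
  by (simp only: om_anti[of u] om_smult_left smult_closed UNIV_I mult_minus_right partial_object.simps)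

abbreviation sp where "sp \<equiv> sp_algebra V \<omega>"

lemma sp_hom: "x \<in> sp \<Longrightarrow> x \<in> linear_hom V V"
  by (simp add: sp_algebra_def endos_def)

lemma sp_skew: "x \<in> sp \<Longrightarrow> a \<in> carrier V \<Longrightarrow> b \<in> carrier V \<Longrightarrow> \<omega> (x a) b = - \<omega> a (x b)"
  by (simp add: sp_algebra_def eq_neg_iff_add_eq_0)

lemma spI:
  assumes "x \<in> linear_hom V V" "\<And>a b. a \<in> carrier V \<Longrightarrow> b \<in> carrier V \<Longrightarrow> \<omega> (x a) b = - \<omega> a (x b)"
  shows "restrict x (carrier V) \<in> sp"
  unfolding sp_algebra_def endos_def
proof (intro CollectI conjI IntI ballI)
  show "restrict x (carrier V) \<in> linear_hom V V" using assms(1) by (auto simp: linear_hom_iff)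
  show "\<omega> (restrict x (carrier V) v) w + \<omega> v (restrict x (carrier V) w) = 0"
    if "v \<in> carrier V" "w \<in> carrier V" for v w
    using assms(2)[OF that] that by simp
qed simp

lemma ext2_lie_act_eqI:
  assumes x: "x \<in> linear_hom V V" and u: "u \<in> carrier U" and w: "w \<in> carrier U"
    and h: "\<And>f us. f \<in> carrier (dual U) \<Longrightarrow> entries us \<Longrightarrow> u = cls us \<Longrightarrow>
      wedge_eval (\<lambda>a b. f (wedge a b)) (wedge_act x us) = f w"
  shows "act x u = w"
proof -
  obtain us where us: "entries us" "u = cls us" using cls_exists[OF u] by blast
  show ?thesis
  proof (rule ext_eqI)
    show "act x u \<in> carrier U" by (rule ext2_lie_act_mem[OF x u])
    show "f (act x u) = f w" if "f \<in> carrier (dual U)" for f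
      using functional_act[OF that x us(1)] h[OF that us] us(2) by simp
  qed (rule w)
qed

lemma wedge_act_zero:
  assumes "alternating_form V \<beta>" "entries us"
  shows "wedge_eval \<beta> (wedge_act (\<lambda>a\<in>carrier V. \<zero>\<^bsub>V\<^esub>) us) = 0"
  using assms(2)
proof (induction us)
  case (Cons u us)
  have "\<beta> \<zero>\<^bsub>V\<^esub> a = 0" "\<beta> a \<zero>\<^bsub>V\<^esub> = 0" if "a \<in> carrier V" for a
    using alternating_form_smult[OF assms(1) M.zero_closed that, of 0] smult_zero_left[OF M.zero_closed] by simp_all
  then show ?case using Cons by auto
qed simp

lemma wedge_act_sum:
  assumes \<beta>: "alternating_form V \<beta>" and xy: "x \<in> linear_hom V V" "y \<in> linear_hom V V" and us: "entries us"
  shows "wedge_eval \<beta> (wedge_act (\<lambda>a\<in>carrier V. x a \<oplus>\<^bsub>V\<^esub> y a) us) =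
      wedge_eval \<beta> (wedge_act x us) + wedge_eval \<beta> (wedge_act y us)" (is ?add)
    and "wedge_eval \<beta> (wedge_act (\<lambda>a\<in>carrier V. c \<odot>\<^bsub>V\<^esub> x a) us) = c * wedge_eval \<beta> (wedge_act x us)" (is ?smult)
    and "wedge_eval \<beta> (wedge_act (\<lambda>a\<in>carrier V. x (y a) \<oplus>\<^bsub>V\<^esub> (- 1) \<odot>\<^bsub>V\<^esub> y (x a)) us) =
      wedge_eval \<beta> (wedge_act x (wedge_act y us)) - wedge_eval \<beta> (wedge_act y (wedge_act x us))" (is ?br)
proof -
  note m = linear_hom_mem[OF xy(1)] linear_hom_mem[OF xy(2)]
  note s = alternating_form_add[OF \<beta>] alternating_form_smult[OF \<beta>]
  show ?add using us by (induction us) (auto simp: s m algebra_simps)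
  show ?smult using us by (induction us) (auto simp: s m algebra_simps)
  show ?br using us by (induction us) (auto simp: s m algebra_simps)
qed

lemma sp_closed:
  assumes "x \<in> sp" "y \<in> sp"
  shows "(\<lambda>a\<in>carrier V. \<zero>\<^bsub>V\<^esub>) \<in> sp" "(\<lambda>a\<in>carrier V. x a \<oplus>\<^bsub>V\<^esub> y a) \<in> sp"
    "(\<lambda>a\<in>carrier V. c \<odot>\<^bsub>V\<^esub> x a) \<in> sp" "(\<lambda>a\<in>carrier V. x (y a) \<oplus>\<^bsub>V\<^esub> (- 1) \<odot>\<^bsub>V\<^esub> y (x a)) \<in> sp"
proof -
  note h = sp_hom[OF assms(1)] sp_hom[OF assms(2)]
  note m = linear_hom_mem[OF h(1)] linear_hom_mem[OF h(2)]
  note l = linear_hom_add[OF h(1)] linear_hom_add[OF h(2)] linear_hom_smult[OF h(1)] linear_hom_smult[OF h(2)]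
  note sk = sp_skew[OF assms(1)] sp_skew[OF assms(2)]
  note o = om_add_left om_add_right om_smult_left om_smult_right
  have sa: "c \<odot>\<^bsub>V\<^esub> (a \<oplus>\<^bsub>V\<^esub> b) = c \<odot>\<^bsub>V\<^esub> a \<oplus>\<^bsub>V\<^esub> c \<odot>\<^bsub>V\<^esub> b"
    if "a \<in> carrier V" "b \<in> carrier V" for a b c
    using that smult_r_distr[of c a b] by simp
  have sc: "c \<odot>\<^bsub>V\<^esub> (d \<odot>\<^bsub>V\<^esub> a) = d \<odot>\<^bsub>V\<^esub> (c \<odot>\<^bsub>V\<^esub> a)" if "a \<in> carrier V" for a c d
    using that smult_assoc1[of c d a] smult_assoc1[of d c a] by (simp add: mult.commute)
  have oz: "\<omega> \<zero>\<^bsub>V\<^esub> u = 0" "\<omega> u \<zero>\<^bsub>V\<^esub> = 0" if "u \<in> carrier V" for u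
    using om_smult_left[OF M.zero_closed that, of 0] om_smult_right[OF M.zero_closed that, of 0]
      smult_zero_left[OF M.zero_closed] by simp_all
  note sm = sa sc
  have z: "c \<odot>\<^bsub>V\<^esub> \<zero>\<^bsub>V\<^esub> = \<zero>\<^bsub>V\<^esub>" for c using rmult_0[of c] by simp
  show "(\<lambda>a\<in>carrier V. \<zero>\<^bsub>V\<^esub>) \<in> sp"
    by (rule spI)
      (auto simp: linear_hom_iff z oz)
  show "(\<lambda>a\<in>carrier V. x a \<oplus>\<^bsub>V\<^esub> y a) \<in> sp"
    by (rule spI) (auto simp: linear_hom_iff m l sm M.a_ac o sk)
  show "(\<lambda>a\<in>carrier V. c \<odot>\<^bsub>V\<^esub> x a) \<in> sp"
    by (rule spI) (auto simp: linear_hom_iff m l sm o sk)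
  show "(\<lambda>a\<in>carrier V. x (y a) \<oplus>\<^bsub>V\<^esub> (- 1) \<odot>\<^bsub>V\<^esub> y (x a)) \<in> sp"
    by (rule spI) (auto simp: linear_hom_iff m l sm M.a_ac o sk)
qed

end

section \<open>The exterior square of a symplectic space\<close>

context symplectic
begin

definition om' :: "('v \<Rightarrow> 'k) \<Rightarrow> ('v \<Rightarrow> 'k) \<Rightarrow> 'k" where
  "om' f g = \<omega> (D f) (D g)"

lemma om'_skew_space: "skew_space fun_scale om'"
proof (intro skew_space.intro skew_space_axioms.intro fs.char0_space_axioms)
  show "om' (x + y) z = om' x z + om' y z" for x y z
    unfolding om'_def D_add by (rule om_add_left[OF D_mem D_mem D_mem])
  show "om' (fun_scale c x) z = c * om' x z" for c x z
    unfolding om'_def D_scale by (rule om_smult_left[OF D_mem D_mem])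
  show "om' x y = - om' y x" for x y
    unfolding om'_def by (rule om_anti[OF D_mem D_mem])
qed

interpretation sk: skew_space fun_scale om' by (rule om'_skew_space)

abbreviation S where "S \<equiv> C ` carrier V"

lemma S_subspace: "fs.subspace S"
  by (rule C_image_subspace[OF carrier_subspace])

lemma CD_S: "f \<in> S \<Longrightarrow> C (D f) = f"
  using DC by auto

lemma S_nondeg: "sk.nondeg S"
  unfolding sk.nondeg_def
proof (intro ballI impI)
  fix x assume x: "x \<in> S" "\<forall>y\<in>S. om' x y = 0"
  have "D x = \<zero>\<^bsub>V\<^esub>"
  proof (rule om_nondeg[OF D_mem])
    fix u assume u: "u \<in> carrier V"
    then have "om' x (C u) = 0" using x(2) by blast
    then show "\<omega> (D x) u = 0" by (simp add: om'_def DC[OF u])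
  qed
  then show "x = 0" using CD_S[OF x(1)] C_zero by simp
qed

definition lift :: "('k \<times> 'v \<times> 'v) list \<Rightarrow> ('k \<times> ('v \<Rightarrow> 'k) \<times> ('v \<Rightarrow> 'k)) list" where
  "lift us = map (\<lambda>(c, a, b). (c, C a, C b)) us"

definition lower :: "('k \<times> ('v \<Rightarrow> 'k) \<times> ('v \<Rightarrow> 'k)) list \<Rightarrow> ('k \<times> 'v \<times> 'v) list" where
  "lower us = map (\<lambda>(c, a, b). (c, D a, D b)) us"

lemma lift_lower_simps [simp]:
  "lift [] = []" "lift ((c, a, b) # us) = (c, C a, C b) # lift us"
  "lower [] = []" "lower ((c, f, g) # vs2) = (c, D f, D g) # lower vs2"
  by (simp_all add: lift_def lower_def)

lemma lift_entries: "entries us \<Longrightarrow> set (lift us) \<subseteq> UNIV \<times> S \<times> S"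
  by (auto simp: lift_def)

lemma lower_entries: "entries (lower us)"
  using D_mem by (auto simp: lower_def)

definition lower_form :: "('v \<Rightarrow> 'v \<Rightarrow> 'k) \<Rightarrow> ('v \<Rightarrow> 'k) \<Rightarrow> ('v \<Rightarrow> 'k) \<Rightarrow> 'k" where
  "lower_form \<beta> f g = \<beta> (D f) (D g)"

lemma lower_form_alternating:
  assumes \<beta>: "alternating_form V \<beta>" shows "sk.alternating (lower_form \<beta>)"
  unfolding sk.alternating_def
proof (intro conjI allI)
  show "fs.linf (\<lambda>a. lower_form \<beta> a b)" for b
    by (rule fs.linfI) (simp_all only: lower_form_def D_add D_scale
        alternating_form_add[OF \<beta> D_mem D_mem D_mem] alternating_form_smult[OF \<beta> D_mem D_mem])
  show "lower_form \<beta> a b = - lower_form \<beta> b a" for a b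
    unfolding lower_form_def by (rule alternating_form_skew[OF vectorspace_axioms \<beta> D_mem D_mem])
qed

lemma wedge_eval_lift:
  assumes x: "\<And>a. a \<in> carrier V \<Longrightarrow> D (y (C a)) = x a" and us: "entries us"
  shows "wedge_eval (lower_form \<beta>) (wedge_act y (lift us)) = wedge_eval \<beta> (wedge_act x us)"
  using us
proof (induction us)
  case (Cons u us)
  then obtain c a b where u: "u = (c, a, b)" "a \<in> carrier V" "b \<in> carrier V" "entries us" by auto
  show ?case using Cons.IH[OF u(4)] by (simp add: u(1) lower_form_def x[OF u(2)] x[OF u(3)] DC u(2,3))
qed simp

lemma wedge_eval_lower:
  assumes x: "\<And>f. f \<in> S \<Longrightarrow> x (D f) = D (y f)" and us: "set us \<subseteq> UNIV \<times> S \<times> S"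
  shows "wedge_eval (lower_form \<beta>) (wedge_act y us) = wedge_eval \<beta> (wedge_act x (lower us))"
  using us
proof (induction us)
  case (Cons u us)
  then obtain c f g where u: "u = (c, f, g)" "f \<in> S" "g \<in> S" "set us \<subseteq> UNIV \<times> S \<times> S" by auto
  show ?case using Cons.IH[OF u(4)] by (simp add: u(1) lower_form_def x[OF u(2)] x[OF u(3)])
qed simp

lemma lower_op_sp:
  assumes y: "sk.skew_adjoint y" shows "(\<lambda>a\<in>carrier V. D (y (C a))) \<in> sp"
proof (rule spI)
  have l: "fs.lin y" and sk: "\<And>f g. om' (y f) g = - om' f (y g)" using y by (auto simp: sk.skew_adjoint_def)
  show "(\<lambda>a. D (y (C a))) \<in> linear_hom V V"
    unfolding linear_hom_iff
  proof (intro conjI ballI allI)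
    show "(\<lambda>a. D (y (C a))) \<in> carrier V \<rightarrow> carrier V" using D_mem by blast
    fix a b c assume a: "a \<in> carrier V"
    show "D (y (C (c \<odot>\<^bsub>V\<^esub> a))) = c \<odot>\<^bsub>V\<^esub> D (y (C a))"
      unfolding C_scale[OF a] fs.lin_scale[OF l] by (rule D_scale)
    assume b: "b \<in> carrier V"
    show "D (y (C (a \<oplus>\<^bsub>V\<^esub> b))) = D (y (C a)) \<oplus>\<^bsub>V\<^esub> D (y (C b))"
      unfolding C_add[OF a b] fs.lin_add[OF l] by (rule D_add)
  qed
  show "\<omega> (D (y (C a))) b = - \<omega> a (D (y (C b)))" if "a \<in> carrier V" "b \<in> carrier V" for a b
    using sk[of "C a" "C b"] that by (simp add: om'_def DC)
qed

lemma lift_op_skew_adjoint: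
  assumes x: "x \<in> sp" shows "sk.skew_adjoint (\<lambda>f. C (x (D f)))"
proof (rule sk.skew_adjointI)
  note h = sp_hom[OF x]
  note m = linear_hom_mem[OF h D_mem]
  show "fs.lin (\<lambda>f. C (x (D f)))"
    by (rule fs.linI) (simp_all only: D_add D_scale linear_hom_add[OF h D_mem D_mem]
        linear_hom_smult[OF h D_mem] C_add[OF m m] C_scale[OF m])
  show "om' (C (x (D f))) g = - om' f (C (x (D g)))" for f g
    unfolding om'_def DC[OF m] by (rule sp_skew[OF x D_mem D_mem])
qed

lemma self_adjoint_op_of: "entries us \<Longrightarrow> self_adjoint_op fun_scale om' (sk.op_of (lift us)) S"
  by (intro self_adjoint_op.intro self_adjoint_op_axioms.intro om'_skew_space sk.op_of_self_adjoint
      S_subspace fin_span_C S_nondeg image_subsetI sk.op_of_mem lift_entries)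

text \<open>Supplies hypothesis \<open>B\<close> of \<open>ind_stabiliser_eq\<close> by carrying
  \<open>generic_wedge\<close>, for the operator of \<open>v\<close>, from coordinates back to
  \<open>V\<close>.\<close>

lemma generic_direction:
  assumes v: "v \<in> carrier U"
  shows "\<exists>u\<in>carrier U. \<exists>P\<subseteq>carrier U. finite P \<and> card P \<le> kdim V div 2 \<and>
    (\<forall>f\<in>carrier (dual U). (\<forall>x\<in>sp. f (act x v) = 0) \<and>
      (\<forall>x\<in>lie_stabiliser sp act U v. f (act x u) = 0) \<and>
      (\<forall>p\<in>P. f p = 0) \<longrightarrow> (\<forall>w\<in>carrier U. f w = 0))"
proof -
  interpret E: kspace U by (rule kspace.intro) (rule ext_vectorspace)
  obtain us where us: "entries us" "v = cls us" using cls_exists[OF v] by blast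
  let ?e = "sk.op_of (lift us)"
  have le: "set (lift us) \<subseteq> UNIV \<times> S \<times> S" by (rule lift_entries[OF us(1)])
  obtain ws P where ws: "set ws \<subseteq> UNIV \<times> S \<times> S" and P: "finite P" "P \<subseteq> S \<times> S" "2 * card P \<le> fs.dim S"
    and gen: "\<forall>\<beta>. sk.alternating \<beta> \<and> (\<forall>a\<in>S. \<forall>b\<in>S. \<beta> (?e a) b = \<beta> a (?e b)) \<and>
      (\<forall>x. sk.skew_adjoint x \<longrightarrow> (\<forall>a. x (?e a) = ?e (x a)) \<longrightarrow> range x \<subseteq> S \<longrightarrow>
        wedge_eval \<beta> (wedge_act x ws) = 0) \<and>
      (\<forall>(p, q)\<in>P. \<beta> p q = 0) \<longrightarrow> (\<forall>a\<in>S. \<forall>b\<in>S. \<beta> a b = 0)"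
    using sk.generic_wedge[OF self_adjoint_op_of[OF us(1)]] by (elim exE conjE) (rule that)
  let ?P = "(\<lambda>(p, q). wedge (D p) (D q)) ` P"
  show ?thesis
  proof (intro bexI[of _ "cls (lower ws)"] exI[of _ ?P] conjI ballI impI)
    show "cls (lower ws) \<in> carrier U" by (rule cls_mem[OF lower_entries])
    show "?P \<subseteq> carrier U" using wedge_mem[OF D_mem D_mem] by auto
    show "finite ?P" using P(1) by simp
    have "card ?P \<le> card P" by (rule card_image_le[OF P(1)])
    moreover have "2 * card P \<le> kdim V" using P(3) by (simp add: kdim_eq)
    ultimately show "card ?P \<le> kdim V div 2" by linarith
    fix f w
    assume f: "f \<in> carrier (dual U)" and w: "w \<in> carrier U"
      and h: "(\<forall>x\<in>sp. f (act x v) = 0) \<and>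
        (\<forall>x\<in>lie_stabiliser sp act U v. f (act x (cls (lower ws))) = 0) \<and>
        (\<forall>p\<in>?P. f p = 0)"
    let ?b = "\<lambda>a b. f (wedge a b)"
    have form: "alternating_form V ?b" by (rule functional_form[OF f])
    have alt: "sk.alternating (lower_form ?b)" by (rule lower_form_alternating[OF form])
    \<comment> \<open>Vanishing of \<open>f\<close> on the orbit \<open>g v\<close> is applied to
      the rank one operator of \<open>p\<close> and \<open>q\<close>.\<close>
    have sym: "lower_form ?b (?e p) q = lower_form ?b p (?e q)" if "p \<in> S" "q \<in> S" for p q
    proof -
      let ?x = "\<lambda>a\<in>carrier V. D (sk.rank_one p q (C a))"
      have x: "?x \<in> sp" by (rule lower_op_sp[OF sk.rank_one_skew_adjoint])
      have "lower_form ?b (?e p) q - lower_form ?b p (?e q) =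
          wedge_eval (lower_form ?b) (wedge_act (sk.rank_one p q) (lift us))"
        by (rule sk.wedge_eval_rank_one[OF alt, symmetric])
      also have "\<dots> = wedge_eval ?b (wedge_act ?x us)" by (rule wedge_eval_lift[OF _ us(1)]) simp
      also have "\<dots> = f (act ?x v)"
        unfolding us(2) by (rule functional_act[OF f sp_hom[OF x] us(1), symmetric])
      also have "\<dots> = 0" using h x by blast
      finally show ?thesis by simp
    qed
    \<comment> \<open>An operator commuting with that of \<open>v\<close> stabilises
      \<open>v\<close>, because the passage from bivectors to operators is equivariant and
      injective; so \<open>f\<close> vanishes on what it makes of \<open>ws\<close>.\<close>
    have inv: "wedge_eval (lower_form ?b) (wedge_act y ws) = 0"
      if y: "sk.skew_adjoint y" "\<forall>a. y (?e a) = ?e (y a)" "range y \<subseteq> S" for y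
    proof -
      let ?x = "\<lambda>a\<in>carrier V. D (y (C a))"
      have x: "?x \<in> sp" by (rule lower_op_sp[OF y(1)])
      have "act ?x v = \<zero>\<^bsub>U\<^esub>"
      proof (rule ext2_lie_act_eqI[OF sp_hom[OF x] v])
        fix g vs2 assume g: "g \<in> carrier (dual U)" and vs2: "entries vs2" "v = cls vs2"
        have "wedge_eval (\<lambda>a b. g (wedge a b)) (wedge_act ?x vs2) = g (act ?x (cls us))"
          using functional_act[OF g sp_hom[OF x] vs2(1)] vs2(2) us(2) by simp
        also have "\<dots> = wedge_eval (\<lambda>a b. g (wedge a b)) (wedge_act ?x us)"
          by (rule functional_act[OF g sp_hom[OF x] us(1)])
        also have "\<dots> = wedge_eval (lower_form (\<lambda>a b. g (wedge a b))) (wedge_act y (lift us))"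
          by (rule wedge_eval_lift[OF _ us(1), symmetric]) simp
        also have "\<dots> = 0"
        proof (rule sk.wedge_eval_eq_0[OF S_subspace fin_span_C S_nondeg])
          show "set (wedge_act y (lift us)) \<subseteq> UNIV \<times> S \<times> S"
            using le y(3) by (auto simp: wedge_act_def)
          show "sk.op_of (wedge_act y (lift us)) w = 0" for w
            unfolding sk.op_of_wedge_act[OF y(1)] using y(2) by simp
        qed (rule lower_form_alternating[OF functional_form[OF g]])
        finally show "wedge_eval (\<lambda>a b. g (wedge a b)) (wedge_act ?x vs2) = g \<zero>\<^bsub>U\<^esub>"
          by (simp add: E.dual_zero_arg[OF g])
      qed simp
      then have "?x \<in> lie_stabiliser sp act U v" using x by (simp add: lie_stabiliser_def)
      then have "0 = f (act ?x (cls (lower ws)))" using h by simp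
      also have "\<dots> = wedge_eval ?b (wedge_act ?x (lower ws))"
        by (rule functional_act[OF f sp_hom[OF x] lower_entries])
      also have "\<dots> = wedge_eval (lower_form ?b) (wedge_act y ws)"
        by (rule wedge_eval_lower[OF _ ws, symmetric]) (simp add: D_mem CD_S)
      finally show ?thesis by simp
    qed
    have P0: "\<forall>(p, q)\<in>P. lower_form ?b p q = 0" using h by (auto simp: lower_form_def)
    have z: "\<forall>a\<in>S. \<forall>b\<in>S. lower_form ?b a b = 0"
    proof (rule gen[THEN spec, THEN mp], intro conjI alt P0)
      show "\<forall>a\<in>S. \<forall>b\<in>S. lower_form ?b (?e a) b = lower_form ?b a (?e b)" using sym by blast
      show "\<forall>y. sk.skew_adjoint y \<longrightarrow> (\<forall>a. y (?e a) = ?e (y a)) \<longrightarrow> range y \<subseteq> S \<longrightarrow>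
          wedge_eval (lower_form ?b) (wedge_act y ws) = 0"
        by (intro allI impI) (rule inv)
    qed
    have b0: "?b a b = 0" if "a \<in> carrier V" "b \<in> carrier V" for a b
      using z that by (force simp: lower_form_def DC)
    obtain vs2 where vs2: "entries vs2" "w = cls vs2" using cls_exists[OF w] by blast
    have "wedge_eval ?b vs2 = 0" using vs2(1)
      by (induction vs2) (auto simp: b0)
    then show "f w = 0" using functional_cls[OF f vs2(1)] vs2(2) by simp
  qed
qed

text \<open>Supplies hypothesis \<open>C\<close> of \<open>ind_stabiliser_eq\<close>: the
  functionals are the forms \<open>\<omega>(y j a, b)\<close> of
  \<open>self_adjoint_commutant\<close>, tested on the bivectors of \<open>p j\<close> and
  \<open>q j\<close>.\<close>

lemma tangent_functionals:
  assumes z: "z \<in> carrier U"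
  shows "\<exists>f w. \<forall>j<kdim V div 2. f j \<in> carrier (dual U) \<and> w j \<in> carrier U \<and>
    (\<forall>x\<in>sp. f j (act x z) = 0) \<and> f j (w j) \<noteq> 0 \<and> (\<forall>i<j. f j (w i) = 0)"
proof -
  obtain us where us: "entries us" "z = cls us" using cls_exists[OF z] by blast
  let ?e = "sk.op_of (lift us)"
  obtain n y p q where n: "fs.dim S = 2 * n"
    and y: "\<forall>j<n. sk.self_adjoint (y j) \<and> (\<forall>a. y j (?e a) = ?e (y j a)) \<and> range (y j) \<subseteq> S \<and>
      p j \<in> S \<and> q j \<in> S \<and> om' (y j (p j)) (q j) \<noteq> 0"
    and tr: "\<forall>j<n. \<forall>i<j. om' (y j (p i)) (q i) = 0"
    using sk.self_adjoint_commutant[OF self_adjoint_op_of[OF us(1)]] by (elim exE conjE) (rule that)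
  have n2: "kdim V div 2 = n" using n by (simp add: kdim_eq)
  define b where "b j a c = om' (y j (C a)) (C c)" for j a c
  have bD: "b j (D f) (D g) = om' (y j f) g" if "f \<in> S" "g \<in> S" for j f g
    using that by (simp add: b_def CD_S)
  have form: "alternating_form V (b j)" if j: "j < n" for j
  proof -
    have l: "fs.lin (y j)" and sa: "\<And>f g. om' (y j f) g = om' f (y j g)"
      using y j by (auto simp: sk.self_adjoint_def)
    show ?thesis
      unfolding alternating_form_def b_def
    proof (intro conjI ballI allI)
      fix a u c assume a: "a \<in> carrier V" and u: "u \<in> carrier V"
      show "om' (y j (C a)) (C a) = 0"
        using sa[of "C a" "C a"] sk.om_skew[of "C a" "y j (C a)"] by simp
      show "om' (y j (C (c \<odot>\<^bsub>V\<^esub> a))) (C u) = c * om' (y j (C a)) (C u)"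
        "om' (y j (C u)) (C (c \<odot>\<^bsub>V\<^esub> a)) = c * om' (y j (C u)) (C a)"
        by (simp_all only: C_scale[OF a] fs.lin_scale[OF l] sk.om_simps)
      fix a' assume a': "a' \<in> carrier V"
      show "om' (y j (C (a \<oplus>\<^bsub>V\<^esub> a'))) (C u) = om' (y j (C a)) (C u) + om' (y j (C a')) (C u)"
        "om' (y j (C u)) (C (a \<oplus>\<^bsub>V\<^esub> a')) = om' (y j (C u)) (C a) + om' (y j (C u)) (C a')"
        by (simp_all only: C_add[OF a a'] fs.lin_add[OF l] sk.om_simps)
    qed
  qed
  have "\<forall>j. \<exists>f. j < n \<longrightarrow> f \<in> carrier (dual U) \<and> (\<forall>us. entries us \<longrightarrow> f (cls us) = wedge_eval (b j) us)"
    using form_functional[OF form] by blast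
  then obtain f where "\<forall>j. j < n \<longrightarrow> f j \<in> carrier (dual U) \<and>
      (\<forall>us. entries us \<longrightarrow> f j (cls us) = wedge_eval (b j) us)" by (rule choice[THEN exE])
  then have f: "f j \<in> carrier (dual U)" "entries us \<Longrightarrow> f j (cls us) = wedge_eval (b j) us"
    if "j < n" for j us using that by blast+
  let ?w = "\<lambda>j. wedge (D (p j)) (D (q j))"
  have fw: "f j (?w i) = om' (y j (p i)) (q i)" if "j < n" "i < n" for i j
    using f(2)[OF that(1), of "[(1, D (p i), D (q i))]"] bD[of "p i" "q i" j] y that D_mem by simp
  have fx: "f j (act x z) = 0" if j: "j < n" and x: "x \<in> sp" for j x
  proof -
    have xV: "x \<in> carrier V \<rightarrow> carrier V" using linear_hom_mem[OF sp_hom[OF x]] by blast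
    let ?y = "\<lambda>g. C (x (D g))"
    have "f j (act x z) = wedge_eval (b j) (wedge_act x us)"
      unfolding us(2) ext2_lie_act_cls[OF sp_hom[OF x] us(1)] by (rule f(2)[OF j entries_wedge_act[OF xV us(1)]])
    also have "\<dots> = wedge_eval (lower_form (b j)) (wedge_act ?y (lift us))"
      by (rule wedge_eval_lift[OF _ us(1), symmetric]) (simp add: DC linear_hom_mem[OF sp_hom[OF x]])
    also have "\<dots> = 0"
    proof (rule sk.wedge_eval_invariant[OF S_subspace fin_span_C S_nondeg lift_entries[OF us(1)]
          lift_op_skew_adjoint[OF x] _ lower_form_alternating[OF form[OF j]]])
      show "?y ` S \<subseteq> S" using linear_hom_mem[OF sp_hom[OF x] D_mem] by blast
      fix g h assume gh: "g \<in> S" "h \<in> S"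
      have eS: "?e k \<in> S" for k by (rule sk.op_of_mem[OF S_subspace lift_entries[OF us(1)]])
      \<comment> \<open>Since \<open>y j\<close> commutes with the self-adjoint \<open>?e\<close>,
        its form is symmetric under \<open>?e\<close>.\<close>
      have "y j (?e g) = ?e (y j g)" using y j by blast
      then show "lower_form (b j) (?e g) h = lower_form (b j) g (?e h)"
        using sk.op_of_self_adjoint[of "lift us"]
        by (simp add: lower_form_def bD eS gh sk.self_adjoint_def)
    qed
    finally show ?thesis .
  qed
  show ?thesis
    unfolding n2
    by (intro exI[of _ f] exI[of _ ?w] allI impI conjI ballI)
      (use f(1) fx fw y tr wedge_mem[OF D_mem D_mem] in auto)
qed

lemma sp_gnib: "gnib G Act sp act U"
proof -
  obtain A' C' D' where "coordinates U A' C' D'" using ext_coordinates_exist by blast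
  then interpret E: coordinates U A' C' D' .
  have zero: "(\<lambda>a\<in>carrier V. \<zero>\<^bsub>V\<^esub>) \<in> sp"
  proof -
    have "sk.skew_adjoint (\<lambda>_. 0)" by (rule sk.skew_adjointI) (auto intro!: fs.linI simp: sk.om_0)
    from sp_closed(1)[OF lower_op_sp[OF this] lower_op_sp[OF this]] show ?thesis .
  qed
  have lie: "lie_action U A' C' D' sp act"
  proof (intro lie_action.intro lie_action_axioms.intro E.coordinates_axioms)
    show "act x \<in> linear_hom U U" if "x \<in> sp" for x
      by (rule ext2_lie_act_hom[OF sp_hom[OF that]])
    show "\<exists>x\<in>sp. \<forall>u\<in>carrier U. act x u = \<zero>\<^bsub>U\<^esub>"
    proof (intro bexI[OF _ zero] ballI ext2_lie_act_eqI sp_hom[OF zero])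
      show "wedge_eval (\<lambda>a b. f (wedge a b)) (wedge_act (\<lambda>a\<in>carrier V. \<zero>\<^bsub>V\<^esub>) us) = f \<zero>\<^bsub>U\<^esub>"
        if "f \<in> carrier (dual U)" "entries us" for f us
        using wedge_act_zero[OF functional_form[OF that(1)] that(2)] E.dual_zero_arg[OF that(1)] by simp
    qed auto
    fix x y c assume x: "x \<in> sp"
    note hx = sp_hom[OF x]
    show "\<exists>z\<in>sp. \<forall>u\<in>carrier U. act z u = c \<odot>\<^bsub>U\<^esub> act x u"
    proof (intro bexI[OF _ sp_closed(3)[OF x x]] ballI ext2_lie_act_eqI sp_hom[OF sp_closed(3)[OF x x]])
      fix u assume u: "u \<in> carrier U"
      show "c \<odot>\<^bsub>U\<^esub> act x u \<in> carrier U" using ext2_lie_act_mem[OF hx u] by simp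
      show "wedge_eval (\<lambda>a b. f (wedge a b)) (wedge_act (\<lambda>a\<in>carrier V. c \<odot>\<^bsub>V\<^esub> x a) us) =
          f (c \<odot>\<^bsub>U\<^esub> act x u)"
        if "f \<in> carrier (dual U)" "entries us" "u = cls us" for f us
        using wedge_act_sum(2)[OF functional_form[OF that(1)] hx hx that(2)] functional_act[OF that(1) hx that(2)]
          dual_smult[OF that(1) ext2_lie_act_mem[OF hx u]] that(3) by simp
    qed
    assume y: "y \<in> sp"
    note hy = sp_hom[OF y]
    show "\<exists>z\<in>sp. \<forall>u\<in>carrier U. act z u = act x u \<oplus>\<^bsub>U\<^esub> act y u"
    proof (intro bexI[OF _ sp_closed(2)[OF x y]] ballI ext2_lie_act_eqI sp_hom[OF sp_closed(2)[OF x y]])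
      fix u assume u: "u \<in> carrier U"
      note m = ext2_lie_act_mem[OF hx u] ext2_lie_act_mem[OF hy u]
      show "act x u \<oplus>\<^bsub>U\<^esub> act y u \<in> carrier U" using m by simp
      show "wedge_eval (\<lambda>a b. f (wedge a b)) (wedge_act (\<lambda>a\<in>carrier V. x a \<oplus>\<^bsub>V\<^esub> y a) us) =
          f (act x u \<oplus>\<^bsub>U\<^esub> act y u)"
        if "f \<in> carrier (dual U)" "entries us" "u = cls us" for f us
        using wedge_act_sum(1)[OF functional_form[OF that(1)] hx hy that(2)] functional_act[OF that(1) _ that(2)]
          dual_add[OF that(1) m] that(3) hx hy by simp
    qed
    let ?z = "\<lambda>a\<in>carrier V. x (y a) \<oplus>\<^bsub>V\<^esub> (- 1) \<odot>\<^bsub>V\<^esub> y (x a)"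
    have z: "?z \<in> sp" by (rule sp_closed(4)[OF x y])
    have xV: "x \<in> carrier V \<rightarrow> carrier V" "y \<in> carrier V \<rightarrow> carrier V"
      using linear_hom_mem[OF hx] linear_hom_mem[OF hy] by blast+
    show "\<exists>z\<in>sp. \<forall>u\<in>carrier U. act x (act y u) =
        act y (act x u) \<oplus>\<^bsub>U\<^esub> act z u"
    proof (intro bexI[OF _ z] ballI)
      fix u assume u: "u \<in> carrier U"
      note m = ext2_lie_act_mem[OF hy ext2_lie_act_mem[OF hx u]] ext2_lie_act_mem[OF sp_hom[OF z] u]
      obtain us where us: "entries us" "u = cls us" using cls_exists[OF u] by blast
      note ea = entries_wedge_act[OF xV(1) us(1)] entries_wedge_act[OF xV(2) us(1)]
      show "act x (act y u) =
          act y (act x u) \<oplus>\<^bsub>U\<^esub> act ?z u"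
      proof (rule ext_eqI)
        show "act x (act y u) \<in> carrier U"
          by (rule ext2_lie_act_mem[OF hx ext2_lie_act_mem[OF hy u]])
        show "act y (act x u) \<oplus>\<^bsub>U\<^esub> act ?z u \<in> carrier U"
          using m by simp
        fix f assume f: "f \<in> carrier (dual U)"
        let ?b = "\<lambda>a b. f (wedge a b)"
        have "f (act x (act y u)) = wedge_eval ?b (wedge_act x (wedge_act y us))"
          unfolding us(2) ext2_lie_act_cls[OF hy us(1)] by (rule functional_act[OF f hx ea(2)])
        moreover have "f (act y (act x u)) = wedge_eval ?b (wedge_act y (wedge_act x us))"
          unfolding us(2) ext2_lie_act_cls[OF hx us(1)] by (rule functional_act[OF f hy ea(1)])
        moreover have "f (act ?z u) = wedge_eval ?b (wedge_act ?z us)"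
          unfolding us(2) by (rule functional_act[OF f sp_hom[OF z] us(1)])
        ultimately show "f (act x (act y u)) =
            f (act y (act x u) \<oplus>\<^bsub>U\<^esub> act ?z u)"
          unfolding dual_add[OF f m] wedge_act_sum(3)[OF functional_form[OF f] hx hy us(1)] by simp
      qed
    qed
  qed
  show ?thesis
    unfolding gnib_def Let_def nilpotent_vector_def
    by (intro allI impI lie_action.ind_stabiliser_eq[OF lie, where n = "kdim V div 2"]
        generic_direction tangent_functionals) auto
qed

end

theorem theorem3p3:
  fixes V :: "('k::{alg_closed_field, field_char_0}, 'v) module"
    and \<omega> :: "'v \<Rightarrow> 'v \<Rightarrow> 'k"
  assumes "vectorspace class_ring V"
    and "vectorspace.fin_dim class_ring V"
    and "even (vectorspace.dim class_ring V)"
    and "symplectic_form V \<omega>"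
  shows "gnib (Sp_group V \<omega>) (ext2_group_act V) (sp_algebra V \<omega>) (ext2_lie_act V) (ext2 V)"
proof -
  obtain A C D where "coordinates V A C D" using coordinates_exist[OF assms(1,2)] by blast
  then interpret symplectic V A C D \<omega>
    by (intro symplectic.intro ext_square.intro symplectic_axioms.intro assms(4))
  show ?thesis by (rule sp_gnib)
qed

end
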